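(* Let $g\ge2$ and $G\in\Gamma_{\ge3}(g)$. For $n\ge0$ let $\mathscr G_n$ be the collection of graphs obtained from $G$ by subdividing each edge $e$ of $G$ with $n_e\ge0$ new vertices, one graph for each tuple $(n_e)_{e\in E(G)}$ with $\sum_e n_e=n$. Let $$\mathscr Z_G=\frac{1}{|\operatorname{Aut}G|}\sum_{n\ge0}\sum_{H\in\mathscr G_n}\widetilde W_H(b,w_-,w_+),$$ a formal power series in $b,w_-,w_+$, and let $\mathscr X_G(x)\in\mathbb{Q}[t][[x]]$ be the result of the substitution $b\gets\mathscr T_b$, $w_+\gets\mathscr T_w^++\mathscr T_w^-$, $w_-\gets t^{-1}\mathscr T_w^++t\,\mathscr T_w^-$. Then $$\mathscr W_g(x)=\sum_{G\in\Gamma_{\ge3}(g)}\mathscr X_G(x).$$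
   Context: Graphs may have loops and parallel edges. A coloring is $c\colon V\to\{0,1\}$ ($0$ white, $1$ black). For a vertex $v$, its black-neighbor count is the number of edges joining $v$ to black vertices, with multiplicity, loops not counted. Full $W$-polynomial: $\widetilde W_K=\sum_c b^{\#\text{black}}w_+^{\#\text{white with even count}}w_-^{\#\text{white with odd count}}$; black-white polynomial $W_K(t)=\sum_c t^{\#\text{white vertices with even count}}$. $\operatorname{Aut}$ includes permutations of vertices and parallel edges and flips/permutations of loops. The degree of a vertex counts loops twice. $\Gamma(g)$ is the set of isomorphism classes of connected graphs with first Betti number $g$ ($=1-|V|+|E|$), $\Gamma_{\ge3}(g)\subseteq\Gamma(g)$ the (finite) subset with all vertex degrees at least $3$, and $\mathscr W_g(x)=\sum_{G\in\Gamma(g)}W_G(t)x^{v(G)}/|\operatorname{Aut}G|$, $v(G)$ the number of vertices. Rooted tree series: with sums over isomorphism classes of rooted trees $T$ (root-preserving automorphisms) and colorings $c$, $\mathscr T_w^+$ (resp. $\mathscr T_w^-$, $\mathscr T_b$) is $\sum t^{\#\{\text{white vertices with even count}\}}x^{v(T)}/|\operatorname{Aut}T|$ over pairs $(T,c)$ whose root is white with an even number of black children (resp. white with an odd number of black children; black). *)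

theory Defs
  imports
    "HOL-Library.FuncSet"
    "HOL-Library.Groups_Big_Fun"
    "HOL-Combinatorics.Permutations"
    "HOL-Computational_Algebra.Computational_Algebra"
begin

section \<open>Graphs with loops and parallel edges\<close>

text \<open>
  A graph is given by its vertices and its darts (half-edges): an edge is a pair of darts
  \<open>{h, opp h}\<close>, and \<open>base h\<close> is the vertex at which the dart \<open>h\<close> is attached.
  A loop has two distinct darts with the same base, so automorphisms can flip it.
  Values of \<open>base\<close> and \<open>opp\<close> outside \<open>darts\<close> carry no meaning.
\<close>

record ('v, 'h) graph =
  verts :: "'v set"
  darts :: "'h set"
  base :: "'h \<Rightarrow> 'v"
  opp :: "'h \<Rightarrow> 'h"

definition finite_graph :: "('v, 'h) graph \<Rightarrow> bool" where
  "finite_graph G \<longleftrightarrow>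
     finite (verts G) \<and> finite (darts G) \<and>
     (\<forall>h\<in>darts G. base G h \<in> verts G \<and> opp G h \<in> darts G \<and>
        opp G h \<noteq> h \<and> opp G (opp G h) = h)"

definition edges :: "('v, 'h) graph \<Rightarrow> 'h set set" where
  "edges G = (\<lambda>h. {h, opp G h}) ` darts G"

definition vertex_degree :: "('v, 'h) graph \<Rightarrow> 'v \<Rightarrow> nat" where
  "vertex_degree G v = card {h \<in> darts G. base G h = v}"

definition connected_graph :: "('v, 'h) graph \<Rightarrow> bool" where
  "connected_graph G \<longleftrightarrow> verts G \<noteq> {} \<and>
     (\<forall>u\<in>verts G. \<forall>v\<in>verts G.
        (u, v) \<in> {(base G h, base G (opp G h)) | h. h \<in> darts G}\<^sup>*)"

text \<open>This is the first Betti number only for connected graphs.\<close>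

definition betti :: "('v, 'h) graph \<Rightarrow> int" where
  "betti G = 1 - int (card (verts G)) + int (card (edges G))"

definition graph_isos :: "('v, 'h) graph \<Rightarrow> ('w, 'k) graph \<Rightarrow> (('v \<Rightarrow> 'w) \<times> ('h \<Rightarrow> 'k)) set" where
  "graph_isos G H = {(\<sigma>, \<pi>).
     bij_betw \<sigma> (verts G) (verts H) \<and> bij_betw \<pi> (darts G) (darts H) \<and>
     (\<forall>h\<in>darts G. base H (\<pi> h) = \<sigma> (base G h) \<and>
        opp H (\<pi> h) = \<pi> (opp G h))}"

text \<open>Automorphisms are normalised to be the identity off the graph, so that they can be counted.\<close>

definition Aut :: "('v, 'h) graph \<Rightarrow> (('v \<Rightarrow> 'v) \<times> ('h \<Rightarrow> 'h)) set" where
  "Aut G = {(\<sigma>, \<pi>) \<in> graph_isos G G. \<sigma> permutes verts G \<and> \<pi> permutes darts G}"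

text \<open>
  Every finite graph is isomorphic to one whose vertices and darts are natural numbers, so
  isomorphism classes are formed there.
\<close>

type_synonym ngraph = "(nat, nat) graph"

definition iso_rel :: "(ngraph \<times> ngraph) set" where
  "iso_rel = {(G, H). finite_graph G \<and> finite_graph H \<and> graph_isos G H \<noteq> {}}"

definition iso_classes :: "nat \<Rightarrow> ngraph set set" where
  "iso_classes g = {G. finite_graph G \<and> connected_graph G \<and> betti G = int g} // iso_rel"

definition iso_classes_ge3 :: "nat \<Rightarrow> ngraph set set" where
  "iso_classes_ge3 g =
     {G. finite_graph G \<and> connected_graph G \<and> betti G = int g \<and>
         (\<forall>v\<in>verts G. 3 \<le> vertex_degree G v)} // iso_rel"

text \<open>Only isomorphism-invariant quantities are evaluated at a representative.\<close>

definition rep :: "'a set \<Rightarrow> 'a" where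
  "rep C = (SOME x. x \<in> C)"

section \<open>Colorings and the two polynomials\<close>

text \<open>Color 0 is white and color 1 is black.\<close>

definition colorings :: "('v, 'h) graph \<Rightarrow> ('v \<Rightarrow> nat) set" where
  "colorings G = verts G \<rightarrow>\<^sub>E {0, 1}"

definition black_nbrs :: "('v, 'h) graph \<Rightarrow> ('v \<Rightarrow> nat) \<Rightarrow> 'v \<Rightarrow> nat" where
  "black_nbrs G c v =
     card {e \<in> edges G. \<exists>u. u \<noteq> v \<and> c u = 1 \<and> base G ` e = {v, u}}"

definition black :: "('v, 'h) graph \<Rightarrow> ('v \<Rightarrow> nat) \<Rightarrow> 'v set" where
  "black G c = {v \<in> verts G. c v = 1}"

definition white_even :: "('v, 'h) graph \<Rightarrow> ('v \<Rightarrow> nat) \<Rightarrow> 'v set" where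
  "white_even G c = {v \<in> verts G. c v = 0 \<and> even (black_nbrs G c v)}"

definition white_odd :: "('v, 'h) graph \<Rightarrow> ('v \<Rightarrow> nat) \<Rightarrow> 'v set" where
  "white_odd G c = {v \<in> verts G. c v = 0 \<and> odd (black_nbrs G c v)}"

definition full_W :: "('v, 'h) graph \<Rightarrow> 'a \<Rightarrow> 'a \<Rightarrow> 'a \<Rightarrow> 'a::comm_semiring_1" where
  "full_W G b wm wp =
     (\<Sum>c\<in>colorings G. b ^ card (black G c) * wp ^ card (white_even G c) * wm ^ card (white_odd G c))"

definition bw_poly :: "('v, 'h) graph \<Rightarrow> rat poly" where
  "bw_poly G = (\<Sum>c\<in>colorings G. monom 1 (card (white_even G c)))"

definition W_series :: "nat \<Rightarrow> rat poly fps" where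
  "W_series g = Abs_fps (\<lambda>n.
     \<Sum>C\<in>{C \<in> iso_classes g. card (verts (rep C)) = n}.
       smult (1 / of_nat (card (Aut (rep C)))) (bw_poly (rep C)))"

section \<open>Rooted trees\<close>

definition rooted_trees :: "(ngraph \<times> nat) set" where
  "rooted_trees =
     {(T, r). finite_graph T \<and> connected_graph T \<and> betti T = 0 \<and> r \<in> verts T}"

definition rooted_iso_rel :: "((ngraph \<times> nat) \<times> (ngraph \<times> nat)) set" where
  "rooted_iso_rel = {((T, r), (T', r')).
     (T, r) \<in> rooted_trees \<and> (T', r') \<in> rooted_trees \<and>
     (\<exists>(\<sigma>, \<pi>) \<in> graph_isos T T'. \<sigma> r = r')}"

definition root_Aut :: "('v, 'h) graph \<Rightarrow> 'v \<Rightarrow> (('v \<Rightarrow> 'v) \<times> ('h \<Rightarrow> 'h)) set" where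
  "root_Aut T r = {(\<sigma>, \<pi>) \<in> Aut T. \<sigma> r = r}"

definition tree_series :: "(ngraph \<Rightarrow> nat \<Rightarrow> (nat \<Rightarrow> nat) \<Rightarrow> bool) \<Rightarrow> rat poly fps" where
  "tree_series P = Abs_fps (\<lambda>n.
     \<Sum>C\<in>{C \<in> rooted_trees // rooted_iso_rel. card (verts (fst (rep C))) = n}.
       case rep C of (T, r) \<Rightarrow>
         (\<Sum>c\<in>{c \<in> colorings T. P T r c}.
            monom (1 / of_nat (card (root_Aut T r))) (card (white_even T c))))"

text \<open>All neighbors of the root are its children, so \<open>black_nbrs\<close> counts its black children.\<close>

definition T_white_even :: "rat poly fps" where
  "T_white_even = tree_series (\<lambda>T r c. c r = 0 \<and> even (black_nbrs T c r))"

definition T_white_odd :: "rat poly fps" where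
  "T_white_odd = tree_series (\<lambda>T r c. c r = 0 \<and> odd (black_nbrs T c r))"

definition T_black :: "rat poly fps" where
  "T_black = tree_series (\<lambda>T r c. c r = 1)"

section \<open>Subdivisions\<close>

text \<open>
  Subdividing the edge \<open>{h, opp h}\<close> with \<open>m = n {h, opp h}\<close> new vertices replaces it by a path
  with \<open>m + 1\<close> edges. Walking along it from \<open>base h\<close>, the successive darts are
  \<open>(h, 0), \<dots>, (h, m)\<close>; the reverse of \<open>(h, i)\<close> is \<open>(opp h, m - i)\<close>. The \<open>i\<close>-th new vertex seen
  from \<open>h\<close> is the \<open>(m + 1 - i)\<close>-th one seen from \<open>opp h\<close>, and is named by the unordered pair of
  these two descriptions, so no orientation of the edges has to be chosen.
\<close>

definition subdiv_vertex :: "('v, 'h) graph \<Rightarrow> ('h set \<Rightarrow> nat) \<Rightarrow> 'h \<Rightarrow> nat \<Rightarrow> ('h \<times> nat) set" where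
  "subdiv_vertex G n h i =
     {(h, i), (opp G h, n {h, opp G h} + 1 - i)}"

definition subdivide ::
  "('v, 'h) graph \<Rightarrow> ('h set \<Rightarrow> nat) \<Rightarrow> ('v + ('h \<times> nat) set, 'h \<times> nat) graph" where
  "subdivide G n =
     \<lparr> verts = Inl ` verts G \<union>
         {Inr (subdiv_vertex G n h i) | h i. h \<in> darts G \<and> 1 \<le> i \<and> i \<le> n {h, opp G h}},
       darts = {(h, i). h \<in> darts G \<and> i \<le> n {h, opp G h}},
       base = (\<lambda>(h, i). if i = 0 then Inl (base G h) else Inr (subdiv_vertex G n h i)),
       opp = (\<lambda>(h, i). (opp G h, n {h, opp G h} - i)) \<rparr>"

definition subdiv_tuples :: "('v, 'h) graph \<Rightarrow> nat \<Rightarrow> ('h set \<Rightarrow> nat) set" where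
  "subdiv_tuples G m = {n \<in> edges G \<rightarrow>\<^sub>E UNIV. (\<Sum>e\<in>edges G. n e) = m}"

section \<open>The series of a core graph and its substitution\<close>

text \<open>
  A series in \<open>b, w\<^sub>-, w\<^sub>+\<close> is an iterated power series \<open>F\<close> in which
  \<open>F $ i $ j $ k\<close> is the coefficient of \<open>b\<^sup>i w\<^sub>-\<^sup>j w\<^sub>+\<^sup>k\<close>.
\<close>

type_synonym fps3 = "rat fps fps fps"

definition var_b :: fps3 where "var_b = fps_X"
definition var_wm :: fps3 where "var_wm = fps_const fps_X"
definition var_wp :: fps3 where "var_wp = fps_const (fps_const fps_X)"

text \<open>
  The infinite sum over \<open>m\<close> is taken coefficientwise: the total degree of the \<open>m\<close>-th term is
  the number of vertices of \<open>G\<close> plus \<open>m\<close>, so each coefficient has finite support in \<open>m\<close>.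
\<close>

definition Z_series :: "('v, 'h) graph \<Rightarrow> fps3" where
  "Z_series G = Abs_fps (\<lambda>i. Abs_fps (\<lambda>j. Abs_fps (\<lambda>k.
     1 / of_nat (card (Aut G)) *
     Sum_any (\<lambda>m. (\<Sum>n\<in>subdiv_tuples G m. full_W (subdivide G n) var_b var_wm var_wp) $ i $ j $ k))))"

text \<open>
  The substitution involves \<open>t\<^sup>-\<^sup>1\<close>, so it is carried out over the field of rational functions
  in \<open>t\<close>, into which series over the polynomial ring are embedded.
\<close>

definition t_var :: "rat poly fract" where
  "t_var = to_fract [:0, 1:]"

definition fps_to_ratfun :: "rat poly fps \<Rightarrow> rat poly fract fps" where
  "fps_to_ratfun F = Abs_fps (\<lambda>n. to_fract (F $ n))"

text \<open>
  As for \<^term>\<open>fps_compose\<close>, the truncated sum is the full substitution whenever the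
  substituted series have zero constant term: then monomials of degree above \<open>N\<close> do not
  contribute to the coefficient at \<open>N\<close>.
\<close>

definition fps3_subst ::
  "fps3 \<Rightarrow> rat poly fract fps \<Rightarrow> rat poly fract fps \<Rightarrow> rat poly fract fps \<Rightarrow> rat poly fract fps" where
  "fps3_subst F b wm wp = Abs_fps (\<lambda>N.
     \<Sum>i\<le>N. \<Sum>j\<le>N. \<Sum>k\<le>N. to_fract [:F $ i $ j $ k:] * (b ^ i * wm ^ j * wp ^ k) $ N)"

definition X_series :: "('v, 'h) graph \<Rightarrow> rat poly fract fps" where
  "X_series G = fps3_subst (Z_series G)
     (fps_to_ratfun T_black)
     (fps_const (inverse t_var) * fps_to_ratfun T_white_even + fps_const t_var * fps_to_ratfun T_white_odd)
     (fps_to_ratfun T_white_even + fps_to_ratfun T_white_odd)"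

end

theory Submission
  imports Defs
begin

text \<open>
  A connected graph with first Betti number at least 2 is obtained from its 2-core by attaching a
  rooted tree at each vertex, and the 2-core is a subdivision of a unique graph \<open>G\<close> of minimum
  degree at least 3. An isomorphism between two such graphs preserves the core, hence splits into
  an isomorphism of cores and rooted isomorphisms of the attached trees; likewise isomorphisms of
  subdivisions come from isomorphisms of the subdivided graphs. Counting isomorphisms onto a fixed
  graph \<open>K\<close> therefore shows that the weights \<open>1 / (|Aut G| * \<Prod>|Aut T\<^sub>v|)\<close>, summed over all
  decompositions \<open>(G, n, T)\<close> of \<open>K\<close>, add up to \<open>1 / |Aut K|\<close>.

  On the side of the polynomials, a black root contributes \<open>T_black\<close>. The count of a white core
  vertex is the sum of its counts in the core and in its tree: if the former is even, the status of
  the root is that in the tree, and if it is odd, the status is flipped, which the factors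
  \<open>t\<^sup>-\<^sup>1\<close> and \<open>t\<close> in the substitution for \<open>w\<^sub>-\<close> account for. To stay with finite sums, the
  coefficient at \<open>N\<close> is computed with the tree series truncated to trees with at most \<open>N\<close> vertices.
\<close>

section \<open>Isomorphisms and connectedness\<close>

text \<open>The obstacle is that neither the tuples \<open>n\<close> nor the tree choices
  \<open>T\<close> are divided by the action of \<open>Aut G\<close>, so many of them yield
  isomorphic graphs. Orbit arguments are avoided: for a fixed target, every sum of isomorphism
  counts collapses to a single count one level below. This works because the source data can be
  recovered from the graph. The core is found from degrees within vertex sets, which requires
  minimum degree 2 in the subdivision, and the old vertices of a subdivision are found from degrees
  alone, which requires minimum degree 3 in \<open>G\<close>. The bound \<open>g \<ge> 2\<close>
  enters through existence: a core all of whose vertices have degree 2 has first Betti number 1, so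
  beyond that there is a branch vertex, and the paths between branch vertices can be contracted to
  edges. Two truncation constants occur. Trees are cut at \<open>N\<close> vertices, since larger
  ones only affect later coefficients. Tuples are cut at total \<open>3 * N\<close>, since the three
  exponents that matter for the coefficient at \<open>N\<close> are each at most
  \<open>N\<close>.\<close>

lemma finite_graphD:
  assumes "finite_graph G"
  shows "finite (verts G)" "finite (darts G)"
    and "h \<in> darts G \<Longrightarrow> base G h \<in> verts G"
    and "h \<in> darts G \<Longrightarrow> opp G h \<in> darts G"
    and "h \<in> darts G \<Longrightarrow> opp G h \<noteq> h"
    and "h \<in> darts G \<Longrightarrow> opp G (opp G h) = h"
  using assms by (auto simp: finite_graph_def)

lemma graph_isosD:
  assumes "(\<sigma>, \<pi>) \<in> graph_isos G H"
  shows "bij_betw \<sigma> (verts G) (verts H)" "bij_betw \<pi> (darts G) (darts H)"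
    and "h \<in> darts G \<Longrightarrow> base H (\<pi> h) = \<sigma> (base G h)"
    and "h \<in> darts G \<Longrightarrow> opp H (\<pi> h) = \<pi> (opp G h)"
    and "v \<in> verts G \<Longrightarrow> \<sigma> v \<in> verts H"
    and "h \<in> darts G \<Longrightarrow> \<pi> h \<in> darts H"
  using assms by (auto simp: graph_isos_def bij_betw_apply)

lemma graph_isos_refl: "(id, id) \<in> graph_isos G G"
  by (auto simp: graph_isos_def)

lemma graph_isos_comp:
  assumes "(\<sigma>, \<pi>) \<in> graph_isos G H" "(\<sigma>', \<pi>') \<in> graph_isos H K"
  shows "(\<sigma>' \<circ> \<sigma>, \<pi>' \<circ> \<pi>) \<in> graph_isos G K"
  using graph_isosD[OF assms(1)] graph_isosD[OF assms(2)]
  by (auto simp: graph_isos_def intro: bij_betw_trans)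

lemma graph_isos_inv:
  assumes "finite_graph G" "(\<sigma>, \<pi>) \<in> graph_isos G H"
  shows "(inv_into (verts G) \<sigma>, inv_into (darts G) \<pi>) \<in> graph_isos H G"
proof -
  note G = finite_graphD[OF assms(1)] and i = graph_isosD[OF assms(2)]
  have "base G (inv_into (darts G) \<pi> h) = inv_into (verts G) \<sigma> (base H h) \<and>
        opp G (inv_into (darts G) \<pi> h) = inv_into (darts G) \<pi> (opp H h)" if h: "h \<in> darts H" for h
  proof -
    obtain k where k: "k \<in> darts G" "h = \<pi> k"
      using h i(2) by (auto simp: bij_betw_def)
    then show ?thesis
      using G i by (simp add: bij_betw_inv_into_left)
  qed
  then show ?thesis
    using i(1,2) by (simp add: graph_isos_def bij_betw_inv_into)
qed

lemma graph_isos_sym: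
  assumes "finite_graph G" "graph_isos G H \<noteq> {}"
  shows "graph_isos H G \<noteq> {}"
  using assms graph_isos_inv by fastforce

lemma graph_isos_trans:
  assumes "graph_isos G H \<noteq> {}" "graph_isos H K \<noteq> {}"
  shows "graph_isos G K \<noteq> {}"
  using assms graph_isos_comp by fastforce

text \<open>
  Isomorphisms are counted in extensional form. The marked sets \<open>A\<close> and \<open>B\<close> are empty for
  plain graphs and consist of the root for rooted trees.
\<close>

definition marked_isos where
  "marked_isos G A H B = {(\<sigma>, \<pi>) \<in> graph_isos G H.
     \<sigma> \<in> extensional (verts G) \<and> \<pi> \<in> extensional (darts G) \<and> \<sigma> ` A = B}"

abbreviation isos where "isos G H \<equiv> marked_isos G {} H {}"

lemma marked_isos_iff:
  "(\<sigma>, \<pi>) \<in> marked_isos G A H B \<longleftrightarrow> (\<sigma>, \<pi>) \<in> graph_isos G H \<and>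
     \<sigma> \<in> extensional (verts G) \<and> \<pi> \<in> extensional (darts G) \<and> \<sigma> ` A = B"
  by (simp add: marked_isos_def)

lemma finite_marked_isos:
  assumes "finite_graph G" "finite_graph H"
  shows "finite (marked_isos G A H B)"
proof (rule finite_subset)
  show "marked_isos G A H B \<subseteq> (verts G \<rightarrow>\<^sub>E verts H) \<times> (darts G \<rightarrow>\<^sub>E darts H)"
    by (auto simp: marked_isos_def graph_isos_def PiE_def bij_betw_apply)
  show "finite ((verts G \<rightarrow>\<^sub>E verts H) \<times> (darts G \<rightarrow>\<^sub>E darts H))"
    using assms by (auto simp: finite_graphD intro!: finite_PiE)
qed

text \<open>Passes from an isomorphism with arbitrary values off the graph to the representative
  that is counted.\<close>

lemma restrict_marked_isos:
  assumes "finite_graph G" "(\<sigma>, \<pi>) \<in> graph_isos G H" "\<sigma> ` A = B" "A \<subseteq> verts G"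
  shows "(restrict \<sigma> (verts G), restrict \<pi> (darts G)) \<in> marked_isos G A H B"
proof -
  note G = finite_graphD[OF assms(1)] and i = graph_isosD[OF assms(2)]
  have "restrict \<sigma> (verts G) ` A = B"
    using assms(3,4) by auto
  moreover have "bij_betw (restrict \<sigma> (verts G)) (verts G) (verts H)"
    "bij_betw (restrict \<pi> (darts G)) (darts G) (darts H)"
    using i(1,2) by simp_all
  ultimately show ?thesis
    using G i by (simp add: marked_isos_iff graph_isos_def)
qed

lemma isos_empty_iff:
  assumes "finite_graph G"
  shows "isos G H = {} \<longleftrightarrow> graph_isos G H = {}"
proof -
  have "isos G H \<subseteq> graph_isos G H" by (auto simp: marked_isos_def)
  moreover have "\<exists>p. p \<in> isos G H" if "p \<in> graph_isos G H" for p
    using restrict_marked_isos[OF assms, of "fst p" "snd p" H "{}" "{}"] that by auto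
  ultimately show ?thesis by blast
qed

text \<open>Composing with the isomorphism of targets is injective on extensional maps. The source
  stays fixed because the weights are normalised by automorphisms of the source.\<close>

lemma card_marked_isos_target_le:
  assumes "finite_graph G" "finite_graph H" "finite_graph K" "A \<subseteq> verts G" "B \<subseteq> verts H"
    and i: "(\<alpha>, \<beta>) \<in> graph_isos H K" and "\<alpha> ` B = C"
  shows "card (marked_isos G A H B) \<le> card (marked_isos G A K C)"
proof (rule card_inj_on_le)
  note i = graph_isosD[OF i]
  let ?f = "\<lambda>(\<sigma>, \<pi>). (restrict (\<alpha> \<circ> \<sigma>) (verts G), restrict (\<beta> \<circ> \<pi>) (darts G))"
  show "?f ` marked_isos G A H B \<subseteq> marked_isos G A K C"
    using assms
    by (auto simp: image_comp[symmetric] marked_isos_iff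
        intro!: restrict_marked_isos graph_isos_comp)
  show "inj_on ?f (marked_isos G A H B)"
  proof (rule inj_onI, clarify)
    fix \<sigma> \<pi> \<sigma>' \<pi>'
    assume a: "(\<sigma>, \<pi>) \<in> marked_isos G A H B" "(\<sigma>', \<pi>') \<in> marked_isos G A H B"
      and e: "restrict (\<alpha> \<circ> \<sigma>) (verts G) = restrict (\<alpha> \<circ> \<sigma>') (verts G)"
        "restrict (\<beta> \<circ> \<pi>) (darts G) = restrict (\<beta> \<circ> \<pi>') (darts G)"
    note a1 = a(1)[unfolded marked_isos_iff] and a2 = a(2)[unfolded marked_isos_iff]
    note j = graph_isosD[OF a1[THEN conjunct1]] and j' = graph_isosD[OF a2[THEN conjunct1]]
    have "\<sigma> x = \<sigma>' x" if "x \<in> verts G" for x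
      using fun_cong[OF e(1), of x] that i(1) j(5) j'(5)
      by (auto simp: bij_betw_def dest: inj_onD)
    moreover have "\<pi> x = \<pi>' x" if "x \<in> darts G" for x
      using fun_cong[OF e(2), of x] that i(2) j(6) j'(6)
      by (auto simp: bij_betw_def dest: inj_onD)
    ultimately show "\<sigma> = \<sigma>' \<and> \<pi> = \<pi>'"
      using a1 a2 by (auto intro: extensionalityI)
  qed
  show "finite (marked_isos G A K C)"
    using assms by (intro finite_marked_isos)
qed

text \<open>The inverse isomorphism of targets gives the reverse inequality.\<close>

lemma card_marked_isos_target:
  assumes "finite_graph G" "finite_graph H" "finite_graph K" "A \<subseteq> verts G" "B \<subseteq> verts H"
    and i: "(\<alpha>, \<beta>) \<in> graph_isos H K" and "\<alpha> ` B = C"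
  shows "card (marked_isos G A H B) = card (marked_isos G A K C)"
proof (rule antisym)
  have "inv_into (verts H) \<alpha> ` C = B"
    using assms(5,7) graph_isosD(1)[OF i] by (auto simp: bij_betw_def)
  moreover have "C \<subseteq> verts K"
    using assms(5,7) graph_isosD(5)[OF i] by auto
  ultimately show "card (marked_isos G A K C) \<le> card (marked_isos G A H B)"
    using assms by (intro card_marked_isos_target_le[OF _ _ _ _ _ graph_isos_inv]) auto
qed (rule card_marked_isos_target_le; fact)

text \<open>\<open>Aut\<close> extends maps by the identity off the graph,
  \<open>marked_isos\<close> by \<open>undefined\<close>; exchanging the two default values is a
  bijection.\<close>

lemma card_marked_isos_self:
  assumes "finite_graph G" "A \<subseteq> verts G"
  shows "card (marked_isos G A G A) = card {(\<sigma>, \<pi>) \<in> Aut G. \<sigma> ` A = A}"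
proof (rule bij_betw_same_card)
  note G = finite_graphD[OF assms(1)]
  let ?g = "\<lambda>(\<sigma>, \<pi>). (\<lambda>x. if x \<in> verts G then \<sigma> x else x, \<lambda>x. if x \<in> darts G then \<pi> x else x)"
  let ?f = "\<lambda>(\<sigma>, \<pi>). (restrict \<sigma> (verts G), restrict \<pi> (darts G))"
  show "bij_betw ?g (marked_isos G A G A) {(\<sigma>, \<pi>) \<in> Aut G. \<sigma> ` A = A}"
  proof (rule bij_betw_byWitness[where f' = ?f])
    show "\<forall>p\<in>marked_isos G A G A. ?f (?g p) = p"
      by (auto simp: marked_isos_def extensional_def)
    show "\<forall>p\<in>{(\<sigma>, \<pi>) \<in> Aut G. \<sigma> ` A = A}. ?g (?f p) = p"
      by (auto simp: Aut_def permutes_def)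
    show "?f ` {(\<sigma>, \<pi>) \<in> Aut G. \<sigma> ` A = A} \<subseteq> marked_isos G A G A"
      using assms by (auto simp: Aut_def intro!: restrict_marked_isos)
    have "?g (\<sigma>, \<pi>) \<in> {(\<sigma>, \<pi>) \<in> Aut G. \<sigma> ` A = A}" if "(\<sigma>, \<pi>) \<in> marked_isos G A G A" for \<sigma> \<pi>
    proof -
      note m = that[unfolded marked_isos_iff]
      note i = graph_isosD[OF m[THEN conjunct1]]
      have 1: "bij_betw (\<lambda>x. if x \<in> verts G then \<sigma> x else x) (verts G) (verts G)"
        using i(1) by (subst bij_betw_cong[where g = \<sigma>]) auto
      have 2: "bij_betw (\<lambda>x. if x \<in> darts G then \<pi> x else x) (darts G) (darts G)"
        using i(2) by (subst bij_betw_cong[where g = \<pi>]) auto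
      have 3: "(\<lambda>x. if x \<in> verts G then \<sigma> x else x) permutes verts G"
        by (rule bij_imp_permutes[OF 1]) auto
      have 4: "(\<lambda>x. if x \<in> darts G then \<pi> x else x) permutes darts G"
        by (rule bij_imp_permutes[OF 2]) auto
      have 5: "(\<lambda>x. if x \<in> verts G then \<sigma> x else x) ` A = A"
      proof -
        have "(\<lambda>x. if x \<in> verts G then \<sigma> x else x) ` A = \<sigma> ` A"
          using assms(2) by (intro image_cong) auto
        with m show ?thesis by simp
      qed
      have 6: "?g (\<sigma>, \<pi>) \<in> graph_isos G G"
        using 1 2 i(3,4) G(3,4) by (simp add: graph_isos_def)
      show ?thesis
        using 3 4 5 6 by (simp add: Aut_def)
    qed
    then show "?g ` marked_isos G A G A \<subseteq> {(\<sigma>, \<pi>) \<in> Aut G. \<sigma> ` A = A}"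
      by fast
  qed
qed

lemma card_isos_self: "finite_graph G \<Longrightarrow> card (isos G G) = card (Aut G)"
  by (subst card_marked_isos_self) auto

lemma card_rooted_isos_self:
  "finite_graph T \<Longrightarrow> r \<in> verts T \<Longrightarrow> card (marked_isos T {r} T {r}) = card (root_Aut T r)"
  by (subst card_marked_isos_self) (auto simp: root_Aut_def)

text \<open>When nonempty, the set of isomorphisms is a torsor: a single isomorphism from
  \<open>G\<close> to \<open>H\<close> carries the count of automorphisms over to it.\<close>

lemma card_isos:
  assumes "finite_graph G" "finite_graph H"
  shows "card (isos G H) = (if graph_isos G H = {} then 0 else card (Aut G))"
proof (cases "graph_isos G H = {}")
  case False
  then obtain \<alpha> \<beta> where "(\<alpha>, \<beta>) \<in> graph_isos G H" by auto
  then have "card (isos G G) = card (isos G H)"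
    using assms by (intro card_marked_isos_target) auto
  with False assms show ?thesis by (simp add: card_isos_self)
qed (use isos_empty_iff[OF assms(1), of H] in auto)

lemma card_Aut_pos: "finite_graph G \<Longrightarrow> 0 < card (Aut G)"
  by (metis card_isos_self card_gt_0_iff finite_marked_isos isos_empty_iff graph_isos_refl empty_iff)

text \<open>Inversion is a bijection between \<open>isos G H\<close> and \<open>isos H G\<close>,
  and these are counted by the automorphisms of \<open>G\<close> and of \<open>H\<close>
  respectively.\<close>

lemma card_Aut_cong:
  assumes "finite_graph G" "finite_graph H" "graph_isos G H \<noteq> {}"
  shows "card (Aut G) = card (Aut H)"
proof -
  obtain \<alpha> \<beta> where i: "(\<alpha>, \<beta>) \<in> graph_isos G H" using assms(3) by auto
  have "card (isos H G) = card (isos H H)"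
    using assms i by (intro card_marked_isos_target) auto
  moreover have "card (isos H G) = card (Aut H)"
    using assms graph_isos_sym by (auto simp: card_isos)
  moreover have "card (Aut G) = card (isos G H)" 
    using assms by (simp add: card_isos)
  moreover have "card (isos G H) = card (isos H G)"
  proof (rule bij_betw_same_card)
    let ?f = "\<lambda>(\<sigma>, \<pi>). (restrict (inv_into (verts G) \<sigma>) (verts H), restrict (inv_into (darts G) \<pi>) (darts H))"
    let ?g = "\<lambda>(\<sigma>, \<pi>). (restrict (inv_into (verts H) \<sigma>) (verts G), restrict (inv_into (darts H) \<pi>) (darts G))"
    \<comment> \<open>Inverting twice gives back the same function, default values included, because
      it is extensional on its domain.\<close>
    have inv: "restrict (inv_into B (restrict (inv_into A f) B)) A = f"
      if "bij_betw f A B" "f \<in> extensional A" for f :: "'x \<Rightarrow> 'y" and A B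
    proof (rule extensionalityI[OF _ that(2)])
      fix x assume x: "x \<in> A"
      have "bij_betw (restrict (inv_into A f) B) B A"
        using that(1) by (simp add: bij_betw_inv_into)
      then have "inv_into B (restrict (inv_into A f) B) x = f x"
        using x that(1) by (intro inv_into_f_eq) (auto simp: bij_betw_def)
      then show "restrict (inv_into B (restrict (inv_into A f) B)) A x = f x"
        using x by simp
    qed auto
    show "bij_betw ?f (isos G H) (isos H G)"
      using assms 
      by (intro bij_betw_byWitness[where f' = ?g])
        (auto simp: marked_isos_iff inv graph_isosD(1,2) intro!: restrict_marked_isos graph_isos_inv)
  qed
  ultimately show ?thesis by simp
qed

lemma iso_rel_equiv: "equiv {G. finite_graph G} iso_rel"
proof (rule equivI)
  show "refl_on {G. finite_graph G} iso_rel"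
    using graph_isos_refl by (fastforce simp: refl_on_def iso_rel_def)
  show "sym iso_rel"
    using graph_isos_sym by (auto simp: sym_def iso_rel_def)
  show "trans iso_rel"
    unfolding trans_def iso_rel_def using graph_isos_trans by blast
qed (auto simp: iso_rel_def)

section \<open>Counting darts, and connectedness through closed sets\<close>

text \<open>The pairs are the orbits of a fixed-point-free involution. This serves both for edges as
  pairs of darts and for new vertices with their two descriptions.\<close>

lemma card_doubleton_image:
  assumes "finite A" "\<And>x. x \<in> A \<Longrightarrow> f x \<in> A" "\<And>x. x \<in> A \<Longrightarrow> f x \<noteq> x" "\<And>x. x \<in> A \<Longrightarrow> f (f x) = x"
  shows "2 * card ((\<lambda>x. {x, f x}) ` A) = card A"
proof -
  let ?C = "(\<lambda>x. {x, f x}) ` A"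
  have U: "\<Union> ?C = A"
    using assms(2) by auto
  have "2 * card ?C = card (\<Union> ?C)"
  proof (rule card_partition)
    show "finite ?C" "finite (\<Union> ?C)"
      using assms(1) unfolding U by auto
    show "card c = 2" if "c \<in> ?C" for c
      using that assms(3) by (force simp: card_2_iff)
    show "c1 \<inter> c2 = {}" if c: "c1 \<in> ?C" "c2 \<in> ?C" "c1 \<noteq> c2" for c1 c2
      using c assms(4) by (auto; metis insert_commute)
  qed
  then show ?thesis unfolding U .
qed

lemma card_darts: "finite_graph G \<Longrightarrow> card (darts G) = 2 * card (edges G)"
  unfolding edges_def
  by (rule card_doubleton_image[symmetric]) (auto simp: finite_graphD)

text \<open>Doubling replaces edges by darts, so that Betti numbers can be compared by linear
  arithmetic on cardinalities.\<close>

lemma betti_iff: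
  assumes "finite_graph G"
  shows "betti G = g \<longleftrightarrow> int (card (darts G)) + 2 = 2 * int (card (verts G)) + 2 * g"
  using card_darts[OF assms] by (auto simp: betti_def)

text \<open>A set closed under darts contains everything reachable from any of its points;
  conversely, the set reachable from \<open>u\<close> is itself closed. The criterion removes the
  transitive closure from all later arguments.\<close>

lemma connected_graph_iff:
  assumes "finite_graph G"
  shows "connected_graph G \<longleftrightarrow> verts G \<noteq> {} \<and>
    (\<forall>S \<subseteq> verts G. S \<noteq> {} \<longrightarrow> (\<forall>h\<in>darts G. base G h \<in> S \<longrightarrow> base G (opp G h) \<in> S) \<longrightarrow> S = verts G)"
    (is "_ \<longleftrightarrow> _ \<and> ?R")
proof -
  note G = finite_graphD[OF assms]
  let ?r = "{(base G h, base G (opp G h)) | h. h \<in> darts G}"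
  have "?R" if c: "connected_graph G"
  proof (intro allI impI)
    fix S assume S: "S \<subseteq> verts G" "S \<noteq> {}" "\<forall>h\<in>darts G. base G h \<in> S \<longrightarrow> base G (opp G h) \<in> S"
    then obtain u where u: "u \<in> S" by auto
    have "v \<in> S" if "(u, v) \<in> ?r\<^sup>*" for v
      using that by (induction rule: rtrancl_induct) (use u S(3) in auto)
    moreover have "(u, v) \<in> ?r\<^sup>*" if "v \<in> verts G" for v
      using c u S(1) that by (auto simp: connected_graph_def)
    ultimately show "S = verts G" using S(1) by blast
  qed
  moreover have "\<forall>u\<in>verts G. \<forall>v\<in>verts G. (u, v) \<in> ?r\<^sup>*" if R: ?R
  proof (intro ballI)
    fix u v assume uv: "u \<in> verts G" "v \<in> verts G"
    let ?S = "{w \<in> verts G. (u, w) \<in> ?r\<^sup>*}"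
    have "?S = verts G"
    proof (rule R[rule_format])
      show "?S \<noteq> {}" using uv(1) by auto
      show "base G (opp G h) \<in> ?S" if "h \<in> darts G" "base G h \<in> ?S" for h
        using that G by (auto intro: rtrancl_into_rtrancl)
    qed auto
    with uv(2) show "(u, v) \<in> ?r\<^sup>*" by auto
  qed
  ultimately show ?thesis by (auto simp: connected_graph_def)
qed

lemma connected_graph_induct [consumes 4, case_names closed]:
  assumes "finite_graph G" "connected_graph G" "u \<in> verts G" "P u"
    and "\<And>h. h \<in> darts G \<Longrightarrow> P (base G h) \<Longrightarrow> P (base G (opp G h))"
    and "v \<in> verts G"
  shows "P v"
proof -
  have "{w \<in> verts G. P w} = verts G"
    using assms(2) unfolding connected_graph_iff[OF assms(1)]
    by (elim conjE allE[of _ "{w \<in> verts G. P w}"]) (use assms finite_graphD[OF assms(1)] in auto)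
  with assms(6) show ?thesis by auto
qed

lemma connected_graphI:
  assumes "finite_graph G" "u \<in> verts G"
    and "\<And>S v. S \<subseteq> verts G \<Longrightarrow> v \<in> S \<Longrightarrow>
      (\<And>h. h \<in> darts G \<Longrightarrow> base G h \<in> S \<Longrightarrow> base G (opp G h) \<in> S) \<Longrightarrow> verts G \<subseteq> S"
  shows "connected_graph G"
  using assms unfolding connected_graph_iff[OF assms(1)] by blast

text \<open>As long as \<open>S\<close> is not everything, connectedness provides an edge leaving
  \<open>S\<close>; adding its far end makes at least two more darts induced. The induction enlarges
  \<open>S\<close> in this way, one vertex at a time.\<close>

lemma card_induced_darts:
  assumes "finite_graph G" "connected_graph G" "S \<subseteq> verts G" "S \<noteq> {}"
  shows "card {h \<in> darts G. base G h \<in> S \<and> base G (opp G h) \<in> S} + 2 * (card (verts G) - card S)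
    \<le> card (darts G)"
  using assms(3,4)
proof (induction "card (verts G) - card S" arbitrary: S)
  case 0
  then show ?case
    using finite_graphD[OF assms(1)] by (auto intro!: card_mono)
next
  case (Suc k)
  note G = finite_graphD[OF assms(1)]
  have "S \<noteq> verts G" using Suc(2) by auto
  then obtain h where h: "h \<in> darts G" "base G h \<in> S" "base G (opp G h) \<notin> S"
    using assms(2) Suc(3,4) unfolding connected_graph_iff[OF assms(1)] by blast
  let ?v = "base G (opp G h)"
  let ?D = "\<lambda>S. {h \<in> darts G. base G h \<in> S \<and> base G (opp G h) \<in> S}"
  have v: "?v \<in> verts G" using h G by auto
  have fS: "finite S" using Suc(3) G(1) finite_subset by blast
  have cS: "card (insert ?v S) = Suc (card S)" using h fS by simp
  have IH: "card (?D (insert ?v S)) + 2 * (card (verts G) - card (insert ?v S)) \<le> card (darts G)"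
    using Suc(2,3) v cS by (intro Suc(1)) auto
  \<comment> \<open>The edge through \<open>h\<close> joins \<open>S\<close> to the added vertex, so
    neither of its darts was induced before and both are now.\<close>
  have "card (?D S \<union> {h, opp G h}) \<le> card (?D (insert ?v S))"
    using h G by (intro card_mono) auto
  moreover have "card (?D S \<union> {h, opp G h}) = card (?D S) + 2"
    using h G(2) G(5)[OF h(1)] by (subst card_Un_disjoint) auto
  ultimately show ?case
    using IH cS Suc(2) by linarith
qed

lemma graph_isos_cards:
  assumes "graph_isos G H \<noteq> {}"
  shows "card (verts G) = card (verts H)" "card (darts G) = card (darts H)"
  using assms by (auto simp: graph_isos_def bij_betw_same_card)

lemma graph_isos_betti:
  assumes "finite_graph G" "finite_graph H" "graph_isos G H \<noteq> {}"
  shows "betti G = betti H"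
  using betti_iff[OF assms(1), of "betti H"] betti_iff[OF assms(2), of "betti H"]
    graph_isos_cards[OF assms(3)] by simp

lemma graph_isos_connected:
  assumes G: "finite_graph G" and H: "finite_graph H" and c: "connected_graph G"
    and i: "graph_isos G H \<noteq> {}"
  shows "connected_graph H"
proof -
  obtain \<sigma> \<pi> where i: "(\<sigma>, \<pi>) \<in> graph_isos G H" using i by auto
  note i = graph_isosD[OF i]
  obtain u where u: "u \<in> verts G" using c by (auto simp: connected_graph_def)
  show ?thesis
  proof (rule connected_graphI[OF H i(5)[OF u]], rule subsetI)
    fix S v w assume S: "S \<subseteq> verts H" "v \<in> S" "w \<in> verts H"
      "\<And>h. h \<in> darts H \<Longrightarrow> base H h \<in> S \<Longrightarrow> base H (opp H h) \<in> S"
    have "v \<in> \<sigma> ` verts G" "w \<in> \<sigma> ` verts G"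
      using S(1-3) bij_betw_imp_surj_on[OF i(1)] by auto
    then obtain v' w' where v': "v' \<in> verts G" "\<sigma> v' = v" and w': "w' \<in> verts G" "\<sigma> w' = w"
      by blast
    have "\<sigma> w' \<in> S"
      using G c v'(1) S(2)[folded v'(2)] 
    proof (induction rule: connected_graph_induct)
      case (closed h)
      then show ?case
        using S(4)[of "\<pi> h"] i finite_graphD[OF G] by auto
    qed (rule w')
    then show "w \<in> S" using w' by simp
  qed
qed

lemma graph_isos_degree:
  assumes G: "finite_graph G" and i: "(\<sigma>, \<pi>) \<in> graph_isos G H" and "v \<in> verts G"
  shows "vertex_degree H (\<sigma> v) = vertex_degree G v"
proof -
  note G = finite_graphD[OF G] and i = graph_isosD[OF i]
  have "bij_betw \<pi> {h \<in> darts G. base G h = v} {h \<in> darts H. base H h = \<sigma> v}"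
  proof (rule bij_betw_imageI)
    show "inj_on \<pi> {h \<in> darts G. base G h = v}"
      using i(2) by (auto simp: bij_betw_def inj_on_def)
    show "\<pi> ` {h \<in> darts G. base G h = v} = {h \<in> darts H. base H h = \<sigma> v}"
    proof (intro set_eqI iffI)
      fix k assume k: "k \<in> {h \<in> darts H. base H h = \<sigma> v}"
      then obtain h where h: "h \<in> darts G" "k = \<pi> h" using i(2) by (auto simp: bij_betw_def)
      then have "base G h = v"
        using k i G assms(3) by (auto simp: bij_betw_def dest: inj_onD)
      with h show "k \<in> \<pi> ` {h \<in> darts G. base G h = v}" by auto
    qed (use i in auto)
  qed
  then show ?thesis by (simp add: vertex_degree_def bij_betw_same_card)
qed

section \<open>Standard copies of finite graphs\<close>

text \<open>A finite set that meets every isomorphism class of the given size. Its members need not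
  be graphs in the sense of \<open>finite_graph\<close>, since only finiteness of the set
  matters.\<close>

definition std_graphs :: "nat \<Rightarrow> nat \<Rightarrow> ngraph set" where
  "std_graphs n d = (\<lambda>(b, p). \<lparr>verts = {..<n}, darts = {..<d}, base = b, opp = p\<rparr>) `
     (({..<d} \<rightarrow>\<^sub>E {..<n}) \<times> ({..<d} \<rightarrow>\<^sub>E {..<d}))"

lemma finite_std_graphs: "finite (std_graphs n d)"
  by (auto simp: std_graphs_def intro!: finite_PiE)

text \<open>Transport of structure along enumerations. It bounds the number of classes, and it gives
  graphs over other types, such as grafts of subdivisions, a copy on the natural numbers, where
  classes are formed.\<close>

lemma std_graph_copy:
  assumes "finite_graph G"
  obtains K \<sigma> \<pi> where "K \<in> std_graphs (card (verts G)) (card (darts G))" "finite_graph K"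
    "(\<sigma>, \<pi>) \<in> graph_isos G K"
proof -
  note G = finite_graphD[OF assms]
  obtain \<sigma> where s: "bij_betw \<sigma> (verts G) {..<card (verts G)}"
    using ex_bij_betw_finite_nat[OF G(1)] by (auto simp: lessThan_atLeast0)
  obtain \<pi> where p: "bij_betw \<pi> (darts G) {..<card (darts G)}"
    using ex_bij_betw_finite_nat[OF G(2)] by (auto simp: lessThan_atLeast0)
  let ?q = "inv_into (darts G) \<pi>"
  define K where "K = \<lparr>verts = {..<card (verts G)}, darts = {..<card (darts G)},
    base = restrict (\<lambda>k. \<sigma> (base G (?q k))) {..<card (darts G)},
    opp = restrict (\<lambda>k. \<pi> (opp G (?q k))) {..<card (darts G)}\<rparr>"
  have q: "?q k \<in> darts G" "\<pi> (?q k) = k" if "k < card (darts G)" for k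
    using that p by (auto simp: bij_betw_inv_into_right bij_betw_def inv_into_into)
  have p': "\<pi> h < card (darts G)" "?q (\<pi> h) = h" if "h \<in> darts G" for h
    using that p by (auto simp: bij_betw_inv_into_left bij_betw_def)
  have s': "\<sigma> v < card (verts G)" if "v \<in> verts G" for v
    using that s by (auto simp: bij_betw_def)
  have "K \<in> std_graphs (card (verts G)) (card (darts G))"
    unfolding K_def std_graphs_def
    by (rule image_eqI[where x = "(restrict (\<lambda>k. \<sigma> (base G (?q k))) {..<card (darts G)},
          restrict (\<lambda>k. \<pi> (opp G (?q k))) {..<card (darts G)})"]) (auto simp: q p' s' G)
  moreover have "finite_graph K"
    unfolding finite_graph_def using q p' s' G by (auto simp: K_def) (metis p'(2))
  moreover have "(\<sigma>, \<pi>) \<in> graph_isos G K"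
    using s p p' by (simp add: graph_isos_def K_def)
  ultimately show thesis using that by blast
qed

section \<open>Grafting rooted trees\<close>

lemma rooted_treesD:
  assumes "\<tau> \<in> rooted_trees"
  shows "finite_graph (fst \<tau>)" "connected_graph (fst \<tau>)" "snd \<tau> \<in> verts (fst \<tau>)"
    and "card (darts (fst \<tau>)) + 2 = 2 * card (verts (fst \<tau>))"
  using assms betti_iff[of "fst \<tau>" 0] by (auto simp: rooted_trees_def)

text \<open>Acyclicity in counting form: a tree has exactly two darts fewer than twice its vertices,
  so the bound on induced darts leaves no room for a cycle.\<close>

lemma tree_induced_darts:
  assumes "\<tau> \<in> rooted_trees" "S \<subseteq> verts (fst \<tau>)" "S \<noteq> {}"
  shows "card {h \<in> darts (fst \<tau>). base (fst \<tau>) h \<in> S \<and> base (fst \<tau>) (opp (fst \<tau>) h) \<in> S} + 2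
    \<le> 2 * card S"
proof -
  note t = rooted_treesD[OF assms(1)]
  have "card S \<le> card (verts (fst \<tau>))"
    using assms(2) t(1) by (simp add: card_mono finite_graphD)
  with card_induced_darts[OF t(1,2) assms(2,3)] t(4) show ?thesis by linarith
qed

text \<open>A loop would give induced darts on a single vertex, where the bound is zero.\<close>

lemma tree_no_loop:
  assumes "\<tau> \<in> rooted_trees" "k \<in> darts (fst \<tau>)"
  shows "base (fst \<tau>) (opp (fst \<tau>) k) \<noteq> base (fst \<tau>) k"
proof
  assume l: "base (fst \<tau>) (opp (fst \<tau>) k) = base (fst \<tau>) k"
  note t = finite_graphD[OF rooted_treesD(1)[OF assms(1)]]
  let ?v = "base (fst \<tau>) k"
  have "{h \<in> darts (fst \<tau>). base (fst \<tau>) h \<in> {?v} \<and> base (fst \<tau>) (opp (fst \<tau>) h) \<in> {?v}} = {}"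
    using tree_induced_darts[OF assms(1), of "{?v}"] t assms(2) by simp
  with l assms(2) show False by auto
qed

abbreviation rooted_isos where
  "rooted_isos \<tau> \<tau>' \<equiv> marked_isos (fst \<tau>) {snd \<tau>} (fst \<tau>') {snd \<tau>'}"

text \<open>The pair \<open>(v, snd (T v))\<close> takes the part of \<open>v\<close> itself, so
  attaching a tree involves no gluing; \<open>Inl\<close> and \<open>Inr\<close> keep the darts of
  \<open>H\<close> apart from those of the trees.\<close>

definition graft ::
  "('v, 'h) graph \<Rightarrow> ('v \<Rightarrow> ('w, 'k) graph \<times> 'w) \<Rightarrow> ('v \<times> 'w, 'h + 'v \<times> 'k) graph" where
  "graft H T = \<lparr>
     verts = Sigma (verts H) (\<lambda>v. verts (fst (T v))),
     darts = Inl ` darts H \<union> Inr ` Sigma (verts H) (\<lambda>v. darts (fst (T v))),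
     base = case_sum (\<lambda>h. (base H h, snd (T (base H h)))) (\<lambda>(v, k). (v, base (fst (T v)) k)),
     opp = map_sum (opp H) (\<lambda>(v, k). (v, opp (fst (T v)) k))\<rparr>"

lemma graft_simps [simp]:
  "verts (graft H T) = Sigma (verts H) (\<lambda>v. verts (fst (T v)))"
  "darts (graft H T) = Inl ` darts H \<union> Inr ` Sigma (verts H) (\<lambda>v. darts (fst (T v)))"
  "base (graft H T) (Inl h) = (base H h, snd (T (base H h)))"
  "base (graft H T) (Inr (v, k)) = (v, base (fst (T v)) k)"
  "opp (graft H T) (Inl h) = Inl (opp H h)"
  "opp (graft H T) (Inr (v, k)) = Inr (v, opp (fst (T v)) k)"
  by (simp_all add: graft_def)

lemma finite_graph_graft:
  assumes "finite_graph H" "\<And>v. v \<in> verts H \<Longrightarrow> finite_graph (fst (T v))"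
    "\<And>v. v \<in> verts H \<Longrightarrow> snd (T v) \<in> verts (fst (T v))"
  shows "finite_graph (graft H T)"
  using finite_graphD[OF assms(1)] finite_graphD[OF assms(2)] assms(3)
  by (auto simp: finite_graph_def[of "graft H T"])

text \<open>A closed set that meets one tree swallows it, its root included, and then spreads to the
  neighbouring trees along the darts of \<open>H\<close>.\<close>

lemma connected_graph_graft:
  assumes H: "finite_graph H" "connected_graph H"
    and T: "\<And>v. v \<in> verts H \<Longrightarrow> T v \<in> rooted_trees"
  shows "connected_graph (graft H T)"
proof -
  note T = rooted_treesD[OF T]
  obtain u where u: "u \<in> verts H" using H(2) by (auto simp: connected_graph_def)
  show ?thesis
  proof (rule connected_graphI[OF finite_graph_graft[OF H(1) T(1,3)]])
    show "(u, snd (T u)) \<in> verts (graft H T)" using u T by simp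
    fix S w assume S: "S \<subseteq> verts (graft H T)" "w \<in> S"
      and cl: "\<And>h. h \<in> darts (graft H T) \<Longrightarrow> base (graft H T) h \<in> S \<Longrightarrow>
        base (graft H T) (opp (graft H T) h) \<in> S"
    have tree: "(v, y) \<in> S" if "v \<in> verts H" "(v, x) \<in> S" "y \<in> verts (fst (T v))" for v x y
    proof -
      have x: "x \<in> verts (fst (T v))" using that S by auto
      show ?thesis
        using T(1,2)[OF that(1)] x that(2)
      proof (induction rule: connected_graph_induct)
        case (closed k)
        then show ?case using cl[of "Inr (v, k)"] that(1) by auto
      qed (rule that(3))
    qed
    obtain v x where v: "w = (v, x)" "v \<in> verts H" using S by (cases w) auto
    have "\<forall>y \<in> verts (fst (T v)). (v, y) \<in> S"
      using tree S(2) v by blast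
    with H v(2) have "\<forall>y \<in> verts (fst (T u)). (u, y) \<in> S" if "u \<in> verts H" for u
    proof (induction rule: connected_graph_induct)
      case (closed h)
      then have "(base H (opp H h), snd (T (base H (opp H h)))) \<in> S"
        using cl[of "Inl h"] T finite_graphD[OF H(1)] by auto
      then show ?case using tree finite_graphD[OF H(1)] closed(1) by blast
    qed (rule that)
    then show "verts (graft H T) \<subseteq> S" by auto
  qed
qed

lemma card_verts_graft:
  assumes "finite_graph H" "\<And>v. v \<in> verts H \<Longrightarrow> finite_graph (fst (T v))"
  shows "card (verts (graft H T)) = (\<Sum>v\<in>verts H. card (verts (fst (T v))))"
  using assms by (simp add: finite_graphD)

text \<open>A tree with \<open>k\<close> vertices has \<open>2 * k - 2\<close> darts, and grafting
  it puts \<open>k\<close> vertices in place of one, so darts and twice the vertices grow by the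
  same amount.\<close>

lemma betti_graft:
  assumes H: "finite_graph H" and T: "\<And>v. v \<in> verts H \<Longrightarrow> T v \<in> rooted_trees"
  shows "betti (graft H T) = betti H"
proof -
  note t = rooted_treesD[OF T] and fH = finite_graphD[OF H]
  have f: "finite_graph (graft H T)" using t by (intro finite_graph_graft H)
  have "card (darts (graft H T)) = card (darts H) + (\<Sum>v\<in>verts H. card (darts (fst (T v))))"
    using fH t by (subst graft_simps, subst card_Un_disjoint)
      (auto simp: card_image finite_graphD intro!: finite_SigmaI)
  moreover have "(\<Sum>v\<in>verts H. card (darts (fst (T v)))) + 2 * card (verts H)
      = 2 * (\<Sum>v\<in>verts H. card (verts (fst (T v))))"
  proof -
    have "(\<Sum>v\<in>verts H. card (darts (fst (T v))) + 2) = (\<Sum>v\<in>verts H. 2 * card (verts (fst (T v))))"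
      by (intro sum.cong t(4)) auto
    from this[unfolded sum.distrib] show ?thesis by (simp add: sum_distrib_left)
  qed
  moreover have "card (verts (graft H T)) = (\<Sum>v\<in>verts H. card (verts (fst (T v))))"
    by (rule card_verts_graft[OF H t(1)])
  ultimately show ?thesis
    using betti_iff[OF H, of "betti H"] betti_iff[OF f, of "betti H"] by linarith
qed

text \<open>\<open>core\<close> is the vertex set of the 2-core.\<close>

definition dense_verts where
  "dense_verts G S \<longleftrightarrow> S \<subseteq> verts G \<and>
     (\<forall>v\<in>S. 2 \<le> card {h \<in> darts G. base G h = v \<and> base G (opp G h) \<in> S})"

definition core where "core G = \<Union> {S. dense_verts G S}"

lemma core_subset: "core G \<subseteq> verts G"
  by (auto simp: core_def dense_verts_def)

lemma graph_isos_core_imp: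
  assumes G: "finite_graph G" "finite_graph H" and i: "(\<sigma>, \<pi>) \<in> graph_isos G H" and v: "v \<in> core G"
  shows "\<sigma> v \<in> core H"
proof -
  note fG = finite_graphD[OF G(1)] and i = graph_isosD[OF i]
  obtain S where S: "dense_verts G S" "v \<in> S" using v by (auto simp: core_def)
  have "dense_verts H (\<sigma> ` S)"
    unfolding dense_verts_def
  proof (intro conjI ballI)
    show "\<sigma> ` S \<subseteq> verts H" using S(1) i(5) by (auto simp: dense_verts_def)
    fix w assume "w \<in> \<sigma> ` S"
    then obtain u where u: "u \<in> S" "w = \<sigma> u" by auto
    let ?D = "{h \<in> darts G. base G h = u \<and> base G (opp G h) \<in> S}"
    have "2 \<le> card ?D" using S(1) u by (auto simp: dense_verts_def)
    also have "\<dots> \<le> card {h \<in> darts H. base H h = w \<and> base H (opp H h) \<in> \<sigma> ` S}"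
    proof (rule card_inj_on_le)
      show "inj_on \<pi> ?D" using i(2) by (auto simp: bij_betw_def inj_on_def)
      show "\<pi> ` ?D \<subseteq> {h \<in> darts H. base H h = w \<and> base H (opp H h) \<in> \<sigma> ` S}"
        using i fG u by auto
    qed (use finite_graphD[OF G(2)] in auto)
    finally show "2 \<le> card {h \<in> darts H. base H h = w \<and> base H (opp H h) \<in> \<sigma> ` S}" .
  qed
  with S(2) show ?thesis unfolding core_def by blast
qed

lemma graph_isos_core:
  assumes "finite_graph G" "finite_graph H" "(\<sigma>, \<pi>) \<in> graph_isos G H" "v \<in> verts G"
  shows "\<sigma> v \<in> core H \<longleftrightarrow> v \<in> core G"
proof
  assume "\<sigma> v \<in> core H"
  then have "inv_into (verts G) \<sigma> (\<sigma> v) \<in> core G"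
    using assms by (intro graph_isos_core_imp[OF _ _ graph_isos_inv])
  then show "v \<in> core G"
    using graph_isosD(1)[OF assms(3)] assms(4) by (simp add: bij_betw_inv_into_left)
qed (rule graph_isos_core_imp[OF assms(1-3)])

definition min_degree :: "nat \<Rightarrow> ('v, 'h) graph \<Rightarrow> bool" where
  "min_degree d G \<longleftrightarrow> (\<forall>v\<in>verts G. d \<le> vertex_degree G v)"

text \<open>The roots form a dense set because \<open>H\<close> has minimum degree 2. A dense set
  with another vertex in some tree would have at least two induced darts at every non-root vertex it
  meets there, which exceeds what a tree can carry.\<close>

lemma core_graft:
  assumes H: "finite_graph H" "min_degree 2 H"
    and T: "\<And>v. v \<in> verts H \<Longrightarrow> T v \<in> rooted_trees"
  shows "core (graft H T) = (\<lambda>v. (v, snd (T v))) ` verts H"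
proof (intro equalityI subsetI)
  note fH = finite_graphD[OF H(1)] and t = rooted_treesD[OF T]
  note fG = finite_graph_graft[OF H(1) t(1,3)]
  fix p assume p: "p \<in> (\<lambda>v. (v, snd (T v))) ` verts H"
  have "dense_verts (graft H T) ((\<lambda>v. (v, snd (T v))) ` verts H)"
    unfolding dense_verts_def
  proof (intro conjI ballI)
    fix q assume "q \<in> (\<lambda>v. (v, snd (T v))) ` verts H"
    then obtain v where v: "v \<in> verts H" "q = (v, snd (T v))" by auto
    let ?E = "{h \<in> darts (graft H T). base (graft H T) h = q \<and>
      base (graft H T) (opp (graft H T) h) \<in> (\<lambda>v. (v, snd (T v))) ` verts H}"
    have "2 \<le> card {h \<in> darts H. base H h = v}"
      using H(2) v by (auto simp: min_degree_def vertex_degree_def)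
    also have "\<dots> = card (Inl ` {h \<in> darts H. base H h = v} :: ('b + 'a \<times> nat) set)"
      by (simp add: card_image)
    also have "\<dots> \<le> card ?E"
      using fH finite_graphD(2)[OF fG] by (intro card_mono) (auto simp: v)
    finally show "2 \<le> card ?E" .
  qed (use t in auto)
  with p show "p \<in> core (graft H T)" unfolding core_def by blast
next
  note fH = finite_graphD[OF H(1)] and t = rooted_treesD[OF T]
  note fG = finite_graph_graft[OF H(1) t(1,3)]
  fix p assume p: "p \<in> core (graft H T)"
  then obtain S where S: "dense_verts (graft H T) S" "p \<in> S" by (auto simp: core_def)
  obtain v x where px: "p = (v, x)" "v \<in> verts H" "x \<in> verts (fst (T v))"
    using p core_subset[of "graft H T"] by (cases p) auto
  show "p \<in> (\<lambda>v. (v, snd (T v))) ` verts H"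
  proof (rule ccontr)
    assume "\<not> ?thesis"
    then have xr: "x \<noteq> snd (T v)" using px by auto
    let ?r = "snd (T v)" and ?T = "fst (T v)"
    note tv = t[OF px(2)] and Tv = T[OF px(2)]
    note fT = finite_graphD[OF tv(1)]
    \<comment> \<open>Only darts at the root can leave the tree, so the degree bound is used on
      \<open>U\<close> without the root. Inserting the root treats at once the cases that it lies in
      \<open>S\<close> or not.\<close>
    define U where "U = insert ?r {y \<in> verts ?T. (v, y) \<in> S}"
    let ?D = "\<lambda>A. {h \<in> darts ?T. base ?T h \<in> A \<and> base ?T (opp ?T h) \<in> A}"
    let ?N = "\<lambda>y. {h \<in> darts ?T. base ?T h = y \<and> base ?T (opp ?T h) \<in> U}"
    have U: "U \<subseteq> verts ?T" "U \<noteq> {}" "finite U" "?r \<in> U" "x \<in> U" "card (U - {?r}) + 1 = card U"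
      using tv(3) fT(1) px S(2) card_Diff_singleton[of ?r U] card_gt_0_iff[of U]
      by (auto simp: U_def)
    have "2 \<le> card (?N y)" if y: "y \<in> U - {?r}" for y
    proof -
      have "(v, y) \<in> S" "y \<in> verts ?T" using y by (auto simp: U_def)
      then have "2 \<le> card {h \<in> darts (graft H T). base (graft H T) h = (v, y) \<and>
          base (graft H T) (opp (graft H T) h) \<in> S}"
        using S(1) by (auto simp: dense_verts_def)
      also have "\<dots> \<le> card ((\<lambda>k. Inr (v, k)) ` ?N y :: ('b + 'a \<times> nat) set)"
        using y fT px by (intro card_mono) (auto simp: U_def)
      also have "\<dots> \<le> card (?N y)" using fT by (intro card_image_le) auto
      finally show ?thesis .
    qed
    then have "2 * card (U - {?r}) \<le> (\<Sum>y\<in>U - {?r}. card (?N y))"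
      using sum_bounded_below[of "U - {?r}" 2 "\<lambda>y. card (?N y)"] by simp
    also have "\<dots> = card (\<Union>y\<in>U - {?r}. ?N y)"
      using fT U by (intro card_UN_disjoint[symmetric]) auto
    finally have *: "2 * card (U - {?r}) \<le> card (\<Union>y\<in>U - {?r}. ?N y)" .
    have "card (\<Union>y\<in>U - {?r}. ?N y) + card (?N ?r) = card (?D U)"
      using fT U by (subst card_Un_disjoint[symmetric]) (auto intro!: arg_cong[where f = card])
    \<comment> \<open>The other vertices already account for \<open>2 * card U - 2\<close> darts,
      the most a tree allows, so none is left at the root. All induced darts then avoid the root,
      which violates the bound for the smaller set.\<close>
    with * tree_induced_darts[OF Tv U(1,2)] U(6) have "card (?N ?r) = 0" by linarith
    then have "?N ?r = {}" using fT by simp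
    have nor: "base ?T h \<noteq> ?r \<and> base ?T (opp ?T h) \<noteq> ?r" if "h \<in> ?D U" for h
    proof -
      have "h \<notin> ?N ?r" "opp ?T h \<notin> ?N ?r"
        unfolding \<open>?N ?r = {}\<close> by auto
      with that fT(4,6) show ?thesis by auto
    qed
    then have "(\<Union>y\<in>U - {?r}. ?N y) = ?D (U - {?r})"
      by auto
    moreover have "card (?D (U - {?r})) + 2 \<le> 2 * card (U - {?r})"
      using U xr by (intro tree_induced_darts Tv) auto
    ultimately show False using * by simp
  qed
qed

text \<open>A tree dart joins two different vertices of one tree, and only one vertex of that tree,
  the root, is in the core.\<close>

lemma isl_graft_iff:
  assumes H: "finite_graph H" "min_degree 2 H"
    and T: "\<And>v. v \<in> verts H \<Longrightarrow> T v \<in> rooted_trees"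
    and d: "d \<in> darts (graft H T)"
  shows "isl d \<longleftrightarrow> base (graft H T) d \<in> core (graft H T) \<and>
    base (graft H T) (opp (graft H T) d) \<in> core (graft H T)"
proof (cases d)
  case (Inl h)
  then show ?thesis
    using d finite_graphD[OF H(1)] by (auto simp: core_graft[OF H T])
next
  case (Inr p)
  then obtain v k where "d = Inr (v, k)" "v \<in> verts H" "k \<in> darts (fst (T v))" using d by auto
  then show ?thesis
    using tree_no_loop[OF T, of v k] by (auto simp: core_graft[OF H T])
qed

section \<open>Isomorphisms between grafts\<close>

definition graft_map where
  "graft_map H T \<theta> \<psi> =
     (\<lambda>(v, x)\<in>verts (graft H T). (fst \<theta> v, fst (\<psi> v) x),
      \<lambda>d\<in>darts (graft H T). map_sum (snd \<theta>) (\<lambda>(v, k). (fst \<theta> v, snd (\<psi> v) k)) d)"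

text \<open>A dart \<open>Inl h\<close> is based at a root, so compatibility with
  \<open>base\<close> is the point where the tree maps have to preserve roots.\<close>

lemma graft_map_in_isos:
  assumes H: "finite_graph H" "finite_graph H'"
    and T: "\<And>v. v \<in> verts H \<Longrightarrow> T v \<in> rooted_trees"
    and T': "\<And>v. v \<in> verts H' \<Longrightarrow> T' v \<in> rooted_trees"
    and \<theta>: "\<theta> \<in> isos H H'" and \<psi>: "\<psi> \<in> (\<Pi>\<^sub>E v\<in>verts H. rooted_isos (T v) (T' (fst \<theta> v)))"
  shows "graft_map H T \<theta> \<psi> \<in> isos (graft H T) (graft H' T')"
proof -
  note fH = finite_graphD[OF H(1)] finite_graphD[OF H(2)]
  note t = rooted_treesD[OF T] and t' = rooted_treesD[OF T']
  have "(fst \<theta>, snd \<theta>) \<in> graph_isos H H'" using \<theta> by (cases \<theta>) (auto simp: marked_isos_iff)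
  note i = graph_isosD[OF this]
  have \<psi>1: "(fst (\<psi> v), snd (\<psi> v)) \<in> rooted_isos (T v) (T' (fst \<theta> v))" if "v \<in> verts H" for v
    using PiE_mem[OF \<psi> that] by simp
  have \<psi>2: "(fst (\<psi> v), snd (\<psi> v)) \<in> graph_isos (fst (T v)) (fst (T' (fst \<theta> v)))"
    if "v \<in> verts H" for v
    using \<psi>1[OF that] unfolding marked_isos_iff by blast
  have r: "fst (\<psi> v) (snd (T v)) = snd (T' (fst \<theta> v))" if "v \<in> verts H" for v
    using \<psi>1[OF that] unfolding marked_isos_iff by simp
  note j = graph_isosD[OF \<psi>2]
  let ?s = "\<lambda>(v, x). (fst \<theta> v, fst (\<psi> v) x)"
  let ?p = "map_sum (snd \<theta>) (\<lambda>(v, k). (fst \<theta> v, snd (\<psi> v) k))"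
  have inj: "v = w" if "fst \<theta> v = fst \<theta> w" "v \<in> verts H" "w \<in> verts H" for v w
    using that i(1) by (auto simp: bij_betw_def dest: inj_onD)
  have "bij_betw ?s (verts (graft H T)) (verts (graft H' T'))"
    unfolding bij_betw_def
  proof
    have "x = y" if "fst (\<psi> v) x = fst (\<psi> v) y" "v \<in> verts H" "x \<in> verts (fst (T v))" "y \<in> verts (fst (T v))"
      for v x y
      using that bij_betw_imp_inj_on[OF j(1)] by (auto dest: inj_onD)
    then show "inj_on ?s (verts (graft H T))"
      using inj by (auto simp: inj_on_def) blast
    have "(w, y) \<in> ?s ` verts (graft H T)" if w: "w \<in> verts H'" "y \<in> verts (fst (T' w))" for w y
    proof -
      obtain v where v: "v \<in> verts H" "w = fst \<theta> v"
        using w(1) bij_betw_imp_surj_on[OF i(1)] by auto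
      then obtain x where "x \<in> verts (fst (T v))" "y = fst (\<psi> v) x"
        using w(2) bij_betw_imp_surj_on[OF j(1)[OF v(1)]] by auto
      with v show ?thesis by force
    qed
    then show "?s ` verts (graft H T) = verts (graft H' T')"
      using i(5) j(5) by auto
  qed
  moreover have "bij_betw ?p (darts (graft H T)) (darts (graft H' T'))"
    unfolding bij_betw_def
  proof
    have "snd \<theta> h = snd \<theta> h' \<Longrightarrow> h = h'" if "h \<in> darts H" "h' \<in> darts H" for h h'
      using that i(2) by (auto simp: bij_betw_def dest: inj_onD)
    moreover have "x = y" if "snd (\<psi> v) x = snd (\<psi> v) y" "v \<in> verts H" "x \<in> darts (fst (T v))" "y \<in> darts (fst (T v))"
      for v x y
      using that bij_betw_imp_inj_on[OF j(2)] by (auto dest: inj_onD)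
    ultimately show "inj_on ?p (darts (graft H T))"
      using inj by (auto simp: inj_on_def) blast
    have "Inr (w, y) \<in> ?p ` darts (graft H T)" if w: "w \<in> verts H'" "y \<in> darts (fst (T' w))" for w y
    proof -
      obtain v where v: "v \<in> verts H" "w = fst \<theta> v"
        using w(1) bij_betw_imp_surj_on[OF i(1)] by auto
      then obtain x where "x \<in> darts (fst (T v))" "y = snd (\<psi> v) x"
        using w(2) bij_betw_imp_surj_on[OF j(2)[OF v(1)]] by auto
      with v show ?thesis by (intro image_eqI[where x = "Inr (v, x)"]) auto
    qed
    moreover have "Inl h \<in> ?p ` darts (graft H T)" if h: "h \<in> darts H'" for h
    proof -
      obtain k where "k \<in> darts H" "h = snd \<theta> k"
        using h bij_betw_imp_surj_on[OF i(2)] by auto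
      then show ?thesis by (intro image_eqI[where x = "Inl k"]) auto
    qed
    ultimately show "?p ` darts (graft H T) = darts (graft H' T')"
      using i(5,6) j(6) by auto
  qed
  moreover have "base (graft H' T') (?p d) = ?s (base (graft H T) d) \<and>
      opp (graft H' T') (?p d) = ?p (opp (graft H T) d)" if d: "d \<in> darts (graft H T)" for d
    using d i(3,4) j(3,4) r fH(3) by auto
  ultimately have "(?s, ?p) \<in> graph_isos (graft H T) (graft H' T')"
    unfolding graph_isos_def by blast
  then show ?thesis
    unfolding graft_map_def using t
    by (intro restrict_marked_isos finite_graph_graft H) auto
qed

text \<open>The core is preserved, and a dart of the graft belongs to the base graph iff both its ends are in the core.\<close>

lemma isos_graft_split:
  assumes H: "finite_graph H" "finite_graph H'" "min_degree 2 H" "min_degree 2 H'"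
    and T: "\<And>v. v \<in> verts H \<Longrightarrow> T v \<in> rooted_trees"
    and T': "\<And>v. v \<in> verts H' \<Longrightarrow> T' v \<in> rooted_trees"
    and p: "(s, p) \<in> isos (graft H T) (graft H' T')"
  shows "(s, p) \<in> (\<lambda>(\<theta>, \<psi>). graft_map H T \<theta> \<psi>) `
    (SIGMA \<theta>:isos H H'. \<Pi>\<^sub>E v\<in>verts H. rooted_isos (T v) (T' (fst \<theta> v)))"
proof -
  note fH = finite_graphD[OF H(1)] and fH' = finite_graphD[OF H(2)]
  note t = rooted_treesD[OF T] and t' = rooted_treesD[OF T']
  let ?G = "graft H T" and ?G' = "graft H' T'"
  have fG: "finite_graph ?G" "finite_graph ?G'"
    using t t' by (auto intro: finite_graph_graft H)
  have gi: "(s, p) \<in> graph_isos ?G ?G'" and ext: "s \<in> extensional (verts ?G)" "p \<in> extensional (darts ?G)"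
    using p unfolding marked_isos_iff by auto
  note i = graph_isosD[OF gi]
  note core = core_graft[OF H(1,3) T] core_graft[OF H(2,4) T']
  define \<sigma> where "\<sigma> = (\<lambda>v\<in>verts H. fst (s (v, snd (T v))))"
  define \<pi> where "\<pi> = (\<lambda>h\<in>darts H. projl (p (Inl h)))"
  define \<psi> where "\<psi> = (\<lambda>v\<in>verts H. (\<lambda>x\<in>verts (fst (T v)). snd (s (v, x)),
    \<lambda>k\<in>darts (fst (T v)). snd (projr (p (Inr (v, k))))))"
  \<comment> \<open>Roots are the core vertices on both sides, so the root over \<open>v\<close>
    goes to a root; the tree carrying that root defines \<open>\<sigma> v\<close>.\<close>
  have sroot: "s (v, snd (T v)) = (\<sigma> v, snd (T' (\<sigma> v)))" "\<sigma> v \<in> verts H'" if v: "v \<in> verts H" for v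
  proof -
    have "s (v, snd (T v)) \<in> core ?G'"
      using v t by (subst graph_isos_core[OF fG gi]) (auto simp: core)
    then obtain w where "s (v, snd (T v)) = (w, snd (T' w))" "w \<in> verts H'"
      using core(2) by auto
    then show "s (v, snd (T v)) = (\<sigma> v, snd (T' (\<sigma> v)))" "\<sigma> v \<in> verts H'"
      using v by (simp_all add: \<sigma>_def)
  qed
  have isl: "isl (p d) \<longleftrightarrow> isl d" if d: "d \<in> darts ?G" for d
  proof -
    have "opp ?G d \<in> darts ?G" "base ?G d \<in> verts ?G" "base ?G (opp ?G d) \<in> verts ?G"
      using d finite_graphD(3,4)[OF fG(1)] by blast+
    moreover have "base ?G' (p d) = s (base ?G d)" "base ?G' (opp ?G' (p d)) = s (base ?G (opp ?G d))"
      using i(3,4) d calculation(1) by simp_all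
    moreover have "isl d \<longleftrightarrow> base ?G d \<in> core ?G \<and> base ?G (opp ?G d) \<in> core ?G"
      by (rule isl_graft_iff[OF H(1,3) T d])
    moreover have "isl (p d) \<longleftrightarrow> base ?G' (p d) \<in> core ?G' \<and> base ?G' (opp ?G' (p d)) \<in> core ?G'"
      by (rule isl_graft_iff[OF H(2,4) T' i(6)[OF d]])
    ultimately show ?thesis
      using graph_isos_core[OF fG gi] by simp
  qed
  have pl: "p (Inl h) = Inl (\<pi> h)" "\<pi> h \<in> darts H'" if h: "h \<in> darts H" for h
    using isl[of "Inl h"] i(6)[of "Inl h"] h by (auto simp: \<pi>_def)
  \<comment> \<open>Induction along the tree, starting at its root: a tree dart goes to a tree dart,
    and both ends of a tree dart lie in the same tree.\<close>
  have s1: "fst (s (v, x)) = \<sigma> v" if v: "v \<in> verts H" "x \<in> verts (fst (T v))" for v x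
    using t(1,2,3)[OF v(1)] arg_cong[OF sroot(1)[OF v(1)], of fst, unfolded fst_conv]
  proof (induction rule: connected_graph_induct)
    case (closed k)
    have d: "Inr (v, k) \<in> darts ?G" using closed(1) v by auto
    obtain w l where "p (Inr (v, k)) = Inr (w, l)"
      using isl[OF d] by (cases "p (Inr (v, k))") auto
    then show ?case
      using i(3,4)[OF d] i(3)[of "opp ?G (Inr (v, k))"] closed(2)
        finite_graphD[OF fG(1)] d by (metis fst_conv graft_simps(4,6))
  qed (rule v)
  have s2: "s (v, x) = (\<sigma> v, fst (\<psi> v) x)" if "v \<in> verts H" "x \<in> verts (fst (T v))" for v x
    using s1[OF that] that by (auto simp: \<psi>_def prod_eq_iff)
  have pr: "p (Inr (v, k)) = Inr (\<sigma> v, snd (\<psi> v) k)" if v: "v \<in> verts H" "k \<in> darts (fst (T v))" for v k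
  proof -
    have d: "Inr (v, k) \<in> darts ?G" using v by auto
    obtain w l where wl: "p (Inr (v, k)) = Inr (w, l)"
      using isl[OF d] by (cases "p (Inr (v, k))") auto
    moreover have "w = \<sigma> v"
      using i(3)[OF d] wl s1[OF v(1)] v t by (simp add: finite_graphD prod_eq_iff)
    ultimately show ?thesis using v by (simp add: \<psi>_def)
  qed
  have sinj: "a = b" if "s a = s b" "a \<in> verts ?G" "b \<in> verts ?G" for a b
    using that i(1) by (meson bij_betw_def inj_onD)
  have pinj: "a = b" if "p a = p b" "a \<in> darts ?G" "b \<in> darts ?G" for a b
    using that i(2) by (meson bij_betw_def inj_onD)
  have \<sigma>inj: "v = w" if "\<sigma> v = \<sigma> w" "v \<in> verts H" "w \<in> verts H" for v w
    using sinj[of "(v, snd (T v))" "(w, snd (T w))"] that sroot t by auto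
  have \<sigma>bij: "bij_betw \<sigma> (verts H) (verts H')"
  proof (rule bij_betw_imageI)
    show "inj_on \<sigma> (verts H)" by (rule inj_onI) (rule \<sigma>inj)
    have "w \<in> \<sigma> ` verts H" if w: "w \<in> verts H'" for w
    proof -
      have "(w, snd (T' w)) \<in> s ` verts ?G"
        using w t' bij_betw_imp_surj_on[OF i(1)] by auto
      then show ?thesis using s2 by auto
    qed
    then show "\<sigma> ` verts H = verts H'" using sroot(2) by auto
  qed
  have \<pi>bij: "bij_betw \<pi> (darts H) (darts H')"
  proof (rule bij_betw_imageI)
    show "inj_on \<pi> (darts H)"
    proof (rule inj_onI)
      fix x y assume "x \<in> darts H" "y \<in> darts H" "\<pi> x = \<pi> y"
      then show "x = y" using pinj[of "Inl x" "Inl y"] pl by auto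
    qed
    have "h \<in> \<pi> ` darts H" if "h \<in> darts H'" for h
    proof -
      have "Inl h \<in> p ` darts ?G"
        using that bij_betw_imp_surj_on[OF i(2)] by auto
      then show ?thesis using pl pr by auto
    qed
    then show "\<pi> ` darts H = darts H'" using pl(2) by auto
  qed
  have "base H' (\<pi> h) = \<sigma> (base H h) \<and> opp H' (\<pi> h) = \<pi> (opp H h)" if "h \<in> darts H" for h
    using i(3,4)[of "Inl h"] that pl sroot fH by auto
  then have \<theta>: "(\<sigma>, \<pi>) \<in> isos H H'"
    using \<sigma>bij \<pi>bij by (simp add: marked_isos_iff graph_isos_def) (simp add: \<sigma>_def \<pi>_def)
  have "\<psi> v \<in> rooted_isos (T v) (T' (\<sigma> v))" if v: "v \<in> verts H" for v
  proof -
    note tv = finite_graphD[OF t(1)[OF v]]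
    have 1: "bij_betw (fst (\<psi> v)) (verts (fst (T v))) (verts (fst (T' (\<sigma> v))))"
    proof (rule bij_betw_imageI)
      show "inj_on (fst (\<psi> v)) (verts (fst (T v)))"
      proof (rule inj_onI)
        fix x y assume "x \<in> verts (fst (T v))" "y \<in> verts (fst (T v))" "fst (\<psi> v) x = fst (\<psi> v) y"
        then show "x = y" using sinj[of "(v, x)" "(v, y)"] s2 v by auto
      qed
      have "y \<in> fst (\<psi> v) ` verts (fst (T v))" if "y \<in> verts (fst (T' (\<sigma> v)))" for y
      proof -
        have "(\<sigma> v, y) \<in> s ` verts ?G"
          using that v sroot(2) bij_betw_imp_surj_on[OF i(1)] by auto
        then obtain w x where "w \<in> verts H" "x \<in> verts (fst (T w))" "s (w, x) = (\<sigma> v, y)"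
          by auto
        then show ?thesis using s2[of w x] \<sigma>inj[of w v] v by auto
      qed
      moreover have "fst (\<psi> v) x \<in> verts (fst (T' (\<sigma> v)))" if "x \<in> verts (fst (T v))" for x
        using i(5)[of "(v, x)"] s2 v that by auto
      ultimately show "fst (\<psi> v) ` verts (fst (T v)) = verts (fst (T' (\<sigma> v)))" by auto
    qed
    have 2: "bij_betw (snd (\<psi> v)) (darts (fst (T v))) (darts (fst (T' (\<sigma> v))))"
    proof (rule bij_betw_imageI)
      show "inj_on (snd (\<psi> v)) (darts (fst (T v)))"
      proof (rule inj_onI)
        fix x y assume "x \<in> darts (fst (T v))" "y \<in> darts (fst (T v))" "snd (\<psi> v) x = snd (\<psi> v) y"
        then show "x = y" using pinj[of "Inr (v, x)" "Inr (v, y)"] pr v by auto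
      qed
      have "y \<in> snd (\<psi> v) ` darts (fst (T v))" if "y \<in> darts (fst (T' (\<sigma> v)))" for y
      proof -
        have "Inr (\<sigma> v, y) \<in> p ` darts ?G"
          using that v sroot(2) bij_betw_imp_surj_on[OF i(2)] by auto
        then obtain w x where "w \<in> verts H" "x \<in> darts (fst (T w))" "p (Inr (w, x)) = Inr (\<sigma> v, y)"
          using pl by auto
        then show ?thesis using pr[of w x] \<sigma>inj[of w v] v by auto
      qed
      moreover have "snd (\<psi> v) x \<in> darts (fst (T' (\<sigma> v)))" if "x \<in> darts (fst (T v))" for x
        using i(6)[of "Inr (v, x)"] pr v that by auto
      ultimately show "snd (\<psi> v) ` darts (fst (T v)) = darts (fst (T' (\<sigma> v)))" by auto
    qed
    have 3: "base (fst (T' (\<sigma> v))) (snd (\<psi> v) k) = fst (\<psi> v) (base (fst (T v)) k) \<and>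
       opp (fst (T' (\<sigma> v))) (snd (\<psi> v) k) = snd (\<psi> v) (opp (fst (T v)) k)"
      if "k \<in> darts (fst (T v))" for k
      using i(3,4)[of "Inr (v, k)"] that v pr s2 tv by auto
    have 4: "fst (\<psi> v) (snd (T v)) = snd (T' (\<sigma> v))"
      using s2[of v "snd (T v)"] sroot v t by auto
    have 5: "fst (\<psi> v) \<in> extensional (verts (fst (T v)))" "snd (\<psi> v) \<in> extensional (darts (fst (T v)))"
      using v by (auto simp: \<psi>_def)
    have "(fst (\<psi> v), snd (\<psi> v)) \<in> rooted_isos (T v) (T' (\<sigma> v))"
      using 1 2 3 4 5 unfolding marked_isos_iff graph_isos_def by (simp add: case_prod_beta)
    then show ?thesis by simp
  qed
  then have \<psi>: "\<psi> \<in> (\<Pi>\<^sub>E v\<in>verts H. rooted_isos (T v) (T' (fst (\<sigma>, \<pi>) v)))"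
    by (auto simp: PiE_def \<psi>_def)
  have "graft_map H T (\<sigma>, \<pi>) \<psi> = (s, p)"
    unfolding graft_map_def
  proof (intro prod_eqI; simp only: fst_conv snd_conv; intro extensionalityI)
    show "(\<lambda>(v, x)\<in>verts ?G. (\<sigma> v, fst (\<psi> v) x)) x = s x" if "x \<in> verts ?G" for x
      using that s2 by auto
    show "(\<lambda>d\<in>darts ?G. map_sum \<pi> (\<lambda>(v, k). (\<sigma> v, snd (\<psi> v) k)) d) d = p d" if "d \<in> darts ?G" for d
      using that pl pr by auto
  qed (use ext in auto)
  with \<theta> \<psi> show ?thesis by force
qed

text \<open>Every tree contains its root, hence is nonempty, so the vertex part of
  \<open>\<theta>\<close> can be read off from first components; the darts \<open>Inl h\<close> give
  the dart part.\<close>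

lemma graft_map_inj:
  assumes T: "\<And>v. v \<in> verts H \<Longrightarrow> T v \<in> rooted_trees"
    and \<theta>: "\<theta> \<in> isos H H'" "\<theta>' \<in> isos H H'"
    and \<psi>: "\<psi> \<in> (\<Pi>\<^sub>E v\<in>verts H. rooted_isos (T v) (T' (fst \<theta> v)))"
      "\<psi>' \<in> (\<Pi>\<^sub>E v\<in>verts H. rooted_isos (T v) (T' (fst \<theta>' v)))"
    and eq: "graft_map H T \<theta> \<psi> = graft_map H T \<theta>' \<psi>'"
  shows "\<theta> = \<theta>'" "\<psi> = \<psi>'"
proof -
  note t = rooted_treesD[OF T]
  have 1: "fst \<theta> v = fst \<theta>' v \<and> fst (\<psi> v) x = fst (\<psi>' v) x" if "v \<in> verts H" "x \<in> verts (fst (T v))" for v x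
    using that fun_cong[OF arg_cong[OF eq, of fst], of "(v, x)"] by (simp add: graft_map_def)
  have 2: "snd \<theta> h = snd \<theta>' h" if "h \<in> darts H" for h
    using that fun_cong[OF arg_cong[OF eq, of snd], of "Inl h"] by (simp add: graft_map_def)
  have 3: "snd (\<psi> v) k = snd (\<psi>' v) k" if "v \<in> verts H" "k \<in> darts (fst (T v))" for v k
    using that fun_cong[OF arg_cong[OF eq, of snd], of "Inr (v, k)"] by (simp add: graft_map_def)
  have e: "fst \<theta> \<in> extensional (verts H)" "snd \<theta> \<in> extensional (darts H)" if "\<theta> \<in> isos H H'" for \<theta>
    using that by (auto simp: marked_isos_def)
  show "\<theta> = \<theta>'"
    using 1 2 t(3) e[OF \<theta>(1)] e[OF \<theta>(2)]
    by (intro prod_eqI extensionalityI[where A = "verts H"] extensionalityI[where A = "darts H"]) blast+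
  have f: "fst (\<psi> v) \<in> extensional (verts (fst (T v)))" "snd (\<psi> v) \<in> extensional (darts (fst (T v)))"
    if "\<psi> \<in> (\<Pi>\<^sub>E v\<in>verts H. rooted_isos (T v) (T' (fst \<theta> v)))" "v \<in> verts H" for \<psi> v \<theta>
    using PiE_mem[OF that] by (auto simp: marked_isos_def)
  have "\<psi> v = \<psi>' v" if v: "v \<in> verts H" for v
    using 1[OF v] 3[OF v] f[OF \<psi>(1) v] f[OF \<psi>(2) v]
    by (intro prod_eqI extensionalityI[where A = "verts (fst (T v))"]
        extensionalityI[where A = "darts (fst (T v))"]) blast+
  then show "\<psi> = \<psi>'"
    by (intro PiE_ext[OF \<psi>(1)]) (use \<psi>(2) in \<open>auto simp: \<open>\<theta> = \<theta>'\<close>\<close>)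
qed

text \<open>The splitting is a bijection onto pairs of an isomorphism of bases and a family of
  rooted isomorphisms above it, and such families are counted by a product.\<close>

lemma card_isos_graft:
  assumes H: "finite_graph H" "finite_graph H'" "min_degree 2 H" "min_degree 2 H'"
    and T: "\<And>v. v \<in> verts H \<Longrightarrow> T v \<in> rooted_trees"
    and T': "\<And>v. v \<in> verts H' \<Longrightarrow> T' v \<in> rooted_trees"
  shows "card (isos (graft H T) (graft H' T')) =
    (\<Sum>\<theta>\<in>isos H H'. \<Prod>v\<in>verts H. card (rooted_isos (T v) (T' (fst \<theta> v))))"
proof -
  note t = rooted_treesD[OF T] and t' = rooted_treesD[OF T'] and fH = finite_graphD[OF H(1)]
  let ?P = "\<lambda>\<theta>. \<Pi>\<^sub>E v\<in>verts H. rooted_isos (T v) (T' (fst \<theta> v))"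
  have "bij_betw (\<lambda>(\<theta>, \<psi>). graft_map H T \<theta> \<psi>) (Sigma (isos H H') ?P) (isos (graft H T) (graft H' T'))"
  proof (rule bij_betw_imageI)
    show "inj_on (\<lambda>(\<theta>, \<psi>). graft_map H T \<theta> \<psi>) (Sigma (isos H H') ?P)"
    proof (rule inj_onI)
      fix x y
      assume "x \<in> Sigma (isos H H') ?P" "y \<in> Sigma (isos H H') ?P"
        "(\<lambda>(\<theta>, \<psi>). graft_map H T \<theta> \<psi>) x = (\<lambda>(\<theta>, \<psi>). graft_map H T \<theta> \<psi>) y"
      then show "x = y"
        using graft_map_inj[where \<theta> = "fst x" and \<theta>' = "fst y" and \<psi> = "snd x" and \<psi>' = "snd y", OF T]
        by (intro prod_eqI) (auto simp: case_prod_beta)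
    qed
    show "(\<lambda>(\<theta>, \<psi>). graft_map H T \<theta> \<psi>) ` Sigma (isos H H') ?P = isos (graft H T) (graft H' T')"
    proof (intro equalityI subsetI)
      fix q assume "q \<in> isos (graft H T) (graft H' T')"
      then show "q \<in> (\<lambda>(\<theta>, \<psi>). graft_map H T \<theta> \<psi>) ` Sigma (isos H H') ?P"
        using isos_graft_split[OF H, of T T' "fst q" "snd q"] T T' by simp
    qed (use graft_map_in_isos[OF H(1,2), of T T'] T T' in auto)
  qed
  then have "card (isos (graft H T) (graft H' T')) = card (Sigma (isos H H') ?P)"
    by (simp add: bij_betw_same_card)
  also have "\<dots> = (\<Sum>\<theta>\<in>isos H H'. card (?P \<theta>))"
  proof (rule card_SigmaI)
    show "finite (isos H H')" using H by (intro finite_marked_isos)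
    have "fst \<theta> v \<in> verts H'" if "\<theta> \<in> isos H H'" "v \<in> verts H" for \<theta> v
      using that graph_isosD(5) by (fastforce simp: marked_isos_def)
    then show "\<forall>\<theta>\<in>isos H H'. finite (?P \<theta>)"
      using fH t t' by (auto intro!: finite_PiE finite_marked_isos)
  qed
  also have "\<dots> = (\<Sum>\<theta>\<in>isos H H'. \<Prod>v\<in>verts H. card (rooted_isos (T v) (T' (fst \<theta> v))))"
    using fH by (simp add: card_PiE)
  finally show ?thesis .
qed

text \<open>Summing over all choices \<open>T\<close> turns the product over vertices into a product
  of sums over \<open>R\<close>. Each of these sums is 1, so every isomorphism of the bases
  contributes 1.\<close>

lemma sum_card_isos_graft:
  fixes R :: "(ngraph \<times> nat) set"
  assumes H: "finite_graph H" "finite_graph H'" "min_degree 2 H" "min_degree 2 H'"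
    and T': "\<And>v. v \<in> verts H' \<Longrightarrow> T' v \<in> rooted_trees"
    and R: "finite R" "R \<subseteq> rooted_trees"
    and ex1: "\<And>v. v \<in> verts H' \<Longrightarrow> \<exists>!\<tau>. \<tau> \<in> R \<and> rooted_isos \<tau> (T' v) \<noteq> {}"
  shows "(\<Sum>T\<in>verts H \<rightarrow>\<^sub>E R. of_nat (card (isos (graft H T) (graft H' T'))) /
      (\<Prod>v\<in>verts H. of_nat (card (root_Aut (fst (T v)) (snd (T v)))))) = (of_nat (card (isos H H')) :: rat)"
    (is "?l = _")
proof -
  note fH = finite_graphD[OF H(1)]
  let ?q = "\<lambda>\<tau> \<tau>'. of_nat (card (rooted_isos \<tau> \<tau>')) / of_nat (card (root_Aut (fst \<tau>) (snd \<tau>))) :: rat"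
  \<comment> \<open>Only one tree in \<open>R\<close> is isomorphic to the target tree, and it has
    as many rooted isomorphisms to it as rooted automorphisms.\<close>
  have one: "(\<Sum>\<tau>\<in>R. ?q \<tau> (T' v)) = 1" if v: "v \<in> verts H'" for v
  proof -
    obtain \<tau> where \<tau>: "\<tau> \<in> R" "rooted_isos \<tau> (T' v) \<noteq> {}"
      and u: "\<And>\<tau>'. \<tau>' \<in> R \<Longrightarrow> rooted_isos \<tau>' (T' v) \<noteq> {} \<Longrightarrow> \<tau>' = \<tau>"
      using ex1[OF v] unfolding Ex1_def by blast
    note t = rooted_treesD[OF subsetD[OF R(2) \<tau>(1)]] and t' = rooted_treesD[OF T'[OF v]]
    obtain \<alpha> \<beta> where ab: "(\<alpha>, \<beta>) \<in> rooted_isos \<tau> (T' v)" using \<tau>(2) by auto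
    have "card (rooted_isos \<tau> \<tau>) = card (rooted_isos \<tau> (T' v))"
      using t t' ab by (intro card_marked_isos_target[where \<alpha> = \<alpha> and \<beta> = \<beta>]) (auto simp: marked_isos_iff)
    moreover have "card (rooted_isos \<tau> (T' v)) \<noteq> 0"
      using \<tau>(2) finite_marked_isos[OF t(1) t'(1)] by simp
    ultimately have "?q \<tau> (T' v) = 1"
      using card_rooted_isos_self[OF t(1,3)] by simp
    moreover have "(\<Sum>\<tau>'\<in>R. ?q \<tau>' (T' v)) = (\<Sum>\<tau>'\<in>{\<tau>}. ?q \<tau>' (T' v))"
    proof (rule sum.mono_neutral_right)
      show "\<forall>\<tau>'\<in>R - {\<tau>}. ?q \<tau>' (T' v) = 0"
      proof
        fix \<tau>' assume "\<tau>' \<in> R - {\<tau>}"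
        then have "rooted_isos \<tau>' (T' v) = {}" using u by blast
        then show "?q \<tau>' (T' v) = 0" by simp
      qed
    qed (use R(1) \<tau>(1) in simp_all)
    ultimately show ?thesis by simp
  qed
  have "?l = (\<Sum>T\<in>verts H \<rightarrow>\<^sub>E R. \<Sum>\<theta>\<in>isos H H'. \<Prod>v\<in>verts H. ?q (T v) (T' (fst \<theta> v)))"
  proof (rule sum.cong[OF refl])
    fix T assume "T \<in> verts H \<rightarrow>\<^sub>E R"
    then have T: "T v \<in> rooted_trees" if "v \<in> verts H" for v
      using that R(2) PiE_mem by blast
    have "card (isos (graft H T) (graft H' T')) =
      (\<Sum>\<theta>\<in>isos H H'. \<Prod>v\<in>verts H. card (rooted_isos (T v) (T' (fst \<theta> v))))"
      by (rule card_isos_graft[OF H T T'])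
    then show "of_nat (card (isos (graft H T) (graft H' T'))) /
      (\<Prod>v\<in>verts H. of_nat (card (root_Aut (fst (T v)) (snd (T v))))) =
      (\<Sum>\<theta>\<in>isos H H'. \<Prod>v\<in>verts H. ?q (T v) (T' (fst \<theta> v)))"
      by (simp add: sum_divide_distrib prod_dividef)
  qed
  also have "\<dots> = (\<Sum>\<theta>\<in>isos H H'. \<Sum>T\<in>verts H \<rightarrow>\<^sub>E R. \<Prod>v\<in>verts H. ?q (T v) (T' (fst \<theta> v)))"
    by (rule sum.swap)
  also have "\<dots> = (\<Sum>\<theta>\<in>isos H H'. \<Prod>v\<in>verts H. \<Sum>\<tau>\<in>R. ?q \<tau> (T' (fst \<theta> v)))"
    using fH R by (intro sum.cong refl prod_sum_PiE[symmetric]) auto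
  also have "\<dots> = (\<Sum>\<theta>\<in>isos H H'. 1)"
  proof (intro sum.cong refl prod.neutral ballI one)
    fix \<theta> v assume "\<theta> \<in> isos H H'" "v \<in> verts H"
    then show "fst \<theta> v \<in> verts H'"
      using graph_isosD(5) by (fastforce simp: marked_isos_def)
  qed
  finally show ?thesis by simp
qed

section \<open>Subdivisions\<close>

text \<open>A name is a pair of descriptions, so names coincide exactly when the descriptions agree
  or are exchanged. Position 0 is covered as well: its partner would have position
  \<open>n {h, opp G h} + 1\<close>, which is out of range.\<close>

lemma subdiv_vertex_eq_iff:
  assumes G: "finite_graph G" and h: "h \<in> darts G" "h' \<in> darts G"
    and i: "i \<le> n {h, opp G h}" "j \<le> n {h', opp G h'}"
  shows "subdiv_vertex G n h i = subdiv_vertex G n h' j \<longleftrightarrow>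
    h' = h \<and> j = i \<or> h' = opp G h \<and> j = n {h, opp G h} + 1 - i"
proof -
  have [simp]: "{opp G h, h} = {h, opp G h}" by blast
  show ?thesis
    using finite_graphD(4-6)[OF G h(1)] finite_graphD(4-6)[OF G h(2)] i
    unfolding subdiv_vertex_def doubleton_eq_iff by (auto simp: insert_commute)
qed

lemma subdivide_simps [simp]:
  "verts (subdivide G n) = Inl ` verts G \<union>
     {Inr (subdiv_vertex G n h i) | h i. h \<in> darts G \<and> 1 \<le> i \<and> i \<le> n {h, opp G h}}"
  "darts (subdivide G n) = {(h, i). h \<in> darts G \<and> i \<le> n {h, opp G h}}"
  "base (subdivide G n) (h, i) = (if i = 0 then Inl (base G h) else Inr (subdiv_vertex G n h i))"
  "opp (subdivide G n) (h, i) = (opp G h, n {h, opp G h} - i)"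
  by (simp_all add: subdivide_def)

lemma finite_darts_subdivide:
  assumes "finite_graph G"
  shows "finite (darts (subdivide G n))"
proof -
  have "darts (subdivide G n) = (SIGMA h:darts G. {..n {h, opp G h}})"
    by auto
  then show ?thesis using assms by (auto simp: finite_graphD simp del: subdivide_simps)
qed

lemma finite_graph_subdivide:
  assumes G: "finite_graph G"
  shows "finite_graph (subdivide G n)"
proof -
  note fG = finite_graphD[OF G]
  have len: "n {opp G h, opp G (opp G h)} = n {h, opp G h}" if "h \<in> darts G" for h
    using fG(6)[OF that] by (simp add: insert_commute)
  have "{Inr (subdiv_vertex G n h i) | h i. h \<in> darts G \<and> 1 \<le> i \<and> i \<le> n {h, opp G h}}
    \<subseteq> (\<lambda>(h, i). Inr (subdiv_vertex G n h i)) ` darts (subdivide G n)"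
    by auto
  from finite_subset[OF this] have "finite (verts (subdivide G n))"
    using finite_darts_subdivide[OF G] fG(1) by (simp del: subdivide_simps(2))
  moreover have "base (subdivide G n) d \<in> verts (subdivide G n) \<and> opp (subdivide G n) d \<in> darts (subdivide G n) \<and>
      opp (subdivide G n) d \<noteq> d \<and> opp (subdivide G n) (opp (subdivide G n) d) = d"
    if "d \<in> darts (subdivide G n)" for d
    using that fG len by (cases d) auto
  ultimately show ?thesis
    using finite_darts_subdivide[OF G] unfolding finite_graph_def by blast
qed

lemma sum_darts_edges:
  assumes "finite_graph G"
  shows "(\<Sum>h\<in>darts G. f {h, opp G h}) = 2 * (\<Sum>e\<in>edges G. f e :: nat)"
proof -
  note fG = finite_graphD[OF assms]
  have "(\<Sum>h\<in>{h \<in> darts G. {h, opp G h} = e}. f {h, opp G h}) = 2 * f e" if "e \<in> edges G" for e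
  proof -
    obtain k where k: "k \<in> darts G" "e = {k, opp G k}" using \<open>e \<in> edges G\<close> by (auto simp: edges_def)
    have "{h \<in> darts G. {h, opp G h} = e} = {k, opp G k}"
      using k fG(4,6) by (auto simp: doubleton_eq_iff)
    then show ?thesis
      using k fG(5)[OF k(1)] fG(6)[OF k(1)] by (simp add: insert_commute)
  qed
  then have "(\<Sum>e\<in>edges G. \<Sum>h\<in>{h \<in> darts G. {h, opp G h} = e}. f {h, opp G h}) = 2 * (\<Sum>e\<in>edges G. f e)"
    unfolding sum_distrib_left by (intro sum.cong refl)
  then show ?thesis
    using sum.image_gen[OF fG(2), of "\<lambda>h. f {h, opp G h}" "\<lambda>h. {h, opp G h}"]
    unfolding edges_def[symmetric] by argo
qed

text \<open>New vertices are the orbits of the involution that exchanges the two descriptions. It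
  has no fixed point even at the middle of a path, because \<open>opp G h\<close> differs from
  \<open>h\<close>.\<close>

lemma card_verts_subdivide:
  assumes G: "finite_graph G"
  shows "card (verts (subdivide G n)) = card (verts G) + (\<Sum>e\<in>edges G. n e)"
proof -
  note fG = finite_graphD[OF G]
  have len: "n {opp G h, h} = n {h, opp G h}" for h by (simp add: insert_commute)
  let ?A = "SIGMA h:darts G. {1..n {h, opp G h}}"
  let ?f = "\<lambda>(h, i). (opp G h, n {h, opp G h} + 1 - i)"
  let ?V = "(\<lambda>x. {x, ?f x}) ` ?A"
  have V: "{Inr (subdiv_vertex G n h i) | h i. h \<in> darts G \<and> 1 \<le> i \<and> i \<le> n {h, opp G h}}
      = (Inr ` ?V :: ('a + ('b \<times> nat) set) set)"
  proof -
    have "{Inr (subdiv_vertex G n h i) | h i. h \<in> darts G \<and> 1 \<le> i \<and> i \<le> n {h, opp G h}}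
      = (\<lambda>x. Inr (subdiv_vertex G n (fst x) (snd x))) ` ?A"
    proof (intro equalityI subsetI)
      fix x assume "x \<in> {Inr (subdiv_vertex G n h i) | h i. h \<in> darts G \<and> 1 \<le> i \<and> i \<le> n {h, opp G h}}"
      then obtain h i where "x = Inr (subdiv_vertex G n h i)" "(h, i) \<in> ?A" by force
      then show "x \<in> (\<lambda>x. Inr (subdiv_vertex G n (fst x) (snd x))) ` ?A"
        by (intro image_eqI[where x = "(h, i)"]) simp_all
    next
      fix x assume "x \<in> (\<lambda>x. Inr (subdiv_vertex G n (fst x) (snd x))) ` ?A"
      then obtain h i where "x = Inr (subdiv_vertex G n h i)" "h \<in> darts G" "1 \<le> i" "i \<le> n {h, opp G h}"
        by (elim imageE SigmaE) simp
      then show "x \<in> {Inr (subdiv_vertex G n h i) | h i. h \<in> darts G \<and> 1 \<le> i \<and> i \<le> n {h, opp G h}}"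
        by blast
    qed
    also have "\<dots> = Inr ` ?V"
      unfolding image_image by (intro image_cong refl) (auto simp: subdiv_vertex_def)
    finally show ?thesis .
  qed
  have "2 * card ?V = card ?A"
  proof (rule card_doubleton_image)
    show "finite ?A" using fG by auto
    fix x assume "x \<in> ?A"
    then show "?f x \<in> ?A" "?f x \<noteq> x" "?f (?f x) = x"
      using fG len by auto
  qed
  also have "card ?A = (\<Sum>h\<in>darts G. n {h, opp G h})"
    using fG by simp
  also have "\<dots> = 2 * (\<Sum>e\<in>edges G. n e)"
    by (rule sum_darts_edges[OF G])
  finally have "card ?V = (\<Sum>e\<in>edges G. n e)" by simp
  moreover have "card (verts (subdivide G n)) = card (verts G) + card ?V"
    unfolding subdivide_simps V using fG by (subst card_Un_disjoint) (auto simp: card_image)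
  ultimately show ?thesis by simp
qed

text \<open>An edge that receives \<open>m\<close> new vertices also gains \<open>m\<close>
  edges.\<close>

lemma betti_subdivide:
  assumes G: "finite_graph G"
  shows "betti (subdivide G n) = betti G"
proof -
  note fG = finite_graphD[OF G] and fS = finite_graph_subdivide[OF G]
  have D: "darts (subdivide G n) = (SIGMA h:darts G. {..n {h, opp G h}})"
    by auto
  have "card (darts (subdivide G n)) = (\<Sum>h\<in>darts G. n {h, opp G h} + 1)"
    unfolding D using fG by simp
  also have "\<dots> = card (darts G) + 2 * (\<Sum>e\<in>edges G. n e)"
    unfolding sum.distrib sum_darts_edges[OF G] by simp
  finally show ?thesis
    using betti_iff[OF G, of "betti G"] betti_iff[OF fS, of n "betti G"] card_verts_subdivide[OF G, of n]
    by linarith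
qed

lemma subdivide_degree_Inl:
  "vertex_degree (subdivide G n) (Inl v) = vertex_degree G v"
proof -
  have "{h \<in> darts (subdivide G n). base (subdivide G n) h = Inl v} = (\<lambda>h. (h, 0)) ` {h \<in> darts G. base G h = v}"
    by (auto split: if_splits)
  then show ?thesis by (simp add: vertex_degree_def card_image inj_on_def)
qed

text \<open>Each of the two descriptions of a new vertex is also a dart leaving it, one in each
  direction along the path.\<close>

lemma subdivide_darts_Inr:
  assumes G: "finite_graph G" and h: "h \<in> darts G" "1 \<le> i" "i \<le> n {h, opp G h}"
  shows "{d \<in> darts (subdivide G n). base (subdivide G n) d = Inr (subdiv_vertex G n h i)} =
    {(h, i), (opp G h, n {h, opp G h} + 1 - i)}" (is "?l = ?r")
proof -
  have "d \<in> ?l \<longleftrightarrow> d \<in> ?r" for d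
  proof (cases d)
    case (Pair k j)
    have len: "n {opp G h, opp G (opp G h)} = n {h, opp G h}"
      using finite_graphD(6)[OF G h(1)] by (simp add: insert_commute)
    show ?thesis
    proof (cases "k \<in> darts G \<and> j \<le> n {k, opp G k}")
      case True
      have "d \<in> ?l \<longleftrightarrow> 0 < j \<and> subdiv_vertex G n h i = subdiv_vertex G n k j"
        using True Pair by auto
      also have "\<dots> \<longleftrightarrow> 0 < j \<and> (k = h \<and> j = i \<or> k = opp G h \<and> j = n {h, opp G h} + 1 - i)"
        using subdiv_vertex_eq_iff[OF G h(1), of k i n j] True h by simp
      finally show ?thesis using Pair h by auto
    next
      case False
      then show ?thesis using Pair h len finite_graphD(4)[OF G h(1)] by auto
    qed
  qed
  then show ?thesis by blast
qed

lemma subdivide_degree_Inr: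
  assumes G: "finite_graph G" and v: "Inr s \<in> verts (subdivide G n)"
  shows "vertex_degree (subdivide G n) (Inr s) = 2"
proof -
  obtain h i where h: "s = subdiv_vertex G n h i" "h \<in> darts G" "1 \<le> i" "i \<le> n {h, opp G h}"
    using v by auto
  show ?thesis
    unfolding vertex_degree_def h(1) subdivide_darts_Inr[where n = n and h = h and i = i, OF G h(2-4)]
    using finite_graphD(5)[OF G h(2)] by simp
qed

lemma min_degree_subdivide:
  assumes G: "finite_graph G" "min_degree 3 G"
  shows "min_degree 2 (subdivide G n)"
  unfolding min_degree_def
proof
  fix v assume v: "v \<in> verts (subdivide G n)"
  show "2 \<le> vertex_degree (subdivide G n) v"
  proof (cases v)
    case (Inl u)
    then have "3 \<le> vertex_degree G u" using v G(2) by (auto simp: min_degree_def)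
    then show ?thesis using Inl by (simp add: subdivide_degree_Inl)
  qed (use subdivide_degree_Inr[OF G(1)] v in auto)
qed

text \<open>In one direction a closed set of vertices of \<open>G\<close> is extended over the new
  vertices; in the other a closed set of the subdivision is traced along the paths that replace
  edges.\<close>

lemma connected_subdivide:
  assumes G: "finite_graph G"
  shows "connected_graph (subdivide G n) \<longleftrightarrow> connected_graph G"
proof
  note fG = finite_graphD[OF G] and fS = finite_graph_subdivide[OF G]
  let ?S = "subdivide G n"
  have len: "n {opp G h, h} = n {h, opp G h}" for h by (simp add: insert_commute)
  assume c: "connected_graph ?S"
  obtain p where p: "p \<in> verts ?S" using c by (auto simp: connected_graph_def)
  have "verts G \<noteq> {}"
    using p fG(3) by fastforce
  then obtain u where u: "u \<in> verts G" by auto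
  show "connected_graph G"
  proof (rule connected_graphI[OF G u], rule subsetI)
    fix A v w assume A: "A \<subseteq> verts G" "v \<in> A" "w \<in> verts G"
      and cl: "\<And>h. h \<in> darts G \<Longrightarrow> base G h \<in> A \<Longrightarrow> base G (opp G h) \<in> A"
    have cl': "base G h \<in> A \<longleftrightarrow> base G (opp G h) \<in> A" if "h \<in> darts G" for h
      using cl[of h] cl[of "opp G h"] that fG by auto
    \<comment> \<open>Since \<open>A\<close> is closed, it contains both ends of an edge or neither,
      so the condition does not depend on the description of a new vertex.\<close>
    let ?P = "\<lambda>p. case p of Inl v \<Rightarrow> v \<in> A | Inr s \<Rightarrow> \<forall>(h, i :: nat)\<in>s. base G h \<in> A"
    have P: "?P (base ?S (h, i)) \<longleftrightarrow> base G h \<in> A" if "h \<in> darts G" for h i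
      using cl'[OF that] by (simp add: subdiv_vertex_def)
    have "?P (Inl w)"
    proof (rule connected_graph_induct[OF fS c, where P = ?P])
      show "Inl v \<in> verts ?S" "?P (Inl v)" using A by auto
      fix d assume d: "d \<in> darts ?S" "?P (base ?S d)"
      obtain h i where hi: "d = (h, i)" "h \<in> darts G" using d(1) by auto
      then have "base G (opp G h) \<in> A" using d(2) P[OF hi(2), of i] cl'[OF hi(2)] by simp
      then show "?P (base ?S (opp ?S d))"
        unfolding hi(1) subdivide_simps(4) by (subst P) (use fG hi in auto)
    qed (use A in auto)
    then show "w \<in> A" by simp
  qed
next
  note fG = finite_graphD[OF G] and fS = finite_graph_subdivide[OF G]
  let ?S = "subdivide G n"
  assume c: "connected_graph G"
  then obtain u where u: "u \<in> verts G" by (auto simp: connected_graph_def)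
  show "connected_graph ?S"
  proof (rule connected_graphI[OF fS])
    show "Inl u \<in> verts ?S" using u by simp
    fix A p assume A: "A \<subseteq> verts ?S" "p \<in> A"
      and cl: "\<And>d. d \<in> darts ?S \<Longrightarrow> base ?S d \<in> A \<Longrightarrow> base ?S (opp ?S d) \<in> A"
    have walk: "base ?S (h, i) \<in> A" if "h \<in> darts G" "Inl (base G h) \<in> A" "i \<le> n {h, opp G h}" for h i
      using that(3)
    proof (induction i)
      case 0
      then show ?case using that by simp
    next
      case (Suc i)
      then have "base ?S (opp ?S (h, i)) \<in> A"
        using that(1) by (intro cl) auto
      moreover have "subdiv_vertex G n (opp G h) (n {h, opp G h} - i) = subdiv_vertex G n h (Suc i)"
        using Suc(2) that(1) fG by (auto simp: subdiv_vertex_def insert_commute)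
      ultimately show ?case
        using Suc(2) by simp
    qed
    have last: "Inl (base G (opp G h)) \<in> A" if "h \<in> darts G" "Inl (base G h) \<in> A" for h
      using cl[of "(h, n {h, opp G h})"] walk[OF that, of "n {h, opp G h}"] that by simp
    \<comment> \<open>The given point of the closed set may be a new vertex; walking back along its
      path produces an old one.\<close>
    have rev_walk: "Inl (base G h) \<in> A" if "h \<in> darts G" "i \<le> n {h, opp G h}" "base ?S (h, i) \<in> A" for h i
      using that(2,3)
    proof (induction i)
      case (Suc i)
      have D: "{d \<in> darts ?S. base ?S d = Inr (subdiv_vertex G n h (Suc i))} =
          {(h, Suc i), (opp G h, n {h, opp G h} - i)}"
        using subdivide_darts_Inr[where n = n and h = h and i = "Suc i", OF G that(1) _ Suc(2)] by simp
      have "(h, Suc i) \<in> {d \<in> darts ?S. base ?S d = Inr (subdiv_vertex G n h (Suc i))}"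
        "(opp G h, n {h, opp G h} - i) \<in> {d \<in> darts ?S. base ?S d = Inr (subdiv_vertex G n h (Suc i))}"
        unfolding D by auto
      then have "base ?S (opp G h, n {h, opp G h} - i) \<in> A" "(opp G h, n {h, opp G h} - i) \<in> darts ?S"
        using Suc(3) by (auto simp del: subdivide_simps)
      from cl[OF this(2,1)] have "base ?S (h, i) \<in> A"
        using Suc(2) that(1) fG by (simp add: insert_commute)
      with Suc show ?case by simp
    qed simp
    have "\<exists>v\<in>verts G. Inl v \<in> A"
    proof (cases p)
      case (Inr s)
      then obtain h i where "s = subdiv_vertex G n h i" "h \<in> darts G" "1 \<le> i" "i \<le> n {h, opp G h}"
        using A by auto
      then show ?thesis using rev_walk[of h i] A(2) Inr fG(3) by auto
    qed (use A in auto)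
    then obtain v where v: "v \<in> verts G" "Inl v \<in> A" by auto
    have main: "Inl w \<in> A" if "w \<in> verts G" for w
      using G c v last that by (rule connected_graph_induct)
    have "Inr (subdiv_vertex G n h i) \<in> A" if "h \<in> darts G" "1 \<le> i" "i \<le> n {h, opp G h}" for h i
      using walk[OF that(1) _ that(3)] main fG(3)[OF that(1)] that(2) by simp
    then show "verts ?S \<subseteq> A"
      using main by auto
  qed
qed

section \<open>Isomorphisms between subdivisions\<close>

text \<open>Names of new vertices are sets built from darts, so taking images under the dart map
  renames them consistently, and no orientation of edges has to match.\<close>

lemma subdivide_graph_isos:
  assumes G: "finite_graph G" and i: "(\<sigma>, \<pi>) \<in> graph_isos G G'"
    and len: "\<And>h. h \<in> darts G \<Longrightarrow> n {h, opp G h} = n' {\<pi> h, opp G' (\<pi> h)}"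
  shows "(map_sum \<sigma> ((`) (map_prod \<pi> id)), map_prod \<pi> id) \<in> graph_isos (subdivide G n) (subdivide G' n')"
proof -
  note fG = finite_graphD[OF G] and i = graph_isosD[OF i]
  let ?s = "map_sum \<sigma> ((`) (map_prod \<pi> (id :: nat \<Rightarrow> nat)))" and ?p = "map_prod \<pi> (id :: nat \<Rightarrow> nat)"
  let ?S = "subdivide G n" and ?S' = "subdivide G' n'"
  have sv: "map_prod \<pi> id ` subdiv_vertex G n h k = subdiv_vertex G' n' (\<pi> h) k" if "h \<in> darts G" for h k
    using that i(4) len by (simp add: subdiv_vertex_def)
  have pi: "bij_betw ?p (darts ?S) (darts ?S')"
  proof (rule bij_betw_imageI)
    show "inj_on ?p (darts ?S)"
      using bij_betw_imp_inj_on[OF i(2)] by (auto simp: inj_on_def)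
    have "(k, j) \<in> ?p ` darts ?S" if k: "k \<in> darts G'" "j \<le> n' {k, opp G' k}" for k j
    proof -
      obtain h where h: "h \<in> darts G" "k = \<pi> h"
        using k(1) bij_betw_imp_surj_on[OF i(2)] by auto
      then show ?thesis
        using k len[OF h(1)] by (intro image_eqI[where x = "(h, j)"]) auto
    qed
    then show "?p ` darts ?S = darts ?S'"
      using i(6) len by auto
  qed
  have si: "bij_betw ?s (verts ?S) (verts ?S')"
  proof (rule bij_betw_imageI)
    have "A = B" if "map_prod \<pi> id ` A = map_prod \<pi> id ` B" "Inr A \<in> verts ?S" "Inr B \<in> verts ?S" for A B
    proof -
      have "inj_on (map_prod \<pi> id) (darts G \<times> (UNIV :: nat set))"
        using bij_betw_imp_inj_on[OF i(2)] by (auto simp: inj_on_def)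
      moreover have "A \<subseteq> darts G \<times> UNIV" "B \<subseteq> darts G \<times> UNIV"
        using that(2,3) fG by (auto simp: subdiv_vertex_def)
      ultimately show ?thesis using that(1) by (simp add: inj_on_image_eq_iff)
    qed
    moreover have "v = w" if "\<sigma> v = \<sigma> w" "Inl v \<in> verts ?S" "Inl w \<in> verts ?S" for v w
      using that bij_betw_imp_inj_on[OF i(1)] by (auto dest: inj_onD)
    ultimately have "x = y" if "x \<in> verts ?S" "y \<in> verts ?S" "?s x = ?s y" for x y
      using that by (cases x; cases y) (simp_all del: subdivide_simps)
    then show "inj_on ?s (verts ?S)"
      by (rule inj_onI)
    have 1: "Inl w \<in> ?s ` verts ?S" if w: "w \<in> verts G'" for w
    proof -
      obtain v where "v \<in> verts G" "w = \<sigma> v" using w bij_betw_imp_surj_on[OF i(1)] by auto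
      then show ?thesis by (intro image_eqI[where x = "Inl v"]) auto
    qed
    have 2: "Inr (subdiv_vertex G' n' k j) \<in> ?s ` verts ?S"
      if k: "k \<in> darts G'" "1 \<le> j" "j \<le> n' {k, opp G' k}" for k j
    proof -
      obtain h where h: "h \<in> darts G" "k = \<pi> h"
        using k(1) bij_betw_imp_surj_on[OF i(2)] by auto
      moreover have "j \<le> n {h, opp G h}" using k(3) h len[OF h(1)] by simp
      ultimately show ?thesis
        using k(2) sv[OF h(1)]
        by (intro image_eqI[where x = "Inr (subdiv_vertex G n h j)"]) auto
    qed
    have 3: "?s p \<in> verts ?S'" if p: "p \<in> verts ?S" for p
    proof (cases p)
      case (Inr s)
      then obtain h k where h: "s = subdiv_vertex G n h k" "h \<in> darts G" "1 \<le> k" "k \<le> n {h, opp G h}"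
        using p by auto
      then show ?thesis using Inr sv[OF h(2)] len[OF h(2)] i(6)[OF h(2)] by auto
    qed (use p i(5) in auto)
    have "x \<in> ?s ` verts ?S" if x: "x \<in> verts ?S'" for x
    proof (cases x)
      case (Inl w)
      then show ?thesis using x 1[of w] by (auto simp del: subdivide_simps simp: subdivide_simps(1)[of G'])
    next
      case (Inr a)
      then obtain k j where "a = subdiv_vertex G' n' k j" "k \<in> darts G'" "1 \<le> j" "j \<le> n' {k, opp G' k}"
        using x by auto
      then show ?thesis using Inr 2[of k j] by (simp del: subdivide_simps)
    qed
    with 3 show "?s ` verts ?S = verts ?S'" by blast
  qed
  have "base ?S' (?p d) = ?s (base ?S d) \<and> opp ?S' (?p d) = ?p (opp ?S d)" if "d \<in> darts ?S" for d
    using that i(3,4) sv len by (cases d) auto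
  with si pi show ?thesis unfolding graph_isos_def by blast
qed

text \<open>Old vertices go to old vertices by their degrees, and the image of a whole path is then
  forced by its first dart, because at a vertex of degree 2 there is only one way on.\<close>

lemma isos_subdivide_split:
  assumes G: "finite_graph G" "finite_graph G'" "min_degree 3 G" "min_degree 3 G'"
    and i: "(s, p) \<in> graph_isos (subdivide G n) (subdivide G' n')"
  obtains \<sigma> \<pi> where "(\<sigma>, \<pi>) \<in> graph_isos G G'"
    "\<And>h. h \<in> darts G \<Longrightarrow> n {h, opp G h} = n' {\<pi> h, opp G' (\<pi> h)}"
    "\<And>v. v \<in> verts G \<Longrightarrow> s (Inl v) = Inl (\<sigma> v)"
    "\<And>h i. h \<in> darts G \<Longrightarrow> i \<le> n {h, opp G h} \<Longrightarrow> p (h, i) = (\<pi> h, i)"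
proof -
  note fG = finite_graphD[OF G(1)] and fG' = finite_graphD[OF G(2)]
  let ?S = "subdivide G n" and ?S' = "subdivide G' n'"
  note fS = finite_graph_subdivide[OF G(1), of n]
  note fS' = finite_graphD[OF finite_graph_subdivide[OF G(2), of n']]
  note deg = graph_isos_degree[OF fS i]
  note i = graph_isosD[OF i]
  \<comment> \<open>On both sides old vertices have degree at least 3 and new ones exactly
    2.\<close>
  have isl: "isl (s v) \<longleftrightarrow> isl v" if v: "v \<in> verts ?S" for v
  proof -
    have *: "isl v \<longleftrightarrow> vertex_degree (subdivide G n) v \<noteq> 2"
      if "finite_graph G" "min_degree 3 G" "v \<in> verts (subdivide G n)"
      for G :: "('x, 'y) graph" and n v
    proof (cases v)
      case (Inl u)
      then have "3 \<le> vertex_degree G u" using that by (auto simp: min_degree_def)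
      then show ?thesis using Inl by (simp add: subdivide_degree_Inl)
    next
      case (Inr s)
      then show ?thesis using subdivide_degree_Inr[OF that(1), of s n] that(3) by simp
    qed
    show ?thesis using *[OF G(1,3) v] *[OF G(2,4) i(5)[OF v]] deg[OF v] by simp
  qed
  define \<sigma> where "\<sigma> v = projl (s (Inl v))" for v
  define \<pi> where "\<pi> h = fst (p (h, 0))" for h
  let ?n = "\<lambda>h. n {h, opp G h}" and ?n' = "\<lambda>h. n' {h, opp G' h}"
  have \<sigma>: "s (Inl v) = Inl (\<sigma> v)" "\<sigma> v \<in> verts G'" if "v \<in> verts G" for v
    using isl[of "Inl v"] i(5)[of "Inl v"] that by (auto simp: \<sigma>_def)
  have bisl: "isl (base ?S' (p d)) \<longleftrightarrow> isl (base ?S d)" "isl (base ?S' (opp ?S' (p d))) \<longleftrightarrow> isl (base ?S (opp ?S d))"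
    if "d \<in> darts ?S" for d
  proof -
    note d = finite_graphD(3,4)[OF fS that]
    show "isl (base ?S' (p d)) \<longleftrightarrow> isl (base ?S d)" "isl (base ?S' (opp ?S' (p d))) \<longleftrightarrow> isl (base ?S (opp ?S d))"
      using isl[OF d(1)] isl[OF finite_graphD(3)[OF fS d(2)]] i(3,4)[OF that] i(3)[OF d(2)] by simp_all
  qed
  have \<pi>0: "p (h, 0) = (\<pi> h, 0)" "\<pi> h \<in> darts G'" if "h \<in> darts G" for h
    using bisl(1)[of "(h, 0)"] i(6)[of "(h, 0)"] that
    by (cases "p (h, 0)"; auto simp: \<pi>_def split: if_splits)+
  \<comment> \<open>At the next vertex there are two darts, the reverse of the current one and its
    continuation. Reverses go to reverses, so by injectivity the continuation goes to the
    continuation.\<close>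
  have walk: "p (h, i) = (\<pi> h, i) \<and> i \<le> ?n' (\<pi> h)" if "h \<in> darts G" "i \<le> ?n h" for h i
    using that(2)
  proof (induction i)
    case 0
    then show ?case using \<pi>0 that by simp
  next
    case (Suc i)
    let ?d = "(h, i)" and ?e = "(h, Suc i)" and ?k = "\<pi> h"
    have d: "?d \<in> darts ?S" "?e \<in> darts ?S" "opp ?S ?d \<in> darts ?S" using Suc(2) that fG by (auto simp: insert_commute)
    have IH: "p ?d = (?k, i)" "i \<le> ?n' ?k" using Suc by auto
    have k: "?k \<in> darts G'" using \<pi>0 that by simp
    have odd: "base ?S (opp ?S ?d) = base ?S ?e" "opp ?S ?d \<noteq> ?e"
    proof -
      have D: "{d \<in> darts ?S. base ?S d = Inr (subdiv_vertex G n h (Suc i))} =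
          {(h, Suc i), (opp G h, n {h, opp G h} - i)}"
        using subdivide_darts_Inr[where n = n and h = h and i = "Suc i", OF G(1) that(1) _ Suc(2)] by simp
      have "(h, Suc i) \<in> {d \<in> darts ?S. base ?S d = Inr (subdiv_vertex G n h (Suc i))}"
        "(opp G h, n {h, opp G h} - i) \<in> {d \<in> darts ?S. base ?S d = Inr (subdiv_vertex G n h (Suc i))}"
        unfolding D by auto
      then show "base ?S (opp ?S ?d) = base ?S ?e"
        using subdivide_simps(4)[of G n h i] by (simp del: subdivide_simps)
      show "opp ?S ?d \<noteq> ?e" using fG(5)[OF that(1)] by simp
    qed
    have "\<not> isl (base ?S (opp ?S ?d))" using odd(1) by simp
    then have "\<not> isl (base ?S' (opp ?S' (?k, i)))" using bisl(2)[OF d(1)] IH by simp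
    then have lt: "Suc i \<le> ?n' ?k" by (auto split: if_splits)
    have e': "p ?e \<in> darts ?S'" "p ?e \<noteq> opp ?S' (?k, i)"
      using i(6)[OF d(2)] i(4)[OF d(1)] IH(1) odd(2) d bij_betw_imp_inj_on[OF i(2)]
      by (auto dest: inj_onD simp del: subdivide_simps)
    have D: "{d \<in> darts ?S'. base ?S' d = Inr (subdiv_vertex G' n' ?k (Suc i))} =
        {(?k, Suc i), (opp G' ?k, ?n' ?k - i)}"
      using subdivide_darts_Inr[where n = n' and h = ?k and i = "Suc i", OF G(2) k _ lt] by simp
    have "base ?S' (p ?e) = s (base ?S ?e)" using i(3)[OF d(2)] .
    also have "\<dots> = base ?S' (p (opp ?S ?d))" using i(3)[OF d(3)] odd(1) by simp
    also have "\<dots> = base ?S' (opp ?S' (?k, i))" using i(4)[OF d(1)] IH(1) by simp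
    also have "\<dots> = Inr (subdiv_vertex G' n' ?k (Suc i))"
    proof -
      have "opp ?S' (?k, i) \<in> {d \<in> darts ?S'. base ?S' d = Inr (subdiv_vertex G' n' ?k (Suc i))}"
        unfolding D by simp
      then show ?thesis by (simp del: subdivide_simps)
    qed
    finally have "p ?e \<in> {(?k, Suc i), (opp G' ?k, ?n' ?k - i)}" using e'(1) D by blast
    then show ?case using e'(2) lt by auto
  qed
  \<comment> \<open>The path ends where the far end of its dart is old, and \<open>p\<close>
    respects this, so both paths end at the same position.\<close>
  have len: "?n h = ?n' (\<pi> h)" and oppi: "opp G' (\<pi> h) = \<pi> (opp G h)" if h: "h \<in> darts G" for h
  proof -
    have d: "(h, ?n h) \<in> darts ?S" using h by simp
    have "isl (base ?S' (opp ?S' (p (h, ?n h))))" using bisl(2)[OF d] by simp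
    then have "?n' (\<pi> h) \<le> ?n h" using walk[OF h, of "?n h"] by (auto split: if_splits)
    then show *: "?n h = ?n' (\<pi> h)" using walk[OF h, of "?n h"] by simp
    show "opp G' (\<pi> h) = \<pi> (opp G h)"
      using i(4)[OF d] walk[OF h, of "?n h"] \<pi>0[of "opp G h"] fG h * by simp
  qed
  have bas: "base G' (\<pi> h) = \<sigma> (base G h)" if "h \<in> darts G" for h
    using i(3)[of "(h, 0)"] \<pi>0[OF that] \<sigma>[of "base G h"] that fG by simp
  have "bij_betw \<sigma> (verts G) (verts G')"
  proof (rule bij_betw_imageI)
    have "inj_on s (verts ?S)" using i(1) by (rule bij_betw_imp_inj_on)
    then show "inj_on \<sigma> (verts G)"
      using \<sigma> by (intro inj_onI) (metis (no_types, lifting) UnCI image_eqI inj_onD subdivide_simps(1) sum.inject(1))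
    have "w \<in> \<sigma> ` verts G" if "w \<in> verts G'" for w
    proof -
      have "Inl w \<in> s ` verts ?S" using that bij_betw_imp_surj_on[OF i(1)] by auto
      then obtain q where q: "q \<in> verts ?S" "s q = Inl w" by (auto simp del: subdivide_simps)
      then have "isl q" using isl[of q] by simp
      then show ?thesis using q \<sigma> by (cases q) auto
    qed
    then show "\<sigma> ` verts G = verts G'" using \<sigma>(2) by auto
  qed
  moreover have "bij_betw \<pi> (darts G) (darts G')"
  proof (rule bij_betw_imageI)
    have "inj_on p (darts ?S)" using i(2) by (rule bij_betw_imp_inj_on)
    show "inj_on \<pi> (darts G)"
    proof (rule inj_onI)
      fix x y assume "x \<in> darts G" "y \<in> darts G" "\<pi> x = \<pi> y"
      then show "x = y" using \<pi>0 inj_onD[OF \<open>inj_on p (darts ?S)\<close>, of "(x, 0)" "(y, 0)"] by simp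
    qed
    have "k \<in> \<pi> ` darts G" if "k \<in> darts G'" for k
    proof -
      have "(k, 0) \<in> p ` darts ?S" using that bij_betw_imp_surj_on[OF i(2)] by auto
      then obtain h j where "h \<in> darts G" "j \<le> ?n h" "p (h, j) = (k, 0)" by auto
      then show ?thesis using walk[of h j] by auto
    qed
    then show "\<pi> ` darts G = darts G'" using \<pi>0(2) by auto
  qed
  ultimately have "(\<sigma>, \<pi>) \<in> graph_isos G G'"
    using bas oppi by (simp add: graph_isos_def)
  with len \<sigma>(1) walk show thesis using that by blast
qed

text \<open>An isomorphism from \<open>G\<close> to \<open>G'\<close> lifts to the subdivisions for
  exactly one tuple, the pullback of \<open>n'\<close>. The sum over \<open>A\<close> thus
  partitions \<open>isos G G'\<close>.\<close>

lemma sum_card_isos_subdivide: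
  assumes G: "finite_graph G" "finite_graph G'" "min_degree 3 G" "min_degree 3 G'"
    and A: "finite A" "A \<subseteq> edges G \<rightarrow>\<^sub>E UNIV"
    and pull: "\<And>\<theta>. \<theta> \<in> isos G G' \<Longrightarrow> (\<lambda>e\<in>edges G. n' (snd \<theta> ` e)) \<in> A"
  shows "(\<Sum>n\<in>A. card (isos (subdivide G n) (subdivide G' n'))) = card (isos G G')"
proof -
  note fG = finite_graphD[OF G(1)]
  let ?I = "\<lambda>n. {\<theta> \<in> isos G G'. (\<lambda>e\<in>edges G. n' (snd \<theta> ` e)) = n}"
  have len: "(\<lambda>e\<in>edges G. n' (\<pi> ` e)) = n \<longleftrightarrow>
      (\<forall>h\<in>darts G. n {h, opp G h} = n' {\<pi> h, opp G' (\<pi> h)})"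
    if "n \<in> A" "(\<sigma>, \<pi>) \<in> graph_isos G G'" for n \<sigma> \<pi>
  proof
    assume "(\<lambda>e\<in>edges G. n' (\<pi> ` e)) = n"
    then have "n {h, opp G h} = n' (\<pi> ` {h, opp G h})" if "h \<in> darts G" for h
      using that by (auto simp: edges_def)
    then show "\<forall>h\<in>darts G. n {h, opp G h} = n' {\<pi> h, opp G' (\<pi> h)}"
      using graph_isosD(4)[OF that(2)] by simp
  next
    assume "\<forall>h\<in>darts G. n {h, opp G h} = n' {\<pi> h, opp G' (\<pi> h)}"
    moreover have "n \<in> extensional (edges G)"
      using A(2) that(1) by (auto simp: PiE_def)
    ultimately show "(\<lambda>e\<in>edges G. n' (\<pi> ` e)) = n"
      using graph_isosD(4)[OF that(2)]
      by (intro extensionalityI[where A = "edges G"]) (auto simp: edges_def)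
  qed
  have "card (isos (subdivide G n) (subdivide G' n')) = card (?I n)" if n: "n \<in> A" for n
  proof (rule bij_betw_same_card[symmetric], rule bij_betw_imageI)
    let ?S = "subdivide G n" and ?S' = "subdivide G' n'"
    let ?f = "\<lambda>(\<sigma>, \<pi>). (restrict (map_sum \<sigma> ((`) (map_prod \<pi> (id :: nat \<Rightarrow> nat)))) (verts ?S),
      restrict (map_prod \<pi> id) (darts ?S))"
    show "inj_on ?f (?I n)"
    proof (rule inj_onI)
      fix x y assume xy: "x \<in> ?I n" "y \<in> ?I n" "?f x = ?f y"
      obtain \<sigma> \<pi> \<sigma>' \<pi>' where [simp]: "x = (\<sigma>, \<pi>)" "y = (\<sigma>', \<pi>')" by (cases x, cases y)
      have m: "(\<sigma>, \<pi>) \<in> isos G G'" "(\<sigma>', \<pi>') \<in> isos G G'"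
        using xy by auto
      have e: "restrict (map_sum \<sigma> ((`) (map_prod \<pi> id))) (verts ?S) =
          restrict (map_sum \<sigma>' ((`) (map_prod \<pi>' id))) (verts ?S)"
          "restrict (map_prod \<pi> id) (darts ?S) = restrict (map_prod \<pi>' id) (darts ?S)"
        using xy(3) by (simp_all del: subdivide_simps)
      have "\<sigma> v = \<sigma>' v" if "v \<in> verts G" for v
        using fun_cong[OF e(1), of "Inl v"] that by simp
      moreover have "\<pi> h = \<pi>' h" if "h \<in> darts G" for h
        using fun_cong[OF e(2), of "(h, 0)"] that by simp
      ultimately show "x = y"
        using m by (auto simp: marked_isos_iff intro: extensionalityI)
    qed
    show "?f ` ?I n = isos ?S ?S'"
    proof (intro equalityI subsetI)
      fix q assume "q \<in> ?f ` ?I n"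
      then obtain \<sigma> \<pi> where q: "q = ?f (\<sigma>, \<pi>)" "(\<sigma>, \<pi>) \<in> graph_isos G G'"
        "(\<lambda>e\<in>edges G. n' (\<pi> ` e)) = n"
        by (auto simp: marked_isos_iff)
      then have l: "\<forall>h\<in>darts G. n {h, opp G h} = n' {\<pi> h, opp G' (\<pi> h)}" using len[OF n] by blast
      show "q \<in> isos ?S ?S'"
        unfolding q(1) prod.case
        by (intro restrict_marked_isos finite_graph_subdivide subdivide_graph_isos G q(2)) (use l in auto)
    next
      fix q assume q: "q \<in> isos ?S ?S'"
      obtain s p where sp: "q = (s, p)" "(s, p) \<in> graph_isos ?S ?S'"
        "s \<in> extensional (verts ?S)" "p \<in> extensional (darts ?S)"
        using q by (cases q) (auto simp: marked_isos_iff)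
      obtain \<sigma> \<pi> where \<sigma>\<pi>: "(\<sigma>, \<pi>) \<in> graph_isos G G'"
        "\<And>h. h \<in> darts G \<Longrightarrow> n {h, opp G h} = n' {\<pi> h, opp G' (\<pi> h)}"
        "\<And>v. v \<in> verts G \<Longrightarrow> s (Inl v) = Inl (\<sigma> v)"
        "\<And>h i. h \<in> darts G \<Longrightarrow> i \<le> n {h, opp G h} \<Longrightarrow> p (h, i) = (\<pi> h, i)"
        using isos_subdivide_split[OF G sp(2)] by metis
      let ?\<sigma> = "restrict \<sigma> (verts G)" and ?\<pi> = "restrict \<pi> (darts G)"
      have m: "(?\<sigma>, ?\<pi>) \<in> isos G G'"
        using restrict_marked_isos[OF G(1) \<sigma>\<pi>(1), of "{}" "{}"] by simp
      then have gi: "(?\<sigma>, ?\<pi>) \<in> graph_isos G G'" by (simp add: marked_isos_iff)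
      have l: "\<forall>h\<in>darts G. n {h, opp G h} = n' {?\<pi> h, opp G' (?\<pi> h)}" using \<sigma>\<pi>(2) by simp
      have "(?\<sigma>, ?\<pi>) \<in> ?I n"
        using m len[OF n gi] l by simp
      moreover have "?f (?\<sigma>, ?\<pi>) = q"
      proof -
        have p: "restrict (map_prod ?\<pi> id) (darts ?S) = p"
          using \<sigma>\<pi>(4) by (intro extensionalityI[OF _ sp(4)]) auto
        have "map_sum ?\<sigma> ((`) (map_prod ?\<pi> id)) x = s x" if x: "x \<in> verts ?S" for x
        proof (cases x)
          case (Inl v)
          then show ?thesis using x \<sigma>\<pi>(3) by auto
        next
          case (Inr a)
          then obtain h i where h: "a = subdiv_vertex G n h i" "h \<in> darts G" "1 \<le> i" "i \<le> n {h, opp G h}"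
            using x by auto
          have d: "(h, i) \<in> darts ?S" using h by simp
          \<comment> \<open>A new vertex is the base of a dart, so its image is determined by that
            of the dart.\<close>
          have x': "x = base ?S (h, i)" using Inr h by simp
          then have "s x = base ?S' (map_prod ?\<pi> id (h, i))"
            using graph_isosD(3)[OF sp(2) d] \<sigma>\<pi>(4)[OF h(2,4)] h(2) by simp
          also have "\<dots> = map_sum ?\<sigma> ((`) (map_prod ?\<pi> id)) (base ?S (h, i))"
            using graph_isosD(3)[OF subdivide_graph_isos[where n = n and n' = n', OF G(1) gi l[rule_format]] d] .
          finally show ?thesis unfolding x' by simp
        qed
        then have "restrict (map_sum ?\<sigma> ((`) (map_prod ?\<pi> id))) (verts ?S) = s"
          by (intro extensionalityI[OF _ sp(3)]) (auto simp del: subdivide_simps)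
        with p show ?thesis by (simp add: sp(1) del: subdivide_simps)
      qed
      ultimately show "q \<in> ?f ` ?I n" by force
    qed
  qed
  then have "(\<Sum>n\<in>A. card (isos (subdivide G n) (subdivide G' n'))) = (\<Sum>n\<in>A. \<Sum>\<theta>\<in>?I n. 1)"
    by simp
  also have "\<dots> = (\<Sum>\<theta>\<in>isos G G'. 1)"
    using pull by (intro sum.group finite_marked_isos G A) auto
  finally show ?thesis by simp
qed

section \<open>Existence of the decomposition\<close>

lemma sum_vertex_degree:
  assumes "finite_graph G"
  shows "(\<Sum>v\<in>verts G. vertex_degree G v) = card (darts G)"
proof -
  note fG = finite_graphD[OF assms]
  have "(\<Sum>v\<in>verts G. \<Sum>h\<in>{h \<in> darts G. base G h = v}. 1) = (\<Sum>h\<in>darts G. 1 :: nat)"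
    using fG by (intro sum.group) auto
  then show ?thesis by (simp add: vertex_degree_def)
qed

section \<open>Suppressing vertices of degree 2\<close>

context
  fixes H :: "('v, 'h) graph"
  assumes fin: "finite_graph H" and md: "min_degree 2 H"
begin

text \<open>By \<open>md\<close> these are the vertices of degree at least 3.\<close>

definition branch_verts where "branch_verts = {v \<in> verts H. vertex_degree H v \<noteq> 2}"

text \<open>Continues a walk through a vertex of degree 2; meaningless at branch vertices.\<close>

definition next_dart where
  "next_dart d = (THE e. e \<in> darts H \<and> base H e = base H (opp H d) \<and> e \<noteq> opp H d)"

text \<open>The index of the last dart of the path starting with \<open>h\<close>, hence the number
  of interior vertices of that path. A \<open>LEAST\<close> without witness is excluded by
  \<open>path_stop\<close> when \<open>h\<close> starts at a branch vertex.\<close>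

definition path_len where
  "path_len h = (LEAST i. base H (opp H ((next_dart ^^ i) h)) \<in> branch_verts)"

text \<open>Each path between branch vertices survives through its first dart; the reverse of that
  dart is the first dart of the path run backwards.\<close>

definition smooth where
  "smooth = \<lparr>verts = branch_verts, darts = {h \<in> darts H. base H h \<in> branch_verts}, base = base H,
     opp = \<lambda>h. opp H ((next_dart ^^ path_len h) h)\<rparr>"

text \<open>Either end of a path gives the same length, so the choice of a dart of the edge is
  harmless.\<close>

definition smooth_len where "smooth_len e = path_len (SOME h. h \<in> e)"

lemmas fH = finite_graphD[OF fin]

lemma deg2:
  assumes "d \<in> darts H" "base H d \<notin> branch_verts"
  shows "\<exists>e. e \<noteq> d \<and> {k \<in> darts H. base H k = base H d} = {d, e}"
proof -
  have "card {k \<in> darts H. base H k = base H d} = 2"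
    using assms fH(3) by (auto simp: branch_verts_def vertex_degree_def)
  then obtain x y where xy: "x \<noteq> y" "{k \<in> darts H. base H k = base H d} = {x, y}"
    unfolding card_2_iff by blast
  moreover have "d \<in> {x, y}" unfolding xy(2)[symmetric] using assms(1) by simp
  ultimately show ?thesis by (metis insertE insert_commute singletonD)
qed

lemma next_dart:
  assumes "d \<in> darts H" "base H (opp H d) \<notin> branch_verts"
  shows "next_dart d \<in> darts H" "base H (next_dart d) = base H (opp H d)" "next_dart d \<noteq> opp H d"
    and "\<And>e. e \<in> darts H \<Longrightarrow> base H e = base H (opp H d) \<Longrightarrow> e \<noteq> opp H d \<Longrightarrow> e = next_dart d"
proof -
  obtain e where e: "e \<noteq> opp H d" "{k \<in> darts H. base H k = base H (opp H d)} = {opp H d, e}"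
    using deg2[OF fH(4)[OF assms(1)] assms(2)] by blast
  have "\<exists>!e. e \<in> darts H \<and> base H e = base H (opp H d) \<and> e \<noteq> opp H d"
    using e by (intro ex1I[of _ e]) blast+
  note t = theI'[OF this, folded next_dart_def] and u = the1_equality[OF this, folded next_dart_def]
  show "next_dart d \<in> darts H" "base H (next_dart d) = base H (opp H d)" "next_dart d \<noteq> opp H d"
    using t by blast+
  show "\<And>e. e \<in> darts H \<Longrightarrow> base H e = base H (opp H d) \<Longrightarrow> e \<noteq> opp H d \<Longrightarrow> e = next_dart d"
    using u by metis
qed

text \<open>Steps of a walk can be undone, since the two darts at a vertex of degree 2 determine
  each other.\<close>

lemma next_rev:
  assumes "d \<in> darts H" "base H (opp H d) \<notin> branch_verts"
  shows "next_dart (opp H (next_dart d)) = opp H d"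
proof -
  note n = next_dart[OF assms]
  have d': "opp H (next_dart d) \<in> darts H" using fH(4)[OF n(1)] .
  have oo: "opp H (opp H (next_dart d)) = next_dart d" using fH(6)[OF n(1)] .
  show ?thesis
    using assms n(2) n(3)[symmetric] fH(4)[OF assms(1)]
    by (intro next_dart(4)[OF d', symmetric]) (simp_all add: oo)
qed

lemma next_inj:
  assumes "d \<in> darts H" "base H (opp H d) \<notin> branch_verts"
    "d' \<in> darts H" "base H (opp H d') \<notin> branch_verts" "next_dart d = next_dart d'"
  shows "d = d'"
proof -
  have "opp H d = next_dart (opp H (next_dart d))"
    by (rule next_rev[OF assms(1,2), symmetric])
  also have "\<dots> = opp H d'"
    unfolding assms(5) by (rule next_rev[OF assms(3,4)])
  finally have *: "opp H d = opp H d'" .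
  have "d = opp H (opp H d)" by (rule fH(6)[OF assms(1), symmetric])
  also have "\<dots> = d'" unfolding * by (rule fH(6)[OF assms(3)])
  finally show ?thesis .
qed

abbreviation dart_path where "dart_path h i \<equiv> (next_dart ^^ i) h"

lemma path_darts:
  assumes "h \<in> darts H" "\<And>j. j < i \<Longrightarrow> base H (opp H (dart_path h j)) \<notin> branch_verts"
  shows "dart_path h i \<in> darts H" "0 < i \<Longrightarrow> base H (dart_path h i) = base H (opp H (dart_path h (i - 1)))"
proof -
  show p: "dart_path h i \<in> darts H"
    using assms(2) by (induction i) (use assms(1) next_dart(1) in auto)
  have "dart_path h j \<in> darts H" if "j \<le> i" for j
    using that assms(2) by (induction j) (use assms(1) next_dart(1) in auto)
  then show "base H (dart_path h i) = base H (opp H (dart_path h (i - 1)))" if "0 < i"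
    using that next_dart(2)[of "dart_path h (i - 1)"] assms(2)[of "i - 1"] by (cases i) auto
qed

text \<open>Both walks are run backwards, a step being injective off branch vertices. When one
  reaches its start, a branch vertex, so has the other, since every later dart of a walk starts at a
  vertex of degree 2.\<close>

lemma path_inj:
  assumes "h \<in> darts H" "base H h \<in> branch_verts" "h' \<in> darts H" "base H h' \<in> branch_verts"
    and "\<And>k. k < i \<Longrightarrow> base H (opp H (dart_path h k)) \<notin> branch_verts"
    and "\<And>k. k < j \<Longrightarrow> base H (opp H (dart_path h' k)) \<notin> branch_verts"
    and "dart_path h i = dart_path h' j"
  shows "h = h' \<and> i = j"
  using assms(5-7)
proof (induction i arbitrary: j)
  case 0
  then show ?case
    using path_darts(2)[OF assms(3), of j] assms(2) 0(2)[of "j - 1"] by (cases j) auto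
next
  case (Suc i)
  show ?case
  proof (cases j)
    case 0
    have "base H (dart_path h (Suc i)) = base H (opp H (dart_path h i))"
      using path_darts(2)[OF assms(1) Suc(2), of "Suc i"] by simp
    then show ?thesis
      using assms(4) Suc(2)[of i] Suc(4) 0 by simp
  next
    case (Suc j')
    have "dart_path h i = dart_path h' j'"
    proof (rule next_inj)
      show "dart_path h i \<in> darts H"
        by (rule path_darts(1)[OF assms(1)], rule Suc.prems(1)) simp
      show "dart_path h' j' \<in> darts H"
        by (rule path_darts(1)[OF assms(3)], rule Suc.prems(2)) (simp add: Suc)
      show "base H (opp H (dart_path h i)) \<notin> branch_verts"
        by (rule Suc.prems(1)) simp
      show "base H (opp H (dart_path h' j')) \<notin> branch_verts"
        by (rule Suc.prems(2)) (simp add: Suc)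
      show "next_dart (dart_path h i) = next_dart (dart_path h' j')"
        using Suc.prems(3) by (simp add: Suc)
    qed
    then have "h = h' \<and> i = j'"
      using Suc.prems(1,2) Suc by (intro Suc.IH) simp_all
    then show ?thesis using Suc by simp
  qed
qed

text \<open>A walk that never met a branch vertex again would be injective with values in the finite
  set of darts.\<close>

lemma path_stop:
  assumes "h \<in> darts H" "base H h \<in> branch_verts"
  shows "base H (opp H (dart_path h (path_len h))) \<in> branch_verts"
    and "i < path_len h \<Longrightarrow> base H (opp H (dart_path h i)) \<notin> branch_verts"
proof -
  have "\<exists>i. base H (opp H (dart_path h i)) \<in> branch_verts"
  proof (rule ccontr)
    assume "\<nexists>i. base H (opp H (dart_path h i)) \<in> branch_verts"
    then have *: "base H (opp H (dart_path h i)) \<notin> branch_verts" for i by blast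
    have "inj (dart_path h)"
      using path_inj[OF assms assms * *] by (auto intro: injI)
    moreover have "range (dart_path h) \<subseteq> darts H"
      using path_darts(1)[OF assms(1) *] by auto
    ultimately show False
      using fH(2) finite_subset infinite_UNIV_nat finite_imageD by metis
  qed
  then show "base H (opp H (dart_path h (path_len h))) \<in> branch_verts"
    unfolding path_len_def by (rule LeastI_ex)
  show "i < path_len h \<Longrightarrow> base H (opp H (dart_path h i)) \<notin> branch_verts"
    unfolding path_len_def by (rule not_less_Least)
qed

lemma path_facts:
  assumes h: "h \<in> darts H" "base H h \<in> branch_verts" and i: "i \<le> path_len h"
  shows "dart_path h i \<in> darts H" "0 < i \<Longrightarrow> base H (dart_path h i) = base H (opp H (dart_path h (i - 1)))"
    "0 < i \<Longrightarrow> base H (dart_path h i) \<notin> branch_verts"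
proof -
  note p = path_darts[OF h(1), of i]
  show "dart_path h i \<in> darts H" using i by (intro p(1) path_stop(2)[OF h]) auto
  show *: "base H (dart_path h i) = base H (opp H (dart_path h (i - 1)))" if "0 < i"
    using i by (intro p(2) path_stop(2)[OF h] that) auto
  show "0 < i \<Longrightarrow> base H (dart_path h i) \<notin> branch_verts"
    using * path_stop(2)[OF h, of "i - 1"] i by auto
qed

lemma path_inj':
  assumes "h \<in> darts H" "base H h \<in> branch_verts" "h' \<in> darts H" "base H h' \<in> branch_verts"
    and "i \<le> path_len h" "j \<le> path_len h'" "dart_path h i = dart_path h' j"
  shows "h = h' \<and> i = j"
  by (rule path_inj) (use assms path_stop(2) in auto)

text \<open>Reading a path backwards is again a walk of the same length, and reading it backwards
  twice returns \<open>h\<close>. This makes \<open>opp smooth\<close> an involution without fixed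
  points.\<close>

lemma opp_smooth:
  assumes h: "h \<in> darts H" "base H h \<in> branch_verts"
  defines "k \<equiv> opp H (dart_path h (path_len h))"
  shows "k \<in> darts H" "base H k \<in> branch_verts" "path_len k = path_len h"
    "i \<le> path_len h \<Longrightarrow> dart_path k i = opp H (dart_path h (path_len h - i))"
    "opp H (dart_path k (path_len k)) = h" "k \<noteq> h"
proof -
  show k: "k \<in> darts H" "base H k \<in> branch_verts"
    using fH(4) path_facts(1)[OF h] path_stop(1)[OF h] by (auto simp: k_def)
  show rev: "dart_path k i = opp H (dart_path h (path_len h - i))" if "i \<le> path_len h" for i
    using that
  proof (induction i)
    case (Suc i)
    let ?d = "dart_path h (path_len h - Suc i)"
    have "dart_path k (Suc i) = next_dart (opp H (dart_path h (path_len h - i)))"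
      using Suc by simp
    also have "dart_path h (path_len h - i) = next_dart ?d"
      using Suc(2) by (metis Suc_diff_Suc Suc_le_lessD comp_apply funpow.simps(2))
    also have "next_dart (opp H (next_dart ?d)) = opp H ?d"
      using path_facts(1)[OF h] path_stop(2)[OF h] Suc(2) by (intro next_rev) auto
    finally show ?case .
  qed (simp add: k_def)
  show len: "path_len k = path_len h"
    unfolding path_len_def[of k]
  proof (rule Least_equality)
    show "base H (opp H (dart_path k (path_len h))) \<in> branch_verts"
      using rev[of "path_len h"] h fH(6) by simp
    fix i assume i: "base H (opp H (dart_path k i)) \<in> branch_verts"
    show "path_len h \<le> i"
    proof (rule ccontr)
      assume "\<not> path_len h \<le> i"
      then have "opp H (dart_path k i) = dart_path h (path_len h - i)"
        using rev[of i] fH(6)[OF path_facts(1)[OF h]] by simp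
      then show False
        using i path_facts(3)[OF h, of "path_len h - i"] \<open>\<not> path_len h \<le> i\<close> by simp
    qed
  qed
  show "opp H (dart_path k (path_len k)) = h"
    unfolding len using rev[of "path_len h"] h fH(6) by simp
  show "k \<noteq> h"
  proof
    assume kh: "k = h"
    \<comment> \<open>If \<open>k\<close> were \<open>h\<close>, the path would be its own reverse.
      In its middle there would be a dart equal to its own reverse, for even length, or a step that
      turns back, for odd length.\<close>
    let ?i = "path_len h div 2"
    have eq: "dart_path h ?i = opp H (dart_path h (path_len h - ?i))"
      using rev[of ?i] kh by simp
    show False
    proof (cases "even (path_len h)")
      case True
      then have "path_len h - ?i = ?i" by auto
      then show False
        using eq fH(5)[OF path_facts(1)[OF h, of ?i]] by simp
    next
      case False
      then have "path_len h - ?i = Suc ?i" "?i < path_len h" by presburger+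
      then show False
        using eq next_dart(3)[of "dart_path h ?i"] path_facts(1)[OF h, of ?i] path_stop(2)[OF h, of ?i]
          fH(6)[of "dart_path h (Suc ?i)"] path_facts(1)[OF h, of "Suc ?i"] by auto
    qed
  qed
qed

lemma smooth_simps [simp]:
  "verts smooth = branch_verts" "darts smooth = {h \<in> darts H. base H h \<in> branch_verts}"
  "base smooth = base H" "opp smooth h = opp H (dart_path h (path_len h))"
  by (simp_all add: smooth_def)

lemma finite_graph_smooth: "finite_graph smooth"
  using fH opp_smooth(1,2,5,6) unfolding finite_graph_def
  by (auto simp: branch_verts_def)

lemma min_degree_smooth: "min_degree 3 smooth"
  unfolding min_degree_def
proof
  fix v assume "v \<in> verts smooth"
  then have v: "v \<in> branch_verts" by simp
  then have "{h \<in> darts smooth. base smooth h = v} = {h \<in> darts H. base H h = v}" by auto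
  then have "vertex_degree smooth v = vertex_degree H v" by (simp add: vertex_degree_def)
  with v md show "3 \<le> vertex_degree smooth v" by (fastforce simp: branch_verts_def min_degree_def)
qed

lemma smooth_len [simp]:
  assumes "h \<in> darts H" "base H h \<in> branch_verts"
  shows "smooth_len {h, opp H (dart_path h (path_len h))} = path_len h"
proof -
  have "(SOME x. x \<in> {h, opp H (dart_path h (path_len h))}) \<in> {h, opp H (dart_path h (path_len h))}"
    by (rule someI[of _ h]) simp
  then show ?thesis
    using opp_smooth(3)[OF assms] unfolding smooth_len_def by auto
qed

text \<open>The dart \<open>(h, i)\<close> is sent to the \<open>i\<close>-th dart of the path
  starting with \<open>h\<close>, and each vertex goes where the darts based at it lead.\<close>

lemma subdivide_smooth_iso:
  assumes c: "connected_graph H" and br: "branch_verts \<noteq> {}"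
  shows "graph_isos (subdivide smooth smooth_len) H \<noteq> {}"
proof -
  let ?S = "subdivide smooth smooth_len"
  let ?P = "\<lambda>(h, i). dart_path h i"
  let ?D = "{(h, i). h \<in> darts H \<and> base H h \<in> branch_verts \<and> i \<le> path_len h}"
  \<comment> \<open>The choice picks one of the two descriptions of a new vertex; by
    \<open>sv\<close> both lead to the same vertex of \<open>H\<close>.\<close>
  let ?F = "\<lambda>x. case x of Inl v \<Rightarrow> v | Inr s \<Rightarrow> base H (?P (SOME x. x \<in> s))"
  have D: "darts ?S = ?D" by auto
  have sv: "?F (Inr (subdiv_vertex smooth smooth_len h i)) = base H (dart_path h i)"
    if h: "h \<in> darts H" "base H h \<in> branch_verts" "1 \<le> i" "i \<le> path_len h" for h i
  proof -
    let ?k = "opp H (dart_path h (path_len h))"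
    let ?s = "subdiv_vertex smooth smooth_len h i"
    have s: "?s = {(h, i), (?k, path_len h + 1 - i)}" using h by (simp add: subdiv_vertex_def)
    have "dart_path ?k (path_len h + 1 - i) = opp H (dart_path h (i - 1))"
      using opp_smooth(4)[OF h(1,2), of "path_len h + 1 - i"] h(3,4) by simp
    then have "base H (dart_path ?k (path_len h + 1 - i)) = base H (dart_path h i)"
      using path_facts(2)[OF h(1,2,4)] h(3) by simp
    moreover have "(SOME x. x \<in> ?s) \<in> ?s" by (rule someI[of _ "(h, i)"]) (simp add: s)
    ultimately show ?thesis unfolding s by auto
  qed
  \<comment> \<open>The vertices met by paths that start at branch vertices. This set is closed
    under darts and nonempty, so by connectedness it is everything.\<close>
  let ?A = "branch_verts \<union> (\<lambda>x. base H (?P x)) ` ?D"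
  have dart: "d \<in> ?P ` ?D" if d: "d \<in> darts H" "base H d \<in> ?A" for d
  proof (cases "base H d \<in> branch_verts")
    case True
    then show ?thesis using d(1) by (intro image_eqI[where x = "(d, 0)"]) auto
  next
    case False
    then obtain h i where h: "h \<in> darts H" "base H h \<in> branch_verts" "i \<le> path_len h" "base H d = base H (dart_path h i)"
      using d(2) by auto
    then have i: "0 < i" using False by (cases i) auto
    let ?e = "dart_path h (i - 1)"
    have e: "?e \<in> darts H" "base H (opp H ?e) \<notin> branch_verts" "next_dart ?e = dart_path h i"
      using path_facts(1)[OF h(1,2), of "i - 1"] path_stop(2)[OF h(1,2), of "i - 1"] h(3) i
      by (cases i; simp)+
    show ?thesis
    proof (cases "d = opp H ?e")
      case True
      let ?k = "opp H (dart_path h (path_len h))"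
      have "dart_path ?k (path_len h + 1 - i) = d"
        using opp_smooth(4)[OF h(1,2), of "path_len h + 1 - i"] h(3) i True by simp
      then show ?thesis
        using opp_smooth(1-3)[OF h(1,2)] i h(3)
        by (intro image_eqI[where x = "(?k, path_len h + 1 - i)"]) auto
    next
      case False
      then have "d = dart_path h i"
        using next_dart(4)[OF e(1,2) d(1)] h(4) path_facts(2)[OF h(1-3)] i e(3) by simp
      then show ?thesis using h by (intro image_eqI[where x = "(h, i)"]) auto
    qed
  qed
  obtain v0 where v0: "v0 \<in> branch_verts" "v0 \<in> verts H" using br by (auto simp: branch_verts_def)
  have A: "v \<in> ?A" if "v \<in> verts H" for v
  proof (rule connected_graph_induct[OF fin c v0(2) _ _ that, where P = "\<lambda>v. v \<in> ?A"])
    fix d assume d: "d \<in> darts H" "base H d \<in> ?A"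
    obtain h i where h: "h \<in> darts H" "base H h \<in> branch_verts" "i \<le> path_len h" "d = dart_path h i"
      using dart[OF d] by auto
    show "base H (opp H d) \<in> ?A"
    proof (cases "i = path_len h")
      case True
      then show ?thesis using path_stop(1)[OF h(1,2)] h(4) by simp
    next
      case False
      then have "base H (opp H d) = base H (dart_path h (Suc i))"
        using path_facts(2)[OF h(1,2), of "Suc i"] h by simp
      moreover have "(h, Suc i) \<in> ?D" using h False by auto
      ultimately show ?thesis by (intro UnI2 image_eqI[where x = "(h, Suc i)"]) simp_all
    qed
  qed (use v0 in auto)
  have dbij: "bij_betw ?P (darts ?S) (darts H)"
    unfolding D
  proof (rule bij_betw_imageI)
    show "inj_on ?P ?D" using path_inj' by (auto simp: inj_on_def)
    have "d \<in> ?P ` ?D" if "d \<in> darts H" for d using dart[OF that A] fH(3)[OF that] .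
    moreover have "?P x \<in> darts H" if "x \<in> ?D" for x using that path_facts(1) by auto
    ultimately show "?P ` ?D = darts H" by blast
  qed
  have FI: "x \<in> verts ?S \<Longrightarrow> (\<exists>v. x = Inl v \<and> v \<in> branch_verts) \<or>
      (\<exists>h i. x = Inr (subdiv_vertex smooth smooth_len h i) \<and> h \<in> darts H \<and> base H h \<in> branch_verts \<and>
        1 \<le> i \<and> i \<le> path_len h)" for x
    by auto
  \<comment> \<open>At a vertex of degree 2 there are only two darts, so two path positions that
    meet there are equal or reverses of each other.\<close>
  have II: "subdiv_vertex smooth smooth_len h i = subdiv_vertex smooth smooth_len h' j"
    if h: "h \<in> darts H" "base H h \<in> branch_verts" "1 \<le> i" "i \<le> path_len h"
    and h': "h' \<in> darts H" "base H h' \<in> branch_verts" "1 \<le> j" "j \<le> path_len h'"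
    and e: "base H (dart_path h i) = base H (dart_path h' j)" for h i h' j
  proof -
    let ?e = "dart_path h (i - 1)" and ?k = "opp H (dart_path h (path_len h))"
    have ee: "?e \<in> darts H" "base H (opp H ?e) \<notin> branch_verts" "next_dart ?e = dart_path h i"
      using path_facts(1)[OF h(1,2), of "i - 1"] path_stop(2)[OF h(1,2), of "i - 1"] h(3,4)
      by (cases i; simp)+
    have b: "base H (dart_path h i) = base H (opp H ?e)" using path_facts(2)[OF h(1,2,4)] h(3) by simp
    have k: "dart_path ?k (path_len h + 1 - i) = opp H ?e"
      using opp_smooth(4)[OF h(1,2), of "path_len h + 1 - i"] h(3,4) by simp
    have "dart_path h' j = opp H ?e \<or> dart_path h' j = dart_path h i"
      using next_dart(4)[OF ee(1,2) path_facts(1)[OF h'(1,2,4)]] b e ee(3) by auto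
    then have "h' = h \<and> j = i \<or> h' = ?k \<and> j = path_len h + 1 - i"
    proof
      assume "dart_path h' j = opp H ?e"
      then show ?thesis
        using path_inj'[OF h'(1,2) opp_smooth(1,2)[OF h(1,2)] h'(4), of "path_len h + 1 - i"] k
          opp_smooth(3)[OF h(1,2)] h(3) by auto
    next
      assume "dart_path h' j = dart_path h i"
      then show ?thesis using path_inj'[OF h'(1,2) h(1,2) h'(4) h(4)] by auto
    qed
    then show ?thesis
      using subdiv_vertex_eq_iff[OF finite_graph_smooth, of h h' i smooth_len j] h h'
        opp_smooth(1-3)[OF h(1,2)] by auto
  qed
  have vbij: "bij_betw ?F (verts ?S) (verts H)"
  proof (rule bij_betw_imageI)
    show "inj_on ?F (verts ?S)"
    proof (rule inj_onI)
      fix x y assume xy: "x \<in> verts ?S" "y \<in> verts ?S" and e: "?F x = ?F y"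
      show "x = y"
        using FI[OF xy(1)] FI[OF xy(2)]
      proof (elim disjE exE conjE)
        fix v w assume "x = Inl v" "y = Inl w"
        then show "x = y" using e by simp
      next
        fix v h i assume *: "x = Inl v" "v \<in> branch_verts" "y = Inr (subdiv_vertex smooth smooth_len h i)"
          "h \<in> darts H" "base H h \<in> branch_verts" "1 \<le> i" "i \<le> path_len h"
        have "?F y = base H (dart_path h i)" unfolding *(3) by (rule sv[OF *(4-7)])
        then show "x = y" using e * path_facts(3)[OF *(4,5,7)] by simp
      next
        fix v h i assume *: "y = Inl v" "v \<in> branch_verts" "x = Inr (subdiv_vertex smooth smooth_len h i)"
          "h \<in> darts H" "base H h \<in> branch_verts" "1 \<le> i" "i \<le> path_len h"
        have "?F x = base H (dart_path h i)" unfolding *(3) by (rule sv[OF *(4-7)])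
        then show "x = y" using e * path_facts(3)[OF *(4,5,7)] by simp
      next
        fix h i h' j assume *: "x = Inr (subdiv_vertex smooth smooth_len h i)"
          "h \<in> darts H" "base H h \<in> branch_verts" "1 \<le> i" "i \<le> path_len h"
          and **: "y = Inr (subdiv_vertex smooth smooth_len h' j)"
          "h' \<in> darts H" "base H h' \<in> branch_verts" "1 \<le> j" "j \<le> path_len h'"
        have "?F x = base H (dart_path h i)" "?F y = base H (dart_path h' j)"
          unfolding *(1) **(1) by (rule sv[OF *(2-5)], rule sv[OF **(2-5)])
        with e have "base H (dart_path h i) = base H (dart_path h' j)" by argo
        from II[OF *(2-5) **(2-5) this] show "x = y" unfolding *(1) **(1) by simp
      qed
    qed
    show "?F ` verts ?S = verts H"
    proof (intro equalityI subsetI)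
      fix v assume "v \<in> ?F ` verts ?S"
      then obtain x where x: "x \<in> verts ?S" "v = ?F x" by blast
      show "v \<in> verts H"
        using FI[OF x(1)]
      proof (elim disjE exE conjE)
        fix u assume "x = Inl u" "u \<in> branch_verts"
        then show ?thesis using x(2) by (simp add: branch_verts_def)
      next
        fix h i assume *: "x = Inr (subdiv_vertex smooth smooth_len h i)"
          "h \<in> darts H" "base H h \<in> branch_verts" "1 \<le> i" "i \<le> path_len h"
        show ?thesis unfolding x(2) *(1) sv[OF *(2-5)] using path_facts(1)[OF *(2,3,5)] fH(3) by blast
      qed
    next
      fix v assume v: "v \<in> verts H"
      from A[OF v] show "v \<in> ?F ` verts ?S"
      proof
        assume "v \<in> branch_verts"
        then show ?thesis by (intro image_eqI[where x = "Inl v"]) auto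
      next
        assume "v \<in> (\<lambda>x. base H (?P x)) ` ?D"
        then obtain h i where h: "v = base H (dart_path h i)" "h \<in> darts H" "base H h \<in> branch_verts" "i \<le> path_len h"
          by auto
        have "base ?S (h, i) \<in> verts ?S" "?F (base ?S (h, i)) = v"
          using finite_graphD(3)[OF finite_graph_subdivide[OF finite_graph_smooth]] h sv[OF h(2,3) _ h(4)]
          by (force, cases i) auto
        then show ?thesis by (intro image_eqI[where x = "base ?S (h, i)"]) auto
      qed
    qed
  qed
  have "base H (?P d) = ?F (base ?S d) \<and> opp H (?P d) = ?P (opp ?S d)" if dS: "d \<in> darts ?S" for d
  proof -
    obtain h i where d: "d = (h, i)" "h \<in> darts H" "base H h \<in> branch_verts" "i \<le> path_len h"
      using dS by auto
    have "base H (?P d) = ?F (base ?S d)"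
      using sv[OF d(2,3) _ d(4)] d(1) by (cases i) auto
    moreover have "opp H (?P d) = ?P (opp ?S d)"
      using opp_smooth(4)[OF d(2,3), of "path_len h - i"] d by simp
    ultimately show ?thesis ..
  qed
  then have "(?F, ?P) \<in> graph_isos ?S H"
    using vbij dbij unfolding graph_isos_def by blast
  then show ?thesis by blast
qed

end

text \<open>Without branch vertices \<open>H\<close> would have as many edges as vertices, hence
  Betti number 1; the bound 2 excludes these cycles.\<close>

lemma exists_subdivision:
  fixes H :: "('v, 'h) graph"
  assumes H: "finite_graph H" "connected_graph H" "min_degree 2 H" "betti H \<ge> 2"
  obtains G :: "('v, 'h) graph" and n
  where "finite_graph G" "min_degree 3 G" "graph_isos (subdivide G n) H \<noteq> {}"
proof -
  have "branch_verts H \<noteq> {}"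
  proof
    assume b: "branch_verts H = {}"
    have "(\<Sum>v\<in>verts H. vertex_degree H v) = (\<Sum>v\<in>verts H. 2)"
      using b by (intro sum.cong) (auto simp: branch_verts_def[OF H(1,3)])
    then have "card (darts H) = 2 * card (verts H)" using sum_vertex_degree[OF H(1)] by simp
    then show False using betti_iff[OF H(1), of "betti H"] H(4) by simp
  qed
  then show thesis
    using that[OF finite_graph_smooth[OF H(1,3)] min_degree_smooth[OF H(1,3)]
        subdivide_smooth_iso[OF H(1,3) H(2)]] by blast
qed

section \<open>Pruning and regrowing leaves\<close>

definition add_leaf where
  "add_leaf G u v a b = \<lparr>verts = insert v (verts G), darts = insert a (insert b (darts G)),
     base = (base G)(a := u, b := v), opp = (opp G)(a := b, b := a)\<rparr>"

lemma add_leaf_simps [simp]: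
  "verts (add_leaf G u v a b) = insert v (verts G)"
  "darts (add_leaf G u v a b) = insert a (insert b (darts G))"
  "base (add_leaf G u v a b) = (base G)(a := u, b := v)"
  "opp (add_leaf G u v a b) = (opp G)(a := b, b := a)"
  by (simp_all add: add_leaf_def)

definition fresh_leaf where
  "fresh_leaf G u v a b \<longleftrightarrow> u \<in> verts G \<and> v \<notin> verts G \<and> a \<notin> darts G \<and> b \<notin> darts G \<and> a \<noteq> b"

lemma finite_graph_add_leaf:
  assumes "finite_graph G" "fresh_leaf G u v a b"
  shows "finite_graph (add_leaf G u v a b)"
proof -
  let ?L = "add_leaf G u v a b"
  note fG = finite_graphD[OF assms(1)] and f = assms(2)[unfolded fresh_leaf_def]
  have "base ?L h \<in> verts ?L \<and> opp ?L h \<in> darts ?L \<and> opp ?L h \<noteq> h \<and> opp ?L (opp ?L h) = h"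
    if h: "h \<in> darts ?L" for h
  proof (cases "h = a \<or> h = b")
    case True
    then show ?thesis using f by auto
  next
    case False
    then have h: "h \<in> darts G" using h by simp
    have "opp G h \<noteq> a" "opp G h \<noteq> b" using fG(4)[OF h] f by auto
    then show ?thesis using False fG(3-6)[OF h] by simp
  qed
  then show ?thesis using fG(1,2) unfolding finite_graph_def by simp
qed

lemma bij_betw_insert_upd:
  assumes "bij_betw f A B" "x \<notin> A" "y \<notin> B"
  shows "bij_betw (f(x := y)) (insert x A) (insert y B)"
proof -
  have "bij_betw (f(x := y)) A B"
    using assms(1,2) by (subst bij_betw_cong[of A _ f]) auto
  then have "bij_betw (f(x := y)) (A \<union> {x}) (B \<union> {(f(x := y)) x})"
    using assms(2,3) by (intro notIn_Un_bij_betw) auto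
  then show ?thesis by simp
qed

lemma add_leaf_graph_isos:
  assumes G: "finite_graph G" and i: "(\<sigma>, \<pi>) \<in> graph_isos G G'"
    and f: "fresh_leaf G u v a b" "fresh_leaf G' u' v' a' b'" and u: "\<sigma> u = u'"
  shows "(\<sigma>(v := v'), \<pi>(a := a', b := b')) \<in> graph_isos (add_leaf G u v a b) (add_leaf G' u' v' a' b')"
proof -
  note fG = finite_graphD[OF G] and i = graph_isosD[OF i]
  note f = f[unfolded fresh_leaf_def]
  have "bij_betw (\<sigma>(v := v')) (verts (add_leaf G u v a b)) (verts (add_leaf G' u' v' a' b'))"
    using i(1) f by (simp add: bij_betw_insert_upd)
  moreover have "bij_betw (\<pi>(b := b', a := a')) (insert a (insert b (darts G))) (insert a' (insert b' (darts G')))"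
    using i(2) f by (intro bij_betw_insert_upd) auto
  then have "bij_betw (\<pi>(a := a', b := b')) (darts (add_leaf G u v a b)) (darts (add_leaf G' u' v' a' b'))"
    using f fun_upd_twist[of a b \<pi> a' b'] by simp
  moreover have "base (add_leaf G' u' v' a' b') ((\<pi>(a := a', b := b')) h) =
      (\<sigma>(v := v')) (base (add_leaf G u v a b) h) \<and>
      opp (add_leaf G' u' v' a' b') ((\<pi>(a := a', b := b')) h) = (\<pi>(a := a', b := b')) (opp (add_leaf G u v a b) h)"
    if h: "h \<in> darts (add_leaf G u v a b)" for h
  proof (cases "h = a \<or> h = b")
    case True
    then show ?thesis using f u by auto
  next
    case False
    then have h: "h \<in> darts G" using h by simp
    have "base G h \<noteq> v" "opp G h \<noteq> a" "opp G h \<noteq> b" "\<pi> h \<noteq> a'" "\<pi> h \<noteq> b'"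
      using fG(3,4)[OF h] i(6)[OF h] f by metis+
    then show ?thesis using False i(3,4)[OF h] by simp
  qed
  ultimately show ?thesis unfolding graph_isos_def by blast
qed

lemma add_leaf_rooted_tree:
  assumes T: "\<tau> \<in> rooted_trees" and f: "fresh_leaf (fst \<tau>) u v a b"
  shows "(add_leaf (fst \<tau>) u v a b, snd \<tau>) \<in> rooted_trees"
proof -
  let ?T = "fst \<tau>" let ?L = "add_leaf ?T u v a b"
  note t = rooted_treesD[OF T] and fT = finite_graphD[OF rooted_treesD(1)[OF T]]
  note f' = f[unfolded fresh_leaf_def]
  have fL: "finite_graph ?L" using finite_graph_add_leaf[OF t(1) f] .
  have "connected_graph ?L"
  proof (rule connected_graphI[OF fL])
    show "snd \<tau> \<in> verts ?L" using t by simp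
    fix S w assume S: "S \<subseteq> verts ?L" "w \<in> S"
      and cl: "\<And>h. h \<in> darts ?L \<Longrightarrow> base ?L h \<in> S \<Longrightarrow> base ?L (opp ?L h) \<in> S"
    have "v \<in> S \<Longrightarrow> u \<in> S" "u \<in> S \<Longrightarrow> v \<in> S"
      using cl[of b] cl[of a] f' by auto
    then obtain w' where w': "w' \<in> verts ?T" "w' \<in> S" using S f' by auto
    have "x \<in> S" if "x \<in> verts ?T" for x
      using t(1,2) w'
    proof (induction rule: connected_graph_induct)
      case (closed h)
      have "h \<noteq> a" "h \<noteq> b" "opp ?T h \<noteq> a" "opp ?T h \<noteq> b"
        using f' closed(1) fT(4)[OF closed(1)] by metis+
      then show ?case using cl[of h] closed by simp
    qed (rule that)
    then show "verts ?L \<subseteq> S" using \<open>u \<in> S \<Longrightarrow> v \<in> S\<close> f' by auto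
  qed
  moreover have "betti ?L = 0"
    using f' fT t(4) by (subst betti_iff[OF fL]) simp
  ultimately show ?thesis
    using fL t by (simp add: rooted_trees_def)
qed

lemma exists_fresh_leaf:
  fixes G :: ngraph
  assumes "finite_graph G" "u \<in> verts G"
  obtains v a b where "fresh_leaf G u v a b"
proof -
  note fG = finite_graphD[OF assms(1)]
  obtain v where "v \<notin> verts G" using ex_new_if_finite[OF infinite_UNIV_nat fG(1)] by blast
  moreover obtain a where a: "a \<notin> darts G" using ex_new_if_finite[OF infinite_UNIV_nat fG(2)] by blast
  moreover obtain b where "b \<notin> insert a (darts G)"
    using ex_new_if_finite[OF infinite_UNIV_nat, of "insert a (darts G)"] fG(2) by blast
  ultimately show thesis using that[of v a b] assms(2) by (auto simp: fresh_leaf_def)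
qed

text \<open>Induction on the number of vertices. A vertex of degree below 2 has degree 1, since an
  isolated vertex would be the whole graph and have Betti number 0. It is pruned, and then regrown
  in the tree that contains its neighbour.\<close>

lemma exists_graft:
  fixes K :: "('v, 'h) graph"
  assumes "finite_graph K" "connected_graph K" "betti K \<ge> 1"
  shows "\<exists>(H :: ('v, 'h) graph) T. finite_graph H \<and> connected_graph H \<and> min_degree 2 H \<and>
    (\<forall>v\<in>verts H. T v \<in> rooted_trees) \<and> graph_isos (graft H T) K \<noteq> {}"
  using assms
proof (induction "card (verts K)" arbitrary: K rule: less_induct)
  case less
  note K = less(2-4)
  note fK = finite_graphD[OF K(1)]
  show ?case
  proof (cases "min_degree 2 K")
    case True
    \<comment> \<open>Grafting the one-vertex tree everywhere changes nothing.\<close>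
    define \<tau> :: "ngraph \<times> nat" where "\<tau> = (\<lparr>verts = {0}, darts = {}, base = id, opp = id\<rparr>, 0)"
    have f: "finite_graph (fst \<tau>)" by (simp add: \<tau>_def finite_graph_def)
    then have "\<tau> \<in> rooted_trees"
      using betti_iff[OF f, of 0] by (auto simp: \<tau>_def rooted_trees_def connected_graph_def)
    moreover have "(fst, projl) \<in> graph_isos (graft K (\<lambda>_. \<tau>)) K"
      using fK by (auto simp: graph_isos_def \<tau>_def bij_betw_def inj_on_def image_iff)
    ultimately show ?thesis
      using True K by (intro exI[of _ K] exI[of _ "\<lambda>_. \<tau>"]) auto
  next
    case False
    then obtain v where v: "v \<in> verts K" "vertex_degree K v < 2" by (auto simp: min_degree_def)
    have "vertex_degree K v \<noteq> 0"
    proof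
      assume "vertex_degree K v = 0"
      then have none: "base K h \<noteq> v" if "h \<in> darts K" for h
        using that fK(2) by (auto simp: vertex_degree_def)
      then have "{v} = verts K"
        using K(2) v(1) unfolding connected_graph_iff[OF K(1)] by blast
      then have "verts K = {v}" "darts K = {}" using none fK(3) by auto
      then show False using betti_iff[OF K(1), of "betti K"] K(3) by simp
    qed
    then have "card {k \<in> darts K. base K k = v} = 1" using v(2) by (simp add: vertex_degree_def)
    then obtain h where h: "{k \<in> darts K. base K k = v} = {h}" by (rule card_1_singletonE)
    then have hd: "h \<in> darts K" "base K h = v" by auto
    have huniq: "k = h" if "k \<in> darts K" "base K k = v" for k using h that by blast
    let ?g = "opp K h"
    define u where "u = base K ?g"
    have g: "?g \<in> darts K" "?g \<noteq> h" "opp K ?g = h" using fK hd by auto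
    have u: "u \<in> verts K" "u \<noteq> v" using g fK(3) huniq[OF g(1)] by (auto simp: u_def)
    define K' where "K' = K\<lparr>verts := verts K - {v}, darts := darts K - {h, ?g}\<rparr>"
    have K'_simps [simp]: "verts K' = verts K - {v}" "darts K' = darts K - {h, ?g}" "base K' = base K" "opp K' = opp K"
      by (simp_all add: K'_def)
    have opp': "opp K k \<in> darts K - {h, ?g}" if "k \<in> darts K - {h, ?g}" for k
      using that fK(4,6) g(3) by (metis Diff_iff insertE insertI1 insertI2 singletonD)
    have fK': "finite_graph K'"
      unfolding finite_graph_def using fK opp' huniq by (auto simp: hd)
    have leaf: "add_leaf K' u v ?g h = K"
      using v(1) hd g by (auto simp: add_leaf_def K'_def u_def fun_upd_idem insert_absorb
          intro!: graph.equality)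
    have fresh: "fresh_leaf K' u v ?g h" using u g by (simp add: fresh_leaf_def)
    have c: "connected_graph K'"
    proof (rule connected_graphI[OF fK'])
      show "u \<in> verts K'" using u by simp
      fix S w assume S: "S \<subseteq> verts K'" "w \<in> S"
        and cl: "\<And>h. h \<in> darts K' \<Longrightarrow> base K' h \<in> S \<Longrightarrow> base K' (opp K' h) \<in> S"
      have w: "w \<in> verts K" using S by auto
      have "x \<in> S \<or> (x = v \<and> u \<in> S)" if "x \<in> verts K" for x
      proof (rule connected_graph_induct[OF K(1,2) w _ _ that, where P = "\<lambda>x. x \<in> S \<or> (x = v \<and> u \<in> S)"])
        fix k assume k: "k \<in> darts K" "base K k \<in> S \<or> (base K k = v \<and> u \<in> S)"
        show "base K (opp K k) \<in> S \<or> (base K (opp K k) = v \<and> u \<in> S)"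
        proof (cases "k = h \<or> k = ?g")
          case True
          have "v \<notin> S" using S(1) by auto
          then show ?thesis using True k hd g(3) by (auto simp: u_def)
        next
          case False
          then have "base K k \<noteq> v" using huniq k by blast
          then show ?thesis using cl[of k] k False by simp
        qed
      qed (use S in auto)
      then show "verts K' \<subseteq> S" by auto
    qed
    have b: "betti K' = betti K"
    proof -
      have "card (darts K') + 2 = card (darts K)" "card (verts K') + 1 = card (verts K)"
        using hd g v(1) fK(1,2) card_Diff_subset[of "{h, ?g}" "darts K"] card_mono[of "darts K" "{h, ?g}"]
          card_gt_0_iff[of "verts K"] by (auto simp: card_Diff_singleton)
      then show ?thesis
        using betti_iff[OF K(1), of "betti K"] betti_iff[OF fK', of "betti K"] by linarith
    qed
    have "card (verts K') < card (verts K)"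
      unfolding K'_simps by (rule card_Diff1_less[OF fK(1) v(1)])
    from less(1)[OF this fK' c] b K(3) obtain H :: "('v, 'h) graph" and T where
      H: "finite_graph H" "connected_graph H" "min_degree 2 H" and T: "\<forall>v\<in>verts H. T v \<in> rooted_trees"
      and i: "graph_isos (graft H T) K' \<noteq> {}" by auto
    obtain \<sigma> \<pi> where i: "(\<sigma>, \<pi>) \<in> graph_isos (graft H T) K'" using i by auto
    note t = rooted_treesD[OF T[rule_format]]
    have fg: "finite_graph (graft H T)" using t by (intro finite_graph_graft H(1))
    have "u \<in> \<sigma> ` verts (graft H T)"
      using u bij_betw_imp_surj_on[OF graph_isosD(1)[OF i]] by simp
    then obtain w x where wx: "w \<in> verts H" "x \<in> verts (fst (T w))" "\<sigma> (w, x) = u" by auto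
    \<comment> \<open>The neighbour \<open>u\<close> of the removed leaf corresponds to
      \<open>x\<close> in the tree at \<open>w\<close>, so that tree is extended at
      \<open>x\<close>. This extends the graft by a leaf, even as an equality of records.\<close>
    obtain y a d where fl: "fresh_leaf (fst (T w)) x y a d"
      using exists_fresh_leaf[OF t(1)[OF wx(1)] wx(2)] .
    let ?T = "T(w := (add_leaf (fst (T w)) x y a d, snd (T w)))"
    have eq: "graft H ?T = add_leaf (graft H T) (w, x) (w, y) (Inr (w, a)) (Inr (w, d))"
      (is "?l = ?r")
    proof (rule graph.equality)
      show "verts ?l = verts ?r" "darts ?l = darts ?r"
        using wx(1) by (auto split: if_splits)
      show "base ?l = base ?r"
      proof
        fix z show "base ?l z = base ?r z" by (cases z) (auto split: if_splits)
      qed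
      show "opp ?l = opp ?r"
      proof
        fix z show "opp ?l z = opp ?r z" by (cases z) (auto split: if_splits)
      qed
    qed simp
    have fl': "fresh_leaf (graft H T) (w, x) (w, y) (Inr (w, a)) (Inr (w, d))"
      using fl wx by (auto simp: fresh_leaf_def)
    have "graph_isos (graft H ?T) K \<noteq> {}"
      using add_leaf_graph_isos[OF fg i fl' fresh wx(3)] unfolding eq leaf by blast
    moreover have "\<forall>v\<in>verts H. ?T v \<in> rooted_trees"
      using T add_leaf_rooted_tree[OF T[rule_format, OF wx(1)] fl] by simp
    ultimately show ?thesis using H by blast
  qed
qed

section \<open>Colorings of grafted graphs\<close>

text \<open>An edge from \<open>v\<close> to another vertex has exactly one dart based at
  \<open>v\<close>, so edges can be counted by darts; the condition on the far end removes
  loops.\<close>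

lemma black_nbrs_darts:
  assumes G: "finite_graph G"
  shows "black_nbrs G c v =
    card {h \<in> darts G. base G h = v \<and> base G (opp G h) \<noteq> v \<and> c (base G (opp G h)) = 1}"
proof -
  note fG = finite_graphD[OF G]
  let ?D = "{h \<in> darts G. base G h = v \<and> base G (opp G h) \<noteq> v \<and> c (base G (opp G h)) = 1}"
  let ?E = "{e \<in> edges G. \<exists>u. u \<noteq> v \<and> c u = 1 \<and> base G ` e = {v, u}}"
  have "bij_betw (\<lambda>h. {h, opp G h}) ?D ?E"
  proof (rule bij_betw_imageI)
    show "inj_on (\<lambda>h. {h, opp G h}) ?D"
      by (rule inj_onI) (auto simp: doubleton_eq_iff)
    show "(\<lambda>h. {h, opp G h}) ` ?D = ?E"
    proof (intro equalityI subsetI)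
      fix e assume "e \<in> (\<lambda>h. {h, opp G h}) ` ?D"
      then obtain h where h: "e = {h, opp G h}" "h \<in> ?D" by blast
      then have "base G ` e = {v, base G (opp G h)}" "e \<in> edges G" by (auto simp: edges_def)
      with h show "e \<in> ?E" by blast
    next
      fix e assume "e \<in> ?E"
      then obtain u where e: "e \<in> edges G" "u \<noteq> v" "c u = 1" "base G ` e = {v, u}" by blast
      then obtain k where k: "k \<in> darts G" "e = {k, opp G k}" by (auto simp: edges_def)
      have "{base G k, base G (opp G k)} = {v, u}" using e k by simp
      then consider "base G k = v" "base G (opp G k) = u" | "base G k = u" "base G (opp G k) = v"
        by (auto simp: doubleton_eq_iff)
      then show "e \<in> (\<lambda>h. {h, opp G h}) ` ?D"
      proof cases
        case 1
        then show ?thesis using k e by (intro image_eqI[where x = k]) auto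
      next
        case 2
        then show ?thesis using k e fG by (intro image_eqI[where x = "opp G k"]) auto
      qed
    qed
  qed
  then show ?thesis unfolding black_nbrs_def by (simp add: bij_betw_same_card)
qed

lemma black_nbrs_iso:
  assumes G: "finite_graph G" "finite_graph H" and i: "(\<sigma>, \<pi>) \<in> graph_isos G H"
    and v: "v \<in> verts G" and c: "\<And>v. v \<in> verts G \<Longrightarrow> c' (\<sigma> v) = c v"
  shows "black_nbrs H c' (\<sigma> v) = black_nbrs G c v"
proof -
  note fG = finite_graphD[OF G(1)] and i = graph_isosD[OF i]
  have inj: "\<sigma> x = \<sigma> y \<longleftrightarrow> x = y" if "x \<in> verts G" "y \<in> verts G" for x y
    using that bij_betw_imp_inj_on[OF i(1)] by (auto dest: inj_onD)
  let ?P = "\<lambda>h. base G h = v \<and> base G (opp G h) \<noteq> v \<and> c (base G (opp G h)) = 1"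
  let ?Q = "\<lambda>h. base H h = \<sigma> v \<and> base H (opp H h) \<noteq> \<sigma> v \<and> c' (base H (opp H h)) = 1"
  have PQ: "?Q (\<pi> h) \<longleftrightarrow> ?P h" if "h \<in> darts G" for h
    using that i(3,4) fG(3,4) v c inj by simp
  have "bij_betw \<pi> {h \<in> darts G. ?P h} {h \<in> darts H. ?Q h}"
  proof (rule bij_betw_imageI)
    show "inj_on \<pi> {h \<in> darts G. ?P h}"
      using bij_betw_imp_inj_on[OF i(2)] by (rule inj_on_subset) auto
    show "\<pi> ` {h \<in> darts G. ?P h} = {h \<in> darts H. ?Q h}"
    proof (intro equalityI subsetI)
      fix k assume k: "k \<in> {h \<in> darts H. ?Q h}"
      then obtain h where "h \<in> darts G" "k = \<pi> h" using bij_betw_imp_surj_on[OF i(2)] by blast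
      then show "k \<in> \<pi> ` {h \<in> darts G. ?P h}" using PQ k by blast
    next
      fix k assume "k \<in> \<pi> ` {h \<in> darts G. ?P h}"
      then obtain h where "h \<in> darts G" "?P h" "k = \<pi> h" by blast
      then show "k \<in> {h \<in> darts H. ?Q h}" using PQ i(6) by blast
    qed
  qed
  then show ?thesis
    unfolding black_nbrs_darts[OF G(1)] black_nbrs_darts[OF G(2)] by (rule bij_betw_same_card[symmetric])
qed

lemma white_even_iso:
  assumes G: "finite_graph G" "finite_graph H" and i: "(\<sigma>, \<pi>) \<in> graph_isos G H"
    and c: "\<And>v. v \<in> verts G \<Longrightarrow> c' (\<sigma> v) = c v"
  shows "card (white_even H c') = card (white_even G c)"
proof (rule bij_betw_same_card[symmetric], rule bij_betw_imageI)
  note i' = graph_isosD[OF i]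
  have e: "v \<in> white_even G c \<longleftrightarrow> \<sigma> v \<in> white_even H c'" if "v \<in> verts G" for v
    using that i'(5) black_nbrs_iso[where c = c and c' = c', OF G i that c] c by (simp add: white_even_def)
  show "inj_on \<sigma> (white_even G c)"
    using bij_betw_imp_inj_on[OF i'(1)] by (rule inj_on_subset) (auto simp: white_even_def)
  show "\<sigma> ` white_even G c = white_even H c'"
  proof (intro equalityI subsetI)
    fix w assume w: "w \<in> white_even H c'"
    then have "w \<in> verts H" by (simp add: white_even_def)
    then obtain v where "v \<in> verts G" "w = \<sigma> v" using bij_betw_imp_surj_on[OF i'(1)] by blast
    then show "w \<in> \<sigma> ` white_even G c" using e w by blast
  next
    fix w assume "w \<in> \<sigma> ` white_even G c"
    then obtain v where v: "w = \<sigma> v" "v \<in> white_even G c" by blast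
    then have "v \<in> verts G" by (simp add: white_even_def)
    then show "w \<in> white_even H c'" using e v by blast
  qed
qed

lemma finite_colorings: "finite_graph G \<Longrightarrow> finite (colorings G)"
  by (auto simp: colorings_def finite_graphD intro!: finite_PiE)

lemma bw_poly_cong:
  assumes G: "finite_graph G" "finite_graph H" and i: "graph_isos G H \<noteq> {}"
  shows "bw_poly G = bw_poly H"
proof -
  obtain \<sigma> \<pi> where i: "(\<sigma>, \<pi>) \<in> graph_isos G H" using i by auto
  note i' = graph_isosD[OF i]
  have inv: "inv_into (verts G) \<sigma> (\<sigma> v) = v" if "v \<in> verts G" for v
    using i'(1) that by (rule bij_betw_inv_into_left)
  have inv': "\<sigma> (inv_into (verts G) \<sigma> w) = w" "inv_into (verts G) \<sigma> w \<in> verts G" if "w \<in> verts H" for w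
    using bij_betw_inv_into_right[OF i'(1) that] bij_betw_apply[OF bij_betw_inv_into[OF i'(1)] that] by auto
  have col: "colorings K = {c \<in> extensional (verts K). \<forall>v\<in>verts K. c v = 0 \<or> c v = 1}" for K :: "('x, 'y) graph"
    unfolding colorings_def PiE_def by auto
  have "(\<Sum>c\<in>colorings H. monom 1 (card (white_even H c)) :: rat poly) =
      (\<Sum>c\<in>colorings G. monom 1 (card (white_even G c)))"
  proof (rule sum.reindex_bij_witness[where i = "\<lambda>c. \<lambda>w\<in>verts H. c (inv_into (verts G) \<sigma> w)"
        and j = "\<lambda>c. \<lambda>v\<in>verts G. c (\<sigma> v)"])
    fix c assume c: "c \<in> colorings H"
    show "(\<lambda>w\<in>verts H. (\<lambda>v\<in>verts G. c (\<sigma> v)) (inv_into (verts G) \<sigma> w)) = c"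
      using c inv' by (auto simp: col extensional_def)
    show "(\<lambda>v\<in>verts G. c (\<sigma> v)) \<in> colorings G" using c i'(5) by (simp add: col)
    show "monom 1 (card (white_even G (\<lambda>v\<in>verts G. c (\<sigma> v)))) = monom 1 (card (white_even H c))"
      by (subst white_even_iso[OF G i, where c = "\<lambda>v\<in>verts G. c (\<sigma> v)" and c' = c]) auto
  next
    fix c assume c: "c \<in> colorings G"
    show "(\<lambda>v\<in>verts G. (\<lambda>w\<in>verts H. c (inv_into (verts G) \<sigma> w)) (\<sigma> v)) = c"
      using c inv i'(5) by (auto simp: col extensional_def)
    show "(\<lambda>w\<in>verts H. c (inv_into (verts G) \<sigma> w)) \<in> colorings H" using c inv' by (simp add: col)
  qed
  then show ?thesis unfolding bw_poly_def by simp
qed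

text \<open>The darts at \<open>(v, x)\<close> come from the tree and, at its root only, also from
  \<open>H\<close>; the far ends of the latter are again roots.\<close>

lemma black_nbrs_graft:
  fixes H :: "('b, 'a) graph" and T :: "'b \<Rightarrow> ngraph \<times> nat"
  assumes H: "finite_graph H" and T: "\<And>v. v \<in> verts H \<Longrightarrow> T v \<in> rooted_trees"
    and v: "v \<in> verts H" "x \<in> verts (fst (T v))"
    and c: "\<And>v. v \<in> verts H \<Longrightarrow> c v = c' (v, snd (T v))"
    and D: "\<And>x. x \<in> verts (fst (T v)) \<Longrightarrow> D x = c' (v, x)"
    and nl: "x = snd (T v) \<Longrightarrow> c v = 0"
  shows "black_nbrs (graft H T) c' (v, x) =
    black_nbrs (fst (T v)) D x + (if x = snd (T v) then black_nbrs H c v else 0)"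
proof -
  note fH = finite_graphD[OF H] and t = rooted_treesD[OF T]
  note fT = finite_graphD[OF t(1)[OF v(1)]]
  let ?T = "fst (T v)" and ?G = "graft H T"
  have fG: "finite_graph ?G" using t by (intro finite_graph_graft H)
  let ?A = "{h \<in> darts ?T. base ?T h = x \<and> base ?T (opp ?T h) \<noteq> x \<and> D (base ?T (opp ?T h)) = 1}"
  let ?B = "{h \<in> darts H. base H h = v \<and> base H (opp H h) \<noteq> v \<and> c (base H (opp H h)) = 1}"
  let ?C = "{h \<in> darts ?G. base ?G h = (v, x) \<and> base ?G (opp ?G h) \<noteq> (v, x) \<and> c' (base ?G (opp ?G h)) = 1}"
  have "?C = (\<lambda>k. Inr (v, k)) ` ?A \<union> (if x = snd (T v) then Inl ` ?B else {})" (is "_ = ?R")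
  proof (rule set_eqI)
    fix z show "z \<in> ?C \<longleftrightarrow> z \<in> ?R"
    proof (cases z)
      case (Inl h)
      show ?thesis
      proof (cases "h \<in> darts H \<and> base H h = v")
        case True
        then have "c (base H (opp H h)) = c' (base H (opp H h), snd (T (base H (opp H h))))"
          using c fH by blast
        then show ?thesis using Inl True nl c[OF v(1)] by auto
      qed (auto simp: Inl)
    next
      case (Inr p)
      obtain w k where p: "p = (w, k)" by (cases p)
      show ?thesis
      proof (cases "w = v \<and> k \<in> darts ?T")
        case True
        then have "D (base ?T (opp ?T k)) = c' (v, base ?T (opp ?T k))"
          using D fT by blast
        then show ?thesis using Inr True v p by auto
      qed (use Inr p in \<open>auto split: if_splits\<close>)
    qed
  qed
  then have "card ?C = card ?R" by simp
  also have "\<dots> = card ?A + (if x = snd (T v) then card ?B else 0)"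
  proof (cases "x = snd (T v)")
    case True
    have "card ?R = card ((\<lambda>k. Inr (v, k)) ` ?A :: ('a + 'b \<times> nat) set) + card (Inl ` ?B :: ('a + 'b \<times> nat) set)"
      unfolding if_P[OF True] using fT(2) fH(2) by (intro card_Un_disjoint) auto
    then show ?thesis using True by (simp add: card_image inj_on_def)
  qed (simp add: card_image inj_on_def)
  finally show ?thesis
    unfolding black_nbrs_darts[OF fG] black_nbrs_darts[OF H] black_nbrs_darts[OF t(1)[OF v(1)]] .
qed

text \<open>
  The number of white vertices with even count in the tree \<open>\<tau>\<close> colored by \<open>d\<close>, once its root
  has been identified with a vertex of color \<open>col\<close> and count \<open>m\<close>.
\<close>

definition grafted_even :: "nat \<Rightarrow> nat \<Rightarrow> ('w, 'k) graph \<times> 'w \<Rightarrow> ('w \<Rightarrow> nat) \<Rightarrow> nat" where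
  "grafted_even col m \<tau> d = card (white_even (fst \<tau>) d - {snd \<tau>}) +
     (if col = 0 \<and> even (m + black_nbrs (fst \<tau>) d (snd \<tau>)) then 1 else 0)"

text \<open>The count is taken tree by tree. Off the root the parity is that in the tree, and at the
  root the counts in \<open>H\<close> and in the tree add up.\<close>

lemma card_white_even_graft:
  assumes H: "finite_graph H" and T: "\<And>v. v \<in> verts H \<Longrightarrow> T v \<in> rooted_trees"
    and c: "\<And>v. v \<in> verts H \<Longrightarrow> c v = c' (v, snd (T v))"
    and D: "\<And>v x. v \<in> verts H \<Longrightarrow> x \<in> verts (fst (T v)) \<Longrightarrow> D v x = c' (v, x)"
  shows "card (white_even (graft H T) c') =
    (\<Sum>v\<in>verts H. grafted_even (c v) (black_nbrs H c v) (T v) (D v))"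
proof -
  note t = rooted_treesD[OF T]
  let ?W = "\<lambda>v. {x \<in> verts (fst (T v)). c' (v, x) = 0 \<and> even (black_nbrs (graft H T) c' (v, x))}"
  have "white_even (graft H T) c' = Sigma (verts H) ?W"
    by (auto simp: white_even_def)
  moreover have "card (?W v) = grafted_even (c v) (black_nbrs H c v) (T v) (D v)" if v: "v \<in> verts H" for v
  proof -
    let ?T = "fst (T v)" and ?r = "snd (T v)"
    have r: "?r \<in> verts ?T" using t(3)[OF v] .
    have fin: "finite (verts ?T)" using finite_graphD(1)[OF t(1)[OF v]] .
    have "x \<in> ?W v \<longleftrightarrow> x \<in> (white_even ?T (D v) - {?r}) \<union>
        (if c v = 0 \<and> even (black_nbrs H c v + black_nbrs ?T (D v) ?r) then {?r} else {})" for x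
    proof (cases "x = ?r")
      case True
      then show ?thesis
        using black_nbrs_graft[where H = H and T = T and v = v and x = ?r and c = c and c' = c' and D = "D v",
            OF H T v r] r c[OF v] c D[OF v]
        by (auto simp: add.commute)
    next
      case False
      then show ?thesis
        using black_nbrs_graft[where H = H and T = T and v = v and x = x and c = c and c' = c' and D = "D v",
            OF H T v] c D[OF v]
        by (auto simp: white_even_def)
    qed
    then have "?W v = (white_even ?T (D v) - {?r}) \<union>
        (if c v = 0 \<and> even (black_nbrs H c v + black_nbrs ?T (D v) ?r) then {?r} else {})"
      by (rule set_eqI)
    moreover have "card (A \<union> (if P then {?r} else {})) = card A + (if P then 1 else 0)"
      if "finite A" "?r \<notin> A" for A P
      using that by simp
    moreover have "finite (white_even ?T (D v) - {?r})"
      using fin by (simp add: white_even_def)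
    ultimately show ?thesis
      unfolding grafted_even_def by (metis (no_types, lifting) Diff_iff singletonI)
  qed
  ultimately show ?thesis
    using finite_graphD(1)[OF H] finite_graphD(1)[OF t(1)] by simp
qed

section \<open>The three vertex contributions\<close>

text \<open>A finite version of \<open>tree_series\<close> with arbitrary weights. Coefficients lie
  in a field so that \<open>t\<close> can be inverted.\<close>

definition tree_poly ::
  "(ngraph \<times> nat \<Rightarrow> 'a::field) \<Rightarrow> 'a \<Rightarrow> (ngraph \<times> nat) set \<Rightarrow>
    (ngraph \<Rightarrow> nat \<Rightarrow> (nat \<Rightarrow> nat) \<Rightarrow> bool) \<Rightarrow> 'a fps" where
  "tree_poly w t R P = (\<Sum>\<tau>\<in>R. \<Sum>d\<in>{d \<in> colorings (fst \<tau>). P (fst \<tau>) (snd \<tau>) d}.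
     fps_const (w \<tau> * t ^ card (white_even (fst \<tau>) d)) * fps_X ^ card (verts (fst \<tau>)))"

text \<open>With odd \<open>m\<close>, a white root with even count in its tree ceases to be
  counted, and one with odd count begins to be; with even \<open>m\<close> nothing changes, and a
  black root is never counted.\<close>

lemma grafted_even_cases:
  assumes \<tau>: "\<tau> \<in> rooted_trees" and d: "d \<in> colorings (fst \<tau>)" and t: "(t :: 'a::field) \<noteq> 0"
  defines "k \<equiv> black_nbrs (fst \<tau>) d (snd \<tau>)"
  shows "d (snd \<tau>) = 1 \<Longrightarrow> t ^ grafted_even 1 m \<tau> d = t ^ card (white_even (fst \<tau>) d)"
    and "d (snd \<tau>) = 0 \<Longrightarrow> even m \<Longrightarrow> t ^ grafted_even 0 m \<tau> d = t ^ card (white_even (fst \<tau>) d)"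
    and "d (snd \<tau>) = 0 \<Longrightarrow> odd m \<Longrightarrow> even k \<Longrightarrow>
      t ^ grafted_even 0 m \<tau> d = inverse t * t ^ card (white_even (fst \<tau>) d)"
    and "d (snd \<tau>) = 0 \<Longrightarrow> odd m \<Longrightarrow> odd k \<Longrightarrow>
      t ^ grafted_even 0 m \<tau> d = t * t ^ card (white_even (fst \<tau>) d)"
proof -
  let ?W = "white_even (fst \<tau>) d" and ?r = "snd \<tau>"
  have r: "?r \<in> ?W \<longleftrightarrow> d ?r = 0 \<and> even k"
    using rooted_treesD(3)[OF \<tau>] by (simp add: white_even_def k_def)
  have fin: "finite ?W"
    using finite_graphD(1)[OF rooted_treesD(1)[OF \<tau>]] by (simp add: white_even_def)
  define n where "n = card (?W - {?r})"
  have c1: "card ?W = Suc n" if "?r \<in> ?W"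
    using card_Suc_Diff1[OF fin that] by (simp add: n_def)
  have c2: "card ?W = n" if "?r \<notin> ?W" using that by (simp add: n_def)
  have ge: "grafted_even l m \<tau> d = n + (if l = 0 \<and> even (m + k) then 1 else 0)" for l
    by (simp only: grafted_even_def n_def k_def)
  show "d ?r = 1 \<Longrightarrow> t ^ grafted_even 1 m \<tau> d = t ^ card ?W"
    using c2 r by (simp add: ge)
  show "d ?r = 0 \<Longrightarrow> even m \<Longrightarrow> t ^ grafted_even 0 m \<tau> d = t ^ card ?W"
    using c1 c2 r by (cases "even k") (simp_all add: ge)
  show "d ?r = 0 \<Longrightarrow> odd m \<Longrightarrow> even k \<Longrightarrow> t ^ grafted_even 0 m \<tau> d = inverse t * t ^ card ?W"
    using c1 r t by (simp add: ge)
  show "d ?r = 0 \<Longrightarrow> odd m \<Longrightarrow> odd k \<Longrightarrow> t ^ grafted_even 0 m \<tau> d = t * t ^ card ?W"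
    using c2 r t by (simp add: ge)
qed

text \<open>The left side is what the substitution inserts at a vertex of the subdivided core with
  color \<open>col\<close> and count \<open>m\<close> there.\<close>

lemma tree_poly_grafted:
  fixes t :: "'a::field" and w :: "ngraph \<times> nat \<Rightarrow> 'a"
  assumes R: "finite R" "R \<subseteq> rooted_trees" and t: "t \<noteq> 0" and col: "col = 0 \<or> col = 1"
  defines "tb \<equiv> tree_poly w t R (\<lambda>T r c. c r = 1)"
    and "te \<equiv> tree_poly w t R (\<lambda>T r c. c r = 0 \<and> even (black_nbrs T c r))"
    and "to \<equiv> tree_poly w t R (\<lambda>T r c. c r = 0 \<and> odd (black_nbrs T c r))"
  shows "(if col = 1 then tb else if even m then te + to
      else fps_const (inverse t) * te + fps_const t * to) =
    (\<Sum>\<tau>\<in>R. \<Sum>d\<in>{d \<in> colorings (fst \<tau>). d (snd \<tau>) = col}.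
      fps_const (w \<tau> * t ^ grafted_even col m \<tau> d) * fps_X ^ card (verts (fst \<tau>)))"
    (is "?l = ?r")
proof -
  have fc: "finite (colorings (fst \<tau>))" if "\<tau> \<in> R" for \<tau>
    using that R rooted_treesD(1) finite_colorings by blast
  let ?g = "\<lambda>\<tau> d. fps_const (w \<tau> * t ^ card (white_even (fst \<tau>) d)) * fps_X ^ card (verts (fst \<tau>))"
  have tp: "tree_poly w t R P = (\<Sum>\<tau>\<in>R. \<Sum>d\<in>colorings (fst \<tau>). if P (fst \<tau>) (snd \<tau>) d then ?g \<tau> d else 0)" for P
    unfolding tree_poly_def by (rule sum.cong[OF refl], rule sum.inter_filter, rule fc)
  have "?r = (\<Sum>\<tau>\<in>R. \<Sum>d\<in>colorings (fst \<tau>). if d (snd \<tau>) = col then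
      fps_const (w \<tau> * t ^ grafted_even col m \<tau> d) * fps_X ^ card (verts (fst \<tau>)) else 0)"
    by (rule sum.cong[OF refl], rule sum.inter_filter, rule fc)
  also have "\<dots> = ?l"
  proof -
    consider "col = 1" | "col = 0" "even m" | "col = 0" "odd m" using col by blast
    then show ?thesis
    proof cases
      case 1
      then show ?thesis
        unfolding tb_def tp using R(2) grafted_even_cases(1)[OF _ _ t]
        by (simp, intro sum.cong refl) (auto)
    next
      case 2
      have "te + to = (\<Sum>\<tau>\<in>R. \<Sum>d\<in>colorings (fst \<tau>). if d (snd \<tau>) = 0 then ?g \<tau> d else 0)"
        unfolding te_def to_def tp sum.distrib[symmetric] by (intro sum.cong refl) auto
      with 2 show ?thesis
        using R(2) grafted_even_cases(2)[OF _ _ t] by (simp, intro sum.cong refl) (auto)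
    next
      case 3
      have "fps_const (inverse t) * te + fps_const t * to = (\<Sum>\<tau>\<in>R. \<Sum>d\<in>colorings (fst \<tau>).
          fps_const (inverse t) * (if d (snd \<tau>) = 0 \<and> even (black_nbrs (fst \<tau>) d (snd \<tau>)) then ?g \<tau> d else 0) +
          fps_const t * (if d (snd \<tau>) = 0 \<and> odd (black_nbrs (fst \<tau>) d (snd \<tau>)) then ?g \<tau> d else 0))"
        unfolding te_def to_def tp sum.distrib sum_distrib_left ..
      moreover have "(if d (snd \<tau>) = col then fps_const (w \<tau> * t ^ grafted_even col m \<tau> d) * fps_X ^ card (verts (fst \<tau>)) else 0) =
          fps_const (inverse t) * (if d (snd \<tau>) = 0 \<and> even (black_nbrs (fst \<tau>) d (snd \<tau>)) then ?g \<tau> d else 0) +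
          fps_const t * (if d (snd \<tau>) = 0 \<and> odd (black_nbrs (fst \<tau>) d (snd \<tau>)) then ?g \<tau> d else 0)"
        if "\<tau> \<in> R" "d \<in> colorings (fst \<tau>)" for \<tau> d
        using 3 grafted_even_cases(3,4)[OF subsetD[OF R(2) that(1)] that(2) t, of m]
        by (auto simp: mult.assoc[symmetric] mult.left_commute)
      ultimately show ?thesis using 3 by simp
    qed
  qed
  finally show ?thesis by simp
qed

text \<open>Each monomial as a product over vertices, the form in which products of tree sums can be
  expanded.\<close>

lemma full_W_alt:
  fixes b :: "'a::comm_semiring_1"
  assumes H: "finite_graph H"
  shows "full_W H b wm wp =
    (\<Sum>c\<in>colorings H. \<Prod>v\<in>verts H. if c v = 1 then b else if even (black_nbrs H c v) then wp else wm)"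
  unfolding full_W_def
proof (rule sum.cong[OF refl])
  fix c assume c: "c \<in> colorings H"
  have V: "finite (verts H)" using finite_graphD(1)[OF H] .
  let ?e = "{v. even (black_nbrs H c v)}"
  have c01: "c v = 0 \<longleftrightarrow> c v \<noteq> 1" if "v \<in> verts H" for v
    using c that by (auto simp: colorings_def PiE_def Pi_def)
  have "black H c = verts H \<inter> {v. c v = 1}" "white_even H c = verts H \<inter> - {v. c v = 1} \<inter> ?e"
    "white_odd H c = verts H \<inter> - {v. c v = 1} \<inter> - ?e"
    using c01 by (auto simp: black_def white_even_def white_odd_def)
  then show "b ^ card (black H c) * wp ^ card (white_even H c) * wm ^ card (white_odd H c) =
      (\<Prod>v\<in>verts H. if c v = 1 then b else if even (black_nbrs H c v) then wp else wm)"
    using V by (simp add: prod.If_cases mult.assoc)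
qed

text \<open>A coloring of the graft consists of a coloring of \<open>H\<close> and colorings of the
  trees that agree with it at the roots.\<close>

lemma sum_colorings_graft:
  fixes H :: "('v, 'h) graph" and T :: "'v \<Rightarrow> ngraph \<times> nat" and f :: "nat \<Rightarrow> 'b::comm_monoid_add"
  assumes H: "finite_graph H" and T: "\<And>v. v \<in> verts H \<Longrightarrow> T v \<in> rooted_trees"
  shows "(\<Sum>c\<in>colorings H. \<Sum>D\<in>(\<Pi>\<^sub>E v\<in>verts H. {d \<in> colorings (fst (T v)). d (snd (T v)) = c v}).
      f (\<Sum>v\<in>verts H. grafted_even (c v) (black_nbrs H c v) (T v) (D v))) =
    (\<Sum>c\<in>colorings (graft H T). f (card (white_even (graft H T) c)))"
proof -
  note t = rooted_treesD[OF T] and fH = finite_graphD[OF H]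
  let ?D = "\<lambda>c. \<Pi>\<^sub>E v\<in>verts H. {d \<in> colorings (fst (T v)). d (snd (T v)) = c v}"
  let ?i = "\<lambda>c'. (\<lambda>v\<in>verts H. c' (v, snd (T v)), \<lambda>v\<in>verts H. \<lambda>x\<in>verts (fst (T v)). c' (v, x))"
  let ?j = "\<lambda>(c, D). \<lambda>(v, x)\<in>verts (graft H T). D v x"
  have col: "colorings K = {c \<in> extensional (verts K). \<forall>v\<in>verts K. c v = 0 \<or> c v = 1}" for K :: "('x, 'y) graph"
    unfolding colorings_def PiE_def by auto
  have fD: "finite (?D c)" for c
    using finite_colorings[OF t(1)] by (intro finite_PiE fH(1) finite_Collect_conjI disjI1) simp
  have "(\<Sum>c\<in>colorings H. \<Sum>D\<in>?D c. f (\<Sum>v\<in>verts H. grafted_even (c v) (black_nbrs H c v) (T v) (D v))) =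
      (\<Sum>(c, D)\<in>Sigma (colorings H) ?D. f (\<Sum>v\<in>verts H. grafted_even (c v) (black_nbrs H c v) (T v) (D v)))"
    using fD finite_colorings[OF H] by (intro sum.Sigma) auto
  also have "\<dots> = (\<Sum>c\<in>colorings (graft H T). f (card (white_even (graft H T) c)))"
  proof (rule sum.reindex_bij_witness[where i = ?i and j = ?j])
    fix p assume "p \<in> Sigma (colorings H) ?D"
    then obtain c D where p: "p = (c, D)" "c \<in> colorings H" "D \<in> ?D c" by auto
    have D: "D v \<in> colorings (fst (T v))" "D v (snd (T v)) = c v" if "v \<in> verts H" for v
      using PiE_mem[OF p(3) that] by auto
    have De: "D \<in> extensional (verts H)" using p(3) by (auto simp: PiE_def)
    have 1: "(\<lambda>v\<in>verts H. ?j p (v, snd (T v))) = c"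
      using D p(2) t(3) by (intro extensionalityI[where A = "verts H"]) (auto simp: p(1) col)
    have 2: "(\<lambda>v\<in>verts H. \<lambda>x\<in>verts (fst (T v)). ?j p (v, x)) = D"
    proof (rule extensionalityI[OF _ De])
      fix v assume v: "v \<in> verts H"
      have "(\<lambda>x\<in>verts (fst (T v)). ?j p (v, x)) = D v"
        using v D(1)[OF v] by (intro extensionalityI[where A = "verts (fst (T v))"]) (auto simp: p(1) col)
      then show "(\<lambda>v\<in>verts H. \<lambda>x\<in>verts (fst (T v)). ?j p (v, x)) v = D v" using v by simp
    qed simp
    show "?i (?j p) = p" using 1 2 p(1) by simp
    show "?j p \<in> colorings (graft H T)"
      using D(1) by (auto simp: p(1) col)
    have "card (white_even (graft H T) (?j p)) =
        (\<Sum>v\<in>verts H. grafted_even (c v) (black_nbrs H c v) (T v) (D v))"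
      using D t(3) by (intro card_white_even_graft H T) (auto simp: p(1))
    then show "f (card (white_even (graft H T) (?j p))) =
      (case p of (c, D) \<Rightarrow> f (\<Sum>v\<in>verts H. grafted_even (c v) (black_nbrs H c v) (T v) (D v)))"
      by (simp add: p(1))
  next
    fix c assume c: "c \<in> colorings (graft H T)"
    show "?j (?i c) = c"
      using c by (intro extensionalityI[where A = "verts (graft H T)"]) (auto simp: col)
    show "?i c \<in> Sigma (colorings H) ?D"
      using c t(3) by (auto simp: col)
  qed
  finally show ?thesis .
qed

text \<open>Expanding the product over vertices chooses a tree and then a coloring of it at each
  vertex. For a fixed choice of trees, these colorings and that of \<open>H\<close> combine to one
  coloring of the graft.\<close>

lemma full_W_tree_poly:
  fixes t :: "'a::field" and w :: "ngraph \<times> nat \<Rightarrow> 'a"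
  assumes H: "finite_graph H" and R: "finite R" "R \<subseteq> rooted_trees" and t: "t \<noteq> 0"
  defines "tb \<equiv> tree_poly w t R (\<lambda>T r c. c r = 1)"
    and "te \<equiv> tree_poly w t R (\<lambda>T r c. c r = 0 \<and> even (black_nbrs T c r))"
    and "to \<equiv> tree_poly w t R (\<lambda>T r c. c r = 0 \<and> odd (black_nbrs T c r))"
  shows "full_W H tb (fps_const (inverse t) * te + fps_const t * to) (te + to) =
    (\<Sum>T\<in>verts H \<rightarrow>\<^sub>E R. fps_const ((\<Prod>v\<in>verts H. w (T v)) *
      (\<Sum>c\<in>colorings (graft H T). t ^ card (white_even (graft H T) c))) * fps_X ^ card (verts (graft H T)))"
proof -
  note fH = finite_graphD[OF H]
  let ?G = "\<lambda>c T. \<Pi>\<^sub>E v\<in>verts H. {d \<in> colorings (fst (T v)). d (snd (T v)) = c v}"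
  let ?s = "\<lambda>c v \<tau> d. grafted_even (c v) (black_nbrs H c v) \<tau> d"
  have rt: "T v \<in> rooted_trees" if "T \<in> verts H \<rightarrow>\<^sub>E R" "v \<in> verts H" for T v
    using that R(2) by (meson PiE_mem subsetD)
  have prod: "(\<Prod>v\<in>verts H. fps_const (w (T v) * t ^ ?s c v (T v) (D v)) * fps_X ^ card (verts (fst (T v)))) =
      fps_const (\<Prod>v\<in>verts H. w (T v)) * fps_const (t ^ (\<Sum>v\<in>verts H. ?s c v (T v) (D v))) *
      fps_X ^ card (verts (graft H T))"
    if "T \<in> verts H \<rightarrow>\<^sub>E R" for T c D
  proof -
    have c: "card (verts (graft H T)) = (\<Sum>v\<in>verts H. card (verts (fst (T v))))"
      using rooted_treesD(1)[OF rt[OF that]] by (rule card_verts_graft[OF H])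
    have "(\<Prod>v\<in>A. fps_const (f v)) = fps_const (\<Prod>v\<in>A. f v)" for A :: "'b set" and f :: "'b \<Rightarrow> 'a"
      by (induction A rule: infinite_finite_induct) (auto simp del: fps_const_1_eq_1)
    then show ?thesis
      unfolding c by (simp add: prod.distrib power_sum)
  qed
  have "full_W H tb (fps_const (inverse t) * te + fps_const t * to) (te + to) =
    (\<Sum>c\<in>colorings H. \<Prod>v\<in>verts H. \<Sum>\<tau>\<in>R. \<Sum>d\<in>{d \<in> colorings (fst \<tau>). d (snd \<tau>) = c v}.
      fps_const (w \<tau> * t ^ ?s c v \<tau> d) * fps_X ^ card (verts (fst \<tau>)))"
    unfolding full_W_alt[OF H]
  proof (intro sum.cong prod.cong refl)
    fix c v assume "c \<in> colorings H" "v \<in> verts H"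
    then have "c v = 0 \<or> c v = 1" by (auto simp: colorings_def PiE_def Pi_def)
    then show "(if c v = 1 then tb else if even (black_nbrs H c v) then te + to
        else fps_const (inverse t) * te + fps_const t * to) =
      (\<Sum>\<tau>\<in>R. \<Sum>d\<in>{d \<in> colorings (fst \<tau>). d (snd \<tau>) = c v}.
        fps_const (w \<tau> * t ^ ?s c v \<tau> d) * fps_X ^ card (verts (fst \<tau>)))"
      unfolding tb_def te_def to_def by (rule tree_poly_grafted[OF R t])
  qed
  also have "\<dots> = (\<Sum>c\<in>colorings H. \<Sum>T\<in>verts H \<rightarrow>\<^sub>E R. \<Sum>D\<in>?G c T.
      \<Prod>v\<in>verts H. fps_const (w (T v) * t ^ ?s c v (T v) (D v)) * fps_X ^ card (verts (fst (T v))))"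
  proof (rule sum.cong[OF refl])
    fix c
    have "(\<Prod>v\<in>verts H. \<Sum>\<tau>\<in>R. \<Sum>d\<in>{d \<in> colorings (fst \<tau>). d (snd \<tau>) = c v}.
        fps_const (w \<tau> * t ^ ?s c v \<tau> d) * fps_X ^ card (verts (fst \<tau>))) =
      (\<Sum>T\<in>verts H \<rightarrow>\<^sub>E R. \<Prod>v\<in>verts H. \<Sum>d\<in>{d \<in> colorings (fst (T v)). d (snd (T v)) = c v}.
        fps_const (w (T v) * t ^ ?s c v (T v) d) * fps_X ^ card (verts (fst (T v))))"
      using fH(1) R(1) by (rule prod_sum_PiE)
    also have "\<dots> = (\<Sum>T\<in>verts H \<rightarrow>\<^sub>E R. \<Sum>D\<in>?G c T.
      \<Prod>v\<in>verts H. fps_const (w (T v) * t ^ ?s c v (T v) (D v)) * fps_X ^ card (verts (fst (T v))))"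
    proof (rule sum.cong[OF refl])
      fix T assume "T \<in> verts H \<rightarrow>\<^sub>E R"
      note rt = rooted_treesD(1)[OF rt[OF this]]
      show "(\<Prod>v\<in>verts H. \<Sum>d\<in>{d \<in> colorings (fst (T v)). d (snd (T v)) = c v}.
          fps_const (w (T v) * t ^ ?s c v (T v) d) * fps_X ^ card (verts (fst (T v)))) =
        (\<Sum>D\<in>?G c T. \<Prod>v\<in>verts H. fps_const (w (T v) * t ^ ?s c v (T v) (D v)) * fps_X ^ card (verts (fst (T v))))"
        using fH(1) finite_colorings[OF rt] by (intro prod_sum_PiE) auto
    qed
    finally show "(\<Prod>v\<in>verts H. \<Sum>\<tau>\<in>R. \<Sum>d\<in>{d \<in> colorings (fst \<tau>). d (snd \<tau>) = c v}.
        fps_const (w \<tau> * t ^ ?s c v \<tau> d) * fps_X ^ card (verts (fst \<tau>))) = \<dots>" .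
  qed
  also have "\<dots> = (\<Sum>T\<in>verts H \<rightarrow>\<^sub>E R. \<Sum>c\<in>colorings H. \<Sum>D\<in>?G c T.
      \<Prod>v\<in>verts H. fps_const (w (T v) * t ^ ?s c v (T v) (D v)) * fps_X ^ card (verts (fst (T v))))"
    by (rule sum.swap)
  also have "\<dots> = (\<Sum>T\<in>verts H \<rightarrow>\<^sub>E R. fps_const ((\<Prod>v\<in>verts H. w (T v)) *
      (\<Sum>c\<in>colorings (graft H T). t ^ card (white_even (graft H T) c))) * fps_X ^ card (verts (graft H T)))"
  proof (rule sum.cong[OF refl])
    fix T assume T: "T \<in> verts H \<rightarrow>\<^sub>E R"
    let ?w = "fps_const (\<Prod>v\<in>verts H. w (T v))" and ?x = "fps_X ^ card (verts (graft H T)) :: 'a fps"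
    have "(\<Sum>c\<in>colorings H. \<Sum>D\<in>?G c T. \<Prod>v\<in>verts H.
        fps_const (w (T v) * t ^ ?s c v (T v) (D v)) * fps_X ^ card (verts (fst (T v)))) =
      ?w * (\<Sum>c\<in>colorings H. \<Sum>D\<in>?G c T. fps_const (t ^ (\<Sum>v\<in>verts H. ?s c v (T v) (D v)))) * ?x"
      unfolding prod[OF T] sum_distrib_left sum_distrib_right ..
    also have "(\<Sum>c\<in>colorings H. \<Sum>D\<in>?G c T. fps_const (t ^ (\<Sum>v\<in>verts H. ?s c v (T v) (D v)))) =
        (\<Sum>c\<in>colorings (graft H T). fps_const (t ^ card (white_even (graft H T) c)))"
      by (rule sum_colorings_graft[OF H rt[OF T]])
    also have "\<dots> = fps_const (\<Sum>c\<in>colorings (graft H T). t ^ card (white_even (graft H T) c))"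
      by (simp add: fps_eq_iff fps_sum_nth)
    finally show "(\<Sum>c\<in>colorings H. \<Sum>D\<in>?G c T. \<Prod>v\<in>verts H.
        fps_const (w (T v) * t ^ ?s c v (T v) (D v)) * fps_X ^ card (verts (fst (T v)))) =
      fps_const ((\<Prod>v\<in>verts H. w (T v)) *
        (\<Sum>c\<in>colorings (graft H T). t ^ card (white_even (graft H T) c))) * ?x"
      by simp
  qed
  finally show ?thesis .
qed

section \<open>Substitution of the tree series\<close>

text \<open>Congruence modulo \<open>fps_X ^ (N + 1)\<close>. The ring operations respect it, so
  tree series may be replaced by finite sums inside \<open>full_W\<close>.\<close>

definition agree_upto :: "nat \<Rightarrow> 'a::comm_semiring_1 fps \<Rightarrow> 'a fps \<Rightarrow> bool" where
  "agree_upto N A B \<longleftrightarrow> (\<forall>m\<le>N. A $ m = B $ m)"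

lemma agree_upto_refl: "agree_upto N A A"
  by (simp add: agree_upto_def)

lemma agree_upto_add: "agree_upto N A B \<Longrightarrow> agree_upto N A' B' \<Longrightarrow> agree_upto N (A + A') (B + B')"
  by (simp add: agree_upto_def)

lemma agree_upto_mult: "agree_upto N A B \<Longrightarrow> agree_upto N A' B' \<Longrightarrow> agree_upto N (A * A') (B * B')"
  by (auto simp: agree_upto_def fps_mult_nth intro!: sum.cong)

lemma agree_upto_power: "agree_upto N A B \<Longrightarrow> agree_upto N (A ^ k) (B ^ k)"
  by (induction k) (auto intro: agree_upto_mult agree_upto_refl)

lemma agree_upto_sum: "(\<And>x. x \<in> S \<Longrightarrow> agree_upto N (f x) (g x)) \<Longrightarrow> agree_upto N (sum f S) (sum g S)"
  by (induction S rule: infinite_finite_induct) (auto intro: agree_upto_add agree_upto_refl)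

lemma agree_upto_full_W:
  assumes "agree_upto N b b'" "agree_upto N wm wm'" "agree_upto N wp wp'"
  shows "agree_upto N (full_W H b wm wp) (full_W H b' wm' wp')"
  unfolding full_W_def by (intro agree_upto_sum agree_upto_mult agree_upto_power assms)

definition const_ratfun :: "rat \<Rightarrow> rat poly fract" where
  "const_ratfun q = to_fract [:q:]"

lemma const_ratfun_mult: "const_ratfun (p * q) = const_ratfun p * const_ratfun q"
  unfolding const_ratfun_def to_fract_mult[symmetric] by simp

lemma const_ratfun_1: "const_ratfun 1 = 1"
  by (simp add: const_ratfun_def pCons_one)

lemma const_ratfun_0: "const_ratfun 0 = 0"
  by (simp add: const_ratfun_def)

lemma const_ratfun_sum: "const_ratfun (sum f A) = (\<Sum>x\<in>A. const_ratfun (f x))"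
proof -
  have "const_ratfun (p + q) = const_ratfun p + const_ratfun q" for p q
    unfolding const_ratfun_def to_fract_add[symmetric] by simp
  then show ?thesis
    by (induction A rule: infinite_finite_induct) (simp_all add: const_ratfun_0)
qed

lemma const_ratfun_prod: "const_ratfun (prod f A) = (\<Prod>x\<in>A. const_ratfun (f x))"
  by (induction A rule: infinite_finite_induct) (simp_all add: const_ratfun_1 const_ratfun_mult)

lemma to_fract_smult: "to_fract (smult q p) = const_ratfun q * to_fract p"
  unfolding const_ratfun_def to_fract_mult[symmetric] by simp

lemma to_fract_power: "to_fract (p ^ k) = to_fract p ^ k"
  by (induction k) simp_all

lemma to_fract_monom: "to_fract (monom q k) = const_ratfun q * t_var ^ k"
  by (simp add: monom_altdef to_fract_smult to_fract_power t_var_def)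

lemma t_var_nonzero: "t_var \<noteq> 0"
  by (simp add: t_var_def)

lemma to_fract_bw_poly: "to_fract (bw_poly G) = (\<Sum>c\<in>colorings G. t_var ^ card (white_even G c))"
  by (simp add: bw_poly_def to_fract_monom const_ratfun_1)

section \<open>Coefficients of the series of a core graph\<close>

lemma var_monomial_nth:
  "(var_b ^ x * var_wp ^ z * var_wm ^ y) $ i $ j $ k = (if i = x \<and> j = y \<and> k = z then 1 else 0)"
  by (auto simp: var_b_def var_wp_def var_wm_def fps_X_power_mult_nth fps_mult_right_const_nth
      fps_X_power_mult_right_nth mult.assoc)

lemma full_W_var_nth:
  "full_W H var_b var_wm var_wp $ i $ j $ k = (\<Sum>c\<in>colorings H.
     if i = card (black H c) \<and> j = card (white_odd H c) \<and> k = card (white_even H c) then 1 else 0)"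
  unfolding full_W_def by (simp add: fps_sum_nth var_monomial_nth)

text \<open>This makes \<open>full_W\<close> homogeneous of degree the number of vertices, so a
  coefficient of \<open>Z_series\<close> sees only subdivisions of one size.\<close>

lemma card_color_classes:
  assumes "finite_graph H" "c \<in> colorings H"
  shows "card (black H c) + card (white_odd H c) + card (white_even H c) = card (verts H)"
proof -
  have fin: "finite (verts H)" using finite_graphD(1)[OF assms(1)] .
  have "verts H = black H c \<union> (white_odd H c \<union> white_even H c)"
    using assms(2) by (auto simp: black_def white_odd_def white_even_def colorings_def PiE_def Pi_def)
  also have "card \<dots> = card (black H c) + card (white_odd H c \<union> white_even H c)"
    using fin by (intro card_Un_disjoint) (auto simp: black_def white_odd_def white_even_def)
  also have "card (white_odd H c \<union> white_even H c) = card (white_odd H c) + card (white_even H c)"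
    using fin by (intro card_Un_disjoint) (auto simp: white_odd_def white_even_def)
  finally show ?thesis by simp
qed

definition tuples_upto :: "('v, 'h) graph \<Rightarrow> nat \<Rightarrow> ('h set \<Rightarrow> nat) set" where
  "tuples_upto G M = {n \<in> edges G \<rightarrow>\<^sub>E UNIV. (\<Sum>e\<in>edges G. n e) \<le> M}"

lemma finite_tuples_upto:
  assumes "finite_graph G"
  shows "finite (tuples_upto G M)"
proof (rule finite_subset)
  have E: "finite (edges G)" using finite_graphD(2)[OF assms] by (simp add: edges_def)
  show "finite (edges G \<rightarrow>\<^sub>E {..M})" using E by (intro finite_PiE) auto
  have "n e \<le> M" if "(\<Sum>e\<in>edges G. n e) \<le> M" "e \<in> edges G" for n :: "'b set \<Rightarrow> nat" and e
    using member_le_sum[OF that(2) _ E, of n] that(1) by simp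
  then show "tuples_upto G M \<subseteq> edges G \<rightarrow>\<^sub>E {..M}"
    unfolding tuples_upto_def PiE_def by auto
qed

lemma sum_tuples_upto:
  assumes "finite_graph G"
  shows "(\<Sum>m\<le>M. \<Sum>n\<in>subdiv_tuples G m. f n) = (\<Sum>n\<in>tuples_upto G M. f n)"
proof -
  have "(\<Sum>m\<le>M. \<Sum>n\<in>subdiv_tuples G m. f n) =
      (\<Sum>m\<le>M. \<Sum>n\<in>{n \<in> tuples_upto G M. (\<Sum>e\<in>edges G. n e) = m}. f n)"
    by (intro sum.cong refl) (auto simp: subdiv_tuples_def tuples_upto_def)
  also have "\<dots> = (\<Sum>n\<in>tuples_upto G M. f n)"
    by (intro sum.group finite_tuples_upto assms) (auto simp: tuples_upto_def)
  finally show ?thesis .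
qed

text \<open>The \<open>i\<close>-th power of a series without constant term starts at order
  \<open>i\<close> or later, and further factors cannot lower the order.\<close>

lemma power_product_nth_eq_0:
  fixes b wm wp :: "'a::comm_ring_1 fps"
  assumes "b $ 0 = 0" "wm $ 0 = 0" "wp $ 0 = 0" and "N < i \<or> N < j \<or> N < k"
  shows "(b ^ i * wm ^ j * wp ^ k) $ N = 0"
proof -
  have z: "(A * B) $ m = 0" if "\<forall>l\<le>m. A $ l = 0 \<or> (\<forall>l\<le>m. B $ l = 0)" for A B :: "'a fps" and m
    unfolding fps_mult_nth by (rule sum.neutral) (use that in auto)
  have p: "(A ^ i) $ l = 0" if "A $ 0 = 0" "l < i" for A :: "'a fps" and l i
    using startsby_zero_power_prefix[OF that(1)] that(2) by blast
  show ?thesis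
    using assms(4)
  proof (elim disjE)
    assume "N < i"
    then show ?thesis using p[OF assms(1)] by (intro z) (auto intro!: z)
  next
    assume "N < j"
    then have "(b ^ i * wm ^ j) $ l = 0" if "l \<le> N" for l
      using p[OF assms(2)] that by (intro z) auto
    then show ?thesis by (intro z) auto
  next
    assume "N < k"
    then show ?thesis using p[OF assms(3)] by (intro z) auto
  qed
qed

text \<open>Exponents above \<open>N\<close> are invisible at \<open>x ^ N\<close>, because the
  substituted series have no constant term, and exponents up to \<open>N\<close> occur only for
  bounded \<open>n\<close>. So the truncated sum over \<open>n\<close>, with all colorings, gives
  the coefficient.\<close>

lemma fps3_subst_Z_series:
  assumes G: "finite_graph G" and z: "b $ 0 = 0" "wm $ 0 = 0" "wp $ 0 = 0"
  shows "fps3_subst (Z_series G) b wm wp $ N =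
    const_ratfun (1 / of_nat (card (Aut G))) *
      (\<Sum>n\<in>tuples_upto G (3 * N). full_W (subdivide G n) b wm wp $ N)"
proof -
  let ?A = "tuples_upto G (3 * N)" and ?q = "1 / of_nat (card (Aut G)) :: rat"
  let ?P = "Sigma ?A (\<lambda>n. colorings (subdivide G n))"
  let ?k = "\<lambda>(n, c). (card (black (subdivide G n) c), card (white_odd (subdivide G n) c), card (white_even (subdivide G n) c))"
  let ?Q = "{..N} \<times> {..N} \<times> {..N}"
  let ?F = "\<lambda>(i, j, k). (b ^ i * wm ^ j * wp ^ k) $ N"
  have fc: "finite (colorings (subdivide G n))" for n
    using finite_colorings[OF finite_graph_subdivide[OF G]] .
  have fP: "finite ?P" using finite_tuples_upto[OF G] fc by auto
  have Z: "Z_series G $ i $ j $ k = ?q * (\<Sum>p\<in>?P. if (i, j, k) = ?k p then 1 else 0)"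
    if ijk: "i \<le> N" "j \<le> N" "k \<le> N" for i j k
  proof -
    let ?g = "\<lambda>m. (\<Sum>n\<in>subdiv_tuples G m. full_W (subdivide G n) var_b var_wm var_wp) $ i $ j $ k"
    have g: "?g m = (\<Sum>n\<in>subdiv_tuples G m. \<Sum>c\<in>colorings (subdivide G n). if (i, j, k) = ?k (n, c) then 1 else 0)" for m
      by (simp add: fps_sum_nth full_W_var_nth)
    \<comment> \<open>By homogeneity \<open>i + j + k\<close> would have to be the number of
      vertices of the subdivision, which is at least \<open>m\<close>, while it is at most
      \<open>3 * N\<close>.\<close>
    have "?g m = 0" if m: "3 * N < m" for m
      unfolding g
    proof (intro sum.neutral ballI)
      fix n c assume n: "n \<in> subdiv_tuples G m" and c: "c \<in> colorings (subdivide G n)"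
      have "card (verts (subdivide G n)) = card (verts G) + m"
        using n card_verts_subdivide[OF G, of n] by (simp add: subdiv_tuples_def)
      then show "(if (i, j, k) = ?k (n, c) then 1 else 0 :: rat) = 0"
        using card_color_classes[OF finite_graph_subdivide[OF G] c] m ijk by auto
    qed
    then have "{m. ?g m \<noteq> 0} \<subseteq> {..3 * N}"
      by (metis (mono_tags, lifting) atMost_iff mem_Collect_eq not_le subsetI)
    then have "Sum_any ?g = (\<Sum>m\<le>3 * N. ?g m)"
      by (intro Sum_any.expand_superset) auto
    also have "\<dots> = (\<Sum>n\<in>?A. \<Sum>c\<in>colorings (subdivide G n). if (i, j, k) = ?k (n, c) then 1 else 0)"
      unfolding g by (rule sum_tuples_upto[OF G])
    also have "\<dots> = (\<Sum>p\<in>?P. if (i, j, k) = ?k p then 1 else 0)"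
      using sum.Sigma[of ?A "\<lambda>n. colorings (subdivide G n)"
          "\<lambda>n c. if (i, j, k) = ?k (n, c) then 1 else 0 :: rat"] finite_tuples_upto[OF G] fc
      by (simp add: case_prod_beta)
    finally show ?thesis by (simp add: Z_series_def)
  qed
  have "fps3_subst (Z_series G) b wm wp $ N =
      (\<Sum>i\<le>N. \<Sum>j\<le>N. \<Sum>k\<le>N. const_ratfun (Z_series G $ i $ j $ k) * ?F (i, j, k))"
    by (simp add: fps3_subst_def const_ratfun_def)
  also have "\<dots> = (\<Sum>(i, j, k)\<in>?Q. const_ratfun (Z_series G $ i $ j $ k) * ?F (i, j, k))"
    by (simp add: sum.cartesian_product)
  also have "\<dots> = (\<Sum>x\<in>?Q. \<Sum>p\<in>?P. const_ratfun ?q * (if x = ?k p then ?F x else 0))"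
  proof (rule sum.cong[OF refl])
    fix x assume x: "x \<in> ?Q"
    obtain i j k where [simp]: "x = (i, j, k)" by (cases x)
    have "const_ratfun (Z_series G $ i $ j $ k) * ?F x =
        (\<Sum>p\<in>?P. const_ratfun ?q * const_ratfun (if x = ?k p then 1 else 0)) * ?F x"
      using Z[of i j k] x unfolding const_ratfun_sum[symmetric] const_ratfun_mult[symmetric] sum_distrib_left by simp
    also have "\<dots> = (\<Sum>p\<in>?P. const_ratfun ?q * (if x = ?k p then ?F x else 0))"
    proof -
      have "u * const_ratfun (if Q then 1 else 0) * v = u * (if Q then v else 0)" for u v Q
        by (simp add: const_ratfun_1 const_ratfun_0)
      then show ?thesis unfolding sum_distrib_right by (intro sum.cong refl)
    qed
    finally show "(case x of (i, j, k) \<Rightarrow> const_ratfun (Z_series G $ i $ j $ k) * ?F (i, j, k)) = \<dots>"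
      by simp
  qed
  also have "\<dots> = (\<Sum>p\<in>?P. \<Sum>x\<in>?Q. const_ratfun ?q * (if x = ?k p then ?F x else 0))"
    by (rule sum.swap)
  also have "\<dots> = const_ratfun ?q * (\<Sum>p\<in>?P. \<Sum>x\<in>?Q. if x = ?k p then ?F x else 0)"
    by (simp only: sum_distrib_left)
  \<comment> \<open>Colorings whose exponents leave the cube are absent on the left, and their
    monomials vanish at \<open>N\<close> on the right.\<close>
  also have "(\<Sum>p\<in>?P. \<Sum>x\<in>?Q. if x = ?k p then ?F x else 0) = (\<Sum>p\<in>?P. ?F (?k p))"
  proof (rule sum.cong[OF refl])
    fix p
    have "?F (?k p) = 0" if "?k p \<notin> ?Q"
    proof -
      obtain i j k where k: "?k p = (i, j, k)" by (cases "?k p")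
      then have "N < i \<or> N < j \<or> N < k" using that by auto
      then show ?thesis unfolding k using power_product_nth_eq_0[OF z] by simp
    qed
    moreover have "finite ?Q" by simp
    ultimately show "(\<Sum>x\<in>?Q. if x = ?k p then ?F x else 0) = ?F (?k p)"
      by (subst sum.delta) auto
  qed
  also have "\<dots> = (\<Sum>n\<in>?A. \<Sum>c\<in>colorings (subdivide G n). ?F (?k (n, c)))"
    using sum.Sigma[of ?A "\<lambda>n. colorings (subdivide G n)" "\<lambda>n c. ?F (?k (n, c))"] finite_tuples_upto[OF G] fc
    by (simp add: case_prod_beta)
  also have "\<dots> = (\<Sum>n\<in>?A. full_W (subdivide G n) b wm wp $ N)"
    by (simp add: full_W_def fps_sum_nth mult.assoc mult.commute[of "wp ^ _"])
  finally show ?thesis .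
qed

section \<open>Representatives of isomorphism classes\<close>

lemma quotient_rep:
  assumes "equiv A r" "B \<subseteq> A" "C \<in> B // r"
  shows "\<exists>x\<in>B. (x, rep C) \<in> r" "C = r `` {rep C}"
proof -
  obtain x where x: "x \<in> B" "C = r `` {x}" using assms(3) by (rule quotientE)
  then have "x \<in> C" using assms(1,2) equiv_class_self by fast
  then have "rep C \<in> C" unfolding rep_def by (rule someI)
  then have *: "(x, rep C) \<in> r" using x by simp
  then show "\<exists>x\<in>B. (x, rep C) \<in> r" using x by blast
  show "C = r `` {rep C}" using equiv_class_eq[OF assms(1) *] x by simp
qed

lemma quotient_rep_eqI:
  assumes "equiv A r" "B \<subseteq> A" "C \<in> B // r" "C' \<in> B // r" "(rep C, rep C') \<in> r"
  shows "C = C'"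
  using quotient_rep(2)[OF assms(1-3)] quotient_rep(2)[OF assms(1,2,4)] equiv_class_eq[OF assms(1,5)]
  by simp

text \<open>A class of bounded size contains a standard graph of bounded size, and there are
  finitely many of these.\<close>

lemma finite_iso_classes:
  assumes "B \<subseteq> {G. finite_graph G}"
  shows "finite {C \<in> B // iso_rel. card (verts (rep C)) \<le> a \<and> card (darts (rep C)) \<le> b}"
proof (rule finite_subset)
  let ?S = "\<Union>n\<le>a. \<Union>d\<le>b. std_graphs n d"
  show "finite ((\<lambda>K. iso_rel `` {K}) ` ?S)" by (auto intro: finite_std_graphs)
  show "{C \<in> B // iso_rel. card (verts (rep C)) \<le> a \<and> card (darts (rep C)) \<le> b} \<subseteq> (\<lambda>K. iso_rel `` {K}) ` ?S"
  proof clarify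
    fix C assume C: "C \<in> B // iso_rel" "card (verts (rep C)) \<le> a" "card (darts (rep C)) \<le> b"
    note q = quotient_rep[OF iso_rel_equiv assms C(1)]
    have f: "finite_graph (rep C)" using q(1) by (auto simp: iso_rel_def)
    obtain K \<sigma> \<pi> where K: "K \<in> std_graphs (card (verts (rep C))) (card (darts (rep C)))" "finite_graph K"
      "(\<sigma>, \<pi>) \<in> graph_isos (rep C) K" by (rule std_graph_copy[OF f])
    then have "(rep C, K) \<in> iso_rel" using f by (auto simp: iso_rel_def)
    then have "C = iso_rel `` {K}" using q(2) equiv_class_eq[OF iso_rel_equiv] by metis
    moreover have "K \<in> ?S" using K(1) C(2,3) by blast
    ultimately show "C \<in> (\<lambda>K. iso_rel `` {K}) ` ?S" by blast
  qed
qed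

lemma verts_std_graph: "K \<in> std_graphs n d \<Longrightarrow> verts K = {..<n}"
  unfolding std_graphs_def by (elim imageE) (simp add: case_prod_beta)

lemma rooted_iso_relI:
  assumes "(T, r) \<in> rooted_trees" "(T', r') \<in> rooted_trees" "(\<sigma>, \<pi>) \<in> graph_isos T T'" "\<sigma> r = r'"
  shows "((T, r), (T', r')) \<in> rooted_iso_rel"
proof -
  have "\<exists>(\<sigma>, \<pi>) \<in> graph_isos T T'. \<sigma> r = r'"
    using assms(3,4) by (intro bexI[of _ "(\<sigma>, \<pi>)"]) simp_all
  with assms(1,2) show ?thesis by (simp add: rooted_iso_rel_def)
qed

lemma rooted_iso_rel_equiv: "equiv rooted_trees rooted_iso_rel"
proof (rule equivI)
  show "rooted_iso_rel \<subseteq> rooted_trees \<times> rooted_trees" by (auto simp: rooted_iso_rel_def)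
  show "refl_on rooted_trees rooted_iso_rel"
  proof (rule refl_onI)
    fix x assume x: "x \<in> rooted_trees"
    obtain T r where "x = (T, r)" by (cases x)
    then show "(x, x) \<in> rooted_iso_rel"
      using x rooted_iso_relI[of T r T r id id] graph_isos_refl[of T] by simp
  qed
  show "sym rooted_iso_rel"
  proof (rule symI)
    fix x y assume xy: "(x, y) \<in> rooted_iso_rel"
    obtain T r T' r' where [simp]: "x = (T, r)" "y = (T', r')" by (cases x, cases y)
    obtain \<sigma> \<pi> where i: "(\<sigma>, \<pi>) \<in> graph_isos T T'" "\<sigma> r = r'"
      and t: "(T, r) \<in> rooted_trees" "(T', r') \<in> rooted_trees"
      using xy by (auto simp: rooted_iso_rel_def)
    have "inv_into (verts T) \<sigma> r' = r"
      using i(2) rooted_treesD(3)[OF t(1)] bij_betw_inv_into_left[OF graph_isosD(1)[OF i(1)]] by auto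
    then show "(y, x) \<in> rooted_iso_rel"
      using rooted_iso_relI[OF t(2,1) graph_isos_inv[OF _ i(1)]] rooted_treesD(1)[OF t(1)] by simp
  qed
  show "trans rooted_iso_rel"
  proof (rule transI)
    fix x y z assume xy: "(x, y) \<in> rooted_iso_rel" "(y, z) \<in> rooted_iso_rel"
    obtain T r T' r' T'' r'' where [simp]: "x = (T, r)" "y = (T', r')" "z = (T'', r'')"
      by (cases x, cases y, cases z)
    obtain \<sigma> \<pi> \<sigma>' \<pi>' where i: "(\<sigma>, \<pi>) \<in> graph_isos T T'" "\<sigma> r = r'"
        "(\<sigma>', \<pi>') \<in> graph_isos T' T''" "\<sigma>' r' = r''"
      and t: "(T, r) \<in> rooted_trees" "(T'', r'') \<in> rooted_trees"
      using xy by (auto simp: rooted_iso_rel_def)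
    show "(x, z) \<in> rooted_iso_rel"
      using rooted_iso_relI[OF t graph_isos_comp[OF i(1,3)]] i(2,4) by simp
  qed
qed

lemma rooted_isos_nonempty_iff:
  assumes "\<tau> \<in> rooted_trees" "\<tau>' \<in> rooted_trees"
  shows "rooted_isos \<tau> \<tau>' \<noteq> {} \<longleftrightarrow> (\<tau>, \<tau>') \<in> rooted_iso_rel"
proof
  assume "rooted_isos \<tau> \<tau>' \<noteq> {}"
  then obtain \<sigma> \<pi> where "(\<sigma>, \<pi>) \<in> rooted_isos \<tau> \<tau>'" by auto
  then have "(\<sigma>, \<pi>) \<in> graph_isos (fst \<tau>) (fst \<tau>')" "\<sigma> (snd \<tau>) = snd \<tau>'"
    by (auto simp: marked_isos_iff)
  then show "(\<tau>, \<tau>') \<in> rooted_iso_rel"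
    using assms rooted_iso_relI[of "fst \<tau>" "snd \<tau>" "fst \<tau>'" "snd \<tau>'"] by simp
next
  assume "(\<tau>, \<tau>') \<in> rooted_iso_rel"
  then obtain \<sigma> \<pi> where "(\<sigma>, \<pi>) \<in> graph_isos (fst \<tau>) (fst \<tau>')" "\<sigma> (snd \<tau>) = snd \<tau>'"
    by (auto simp: rooted_iso_rel_def)
  then have "(restrict \<sigma> (verts (fst \<tau>)), restrict \<pi> (darts (fst \<tau>))) \<in> rooted_isos \<tau> \<tau>'"
    using rooted_treesD[OF assms(1)] by (intro restrict_marked_isos) auto
  then show "rooted_isos \<tau> \<tau>' \<noteq> {}" by blast
qed

section \<open>Representative trees of bounded size\<close>

definition small_tree_classes :: "nat \<Rightarrow> (ngraph \<times> nat) set set" where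
  "small_tree_classes N = {C \<in> rooted_trees // rooted_iso_rel. card (verts (fst (rep C))) \<le> N}"

abbreviation small_trees :: "nat \<Rightarrow> (ngraph \<times> nat) set" where
  "small_trees N \<equiv> rep ` small_tree_classes N"

lemma rep_rooted_tree:
  assumes "C \<in> rooted_trees // rooted_iso_rel"
  shows "rep C \<in> rooted_trees"
proof -
  obtain x where "(x, rep C) \<in> rooted_iso_rel"
    using quotient_rep(1)[OF rooted_iso_rel_equiv order_refl assms] by blast
  then show ?thesis unfolding rooted_iso_rel_def by (cases "rep C") auto
qed

lemma small_trees_subset: "small_trees N \<subseteq> rooted_trees"
  using rep_rooted_tree by (auto simp: small_tree_classes_def)

lemma finite_small_tree_classes: "finite (small_tree_classes N)"
proof (rule finite_subset)
  \<comment> \<open>A tree with at most \<open>N\<close> vertices has fewer than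
    \<open>2 * N\<close> darts, and the root of a standard copy is a number below
    \<open>N\<close>.\<close>
  let ?S = "(\<Union>n\<le>N. \<Union>d\<le>2 * N. std_graphs n d) \<times> {..<N}"
  show "finite ((\<lambda>p. rooted_iso_rel `` {p}) ` ?S)"
    by (intro finite_imageI finite_cartesian_product finite_UN_I finite_atMost finite_lessThan finite_std_graphs)
  show "small_tree_classes N \<subseteq> (\<lambda>p. rooted_iso_rel `` {p}) ` ?S"
  proof
    fix C assume "C \<in> small_tree_classes N"
    then have C: "C \<in> rooted_trees // rooted_iso_rel" and n: "card (verts (fst (rep C))) \<le> N"
      by (auto simp: small_tree_classes_def)
    note \<tau> = rep_rooted_tree[OF C] and q = quotient_rep[OF rooted_iso_rel_equiv order_refl C]
    note t = rooted_treesD[OF \<tau>]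
    obtain K \<sigma> \<pi> where K: "K \<in> std_graphs (card (verts (fst (rep C)))) (card (darts (fst (rep C))))"
      "finite_graph K" "(\<sigma>, \<pi>) \<in> graph_isos (fst (rep C)) K" by (rule std_graph_copy[OF t(1)])
    let ?r = "\<sigma> (snd (rep C))"
    have ne: "graph_isos (fst (rep C)) K \<noteq> {}" using K(3) by blast
    have r: "?r \<in> verts K" using graph_isosD(5)[OF K(3)] t(3) by blast
    have b: "betti K = 0" using graph_isos_betti[OF t(1) K(2) ne] \<tau> by (auto simp: rooted_trees_def)
    have Kt: "(K, ?r) \<in> rooted_trees"
      using graph_isos_connected[OF t(1) K(2) t(2) ne] K(2) r b by (simp add: rooted_trees_def)
    have "(rep C, (K, ?r)) \<in> rooted_iso_rel"
      using rooted_iso_relI[of "fst (rep C)" "snd (rep C)" K ?r \<sigma> \<pi>] \<tau> Kt K(3) by simp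
    from equiv_class_eq[OF rooted_iso_rel_equiv this] have "C = rooted_iso_rel `` {(K, ?r)}"
      using q(2) by (rule trans[rotated])
    moreover have "?r < N"
      using r n unfolding verts_std_graph[OF K(1)] by simp
    moreover have "card (darts (fst (rep C))) \<le> 2 * N" using t(4) n by simp
    then have "K \<in> (\<Union>n\<le>N. \<Union>d\<le>2 * N. std_graphs n d)"
      using K(1) n by (intro UN_I) simp_all
    ultimately show "C \<in> (\<lambda>p. rooted_iso_rel `` {p}) ` ?S"
      by (intro image_eqI[where x = "(K, ?r)"]) simp_all
  qed
qed

text \<open>Each class has a single chosen representative, and the size bound is invariant under
  isomorphism, so the truncation loses no small tree.\<close>

lemma ex1_small_tree:
  assumes \<tau>: "\<tau> \<in> rooted_trees" "card (verts (fst \<tau>)) \<le> N"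
  shows "\<exists>!\<tau>'. \<tau>' \<in> small_trees N \<and> rooted_isos \<tau>' \<tau> \<noteq> {}"
proof -
  let ?C = "rooted_iso_rel `` {\<tau>}"
  have C: "?C \<in> rooted_trees // rooted_iso_rel" using \<tau>(1) by (rule quotientI)
  note rC = rep_rooted_tree[OF C]
  have "\<tau> \<in> ?C" using equiv_class_self[OF rooted_iso_rel_equiv \<tau>(1)] .
  then have r: "(rep ?C, \<tau>) \<in> rooted_iso_rel"
    using quotient_rep(2)[OF rooted_iso_rel_equiv order_refl C] by blast
  then have "graph_isos (fst (rep ?C)) (fst \<tau>) \<noteq> {}" by (auto simp: rooted_iso_rel_def)
  then have "card (verts (fst (rep ?C))) = card (verts (fst \<tau>))" by (rule graph_isos_cards(1))
  then have small: "?C \<in> small_tree_classes N"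
    using C \<tau>(2) by (simp add: small_tree_classes_def)
  have only: "\<tau>' = rep ?C" if \<tau>': "\<tau>' \<in> small_trees N" "rooted_isos \<tau>' \<tau> \<noteq> {}" for \<tau>'
  proof -
    obtain C' where C': "\<tau>' = rep C'" "C' \<in> rooted_trees // rooted_iso_rel"
      using \<tau>'(1) by (auto simp: small_tree_classes_def)
    have "(\<tau>', \<tau>) \<in> rooted_iso_rel"
      using rooted_isos_nonempty_iff \<tau>' \<tau>(1) small_trees_subset by blast
    then have "(rep C', rep ?C) \<in> rooted_iso_rel"
      using r C'(1) rooted_iso_rel_equiv by (meson equivE symD transD)
    then show ?thesis
      using quotient_rep_eqI[OF rooted_iso_rel_equiv order_refl C'(2) C] C'(1) by simp
  qed
  have "rooted_isos (rep ?C) \<tau> \<noteq> {}"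
    using r by (rule rooted_isos_nonempty_iff[OF rC \<tau>(1), THEN iffD2])
  then show ?thesis
    by (intro ex1I[of _ "rep ?C"]) (use small only in simp_all)
qed

definition tree_weight :: "ngraph \<times> nat \<Rightarrow> rat" where
  "tree_weight \<tau> = 1 / of_nat (card (root_Aut (fst \<tau>) (snd \<tau>)))"

text \<open>A tree with more than \<open>N\<close> vertices contributes only to coefficients beyond
  \<open>N\<close>.\<close>

lemma tree_series_agree:
  "agree_upto N (fps_to_ratfun (tree_series P))
     (tree_poly (\<lambda>\<tau>. const_ratfun (tree_weight \<tau>)) t_var (small_trees N) P)"
  unfolding agree_upto_def
proof (intro allI impI)
  fix m assume m: "m \<le> N"
  let ?v = "\<lambda>\<tau>. \<Sum>d\<in>{d \<in> colorings (fst \<tau>). P (fst \<tau>) (snd \<tau>) d}.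
      const_ratfun (tree_weight \<tau>) * t_var ^ card (white_even (fst \<tau>) d)"
  have inj: "inj_on rep (small_tree_classes N)"
  proof (rule inj_onI)
    fix C C' assume "C \<in> small_tree_classes N" "C' \<in> small_tree_classes N" "rep C = rep C'"
    then show "C = C'"
      using quotient_rep(2)[OF rooted_iso_rel_equiv order_refl, of C]
        quotient_rep(2)[OF rooted_iso_rel_equiv order_refl, of C']
      by (simp add: small_tree_classes_def)
  qed
  have "tree_poly (\<lambda>\<tau>. const_ratfun (tree_weight \<tau>)) t_var (small_trees N) P $ m =
      (\<Sum>\<tau>\<in>small_trees N. if card (verts (fst \<tau>)) = m then ?v \<tau> else 0)"
    unfolding tree_poly_def fps_sum_nth
    by (intro sum.cong refl) (auto simp: fps_X_power_mult_right_nth intro!: sum.neutral)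
  also have "\<dots> = (\<Sum>C\<in>small_tree_classes N. if card (verts (fst (rep C))) = m then ?v (rep C) else 0)"
    by (rule sum.reindex_cong[OF inj refl refl])
  also have "\<dots> = (\<Sum>C\<in>{C \<in> small_tree_classes N. card (verts (fst (rep C))) = m}. ?v (rep C))"
    using finite_small_tree_classes by (simp add: sum.inter_filter)
  also have "{C \<in> small_tree_classes N. card (verts (fst (rep C))) = m} =
      {C \<in> rooted_trees // rooted_iso_rel. card (verts (fst (rep C))) = m}"
    using m by (auto simp: small_tree_classes_def)
  also have "(\<Sum>C\<in>{C \<in> rooted_trees // rooted_iso_rel. card (verts (fst (rep C))) = m}. ?v (rep C)) =
      fps_to_ratfun (tree_series P) $ m"
    by (simp add: fps_to_ratfun_def tree_series_def case_prod_beta to_fract_monom tree_weight_def)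
  finally show "fps_to_ratfun (tree_series P) $ m =
    tree_poly (\<lambda>\<tau>. const_ratfun (tree_weight \<tau>)) t_var (small_trees N) P $ m" ..
qed

text \<open>A rooted tree has at least one vertex. The vanishing constant term is what makes
  \<open>fps3_subst\<close> the full substitution.\<close>

lemma tree_series_nth_0: "tree_series P $ 0 = 0"
proof -
  have "card (verts (fst (rep C))) \<noteq> 0" if "C \<in> rooted_trees // rooted_iso_rel" for C
    using finite_graphD(1)[OF rooted_treesD(1)[OF rep_rooted_tree[OF that]]]
      rooted_treesD(3)[OF rep_rooted_tree[OF that]] by auto
  then have none: "{C \<in> rooted_trees // rooted_iso_rel. card (verts (fst (rep C))) = 0} = {}" by blast
  show ?thesis unfolding tree_series_def fps_nth_Abs_fps none by simp
qed

section \<open>From coefficients of the substitution to classes of graphs\<close>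

definition graft_weight :: "ngraph \<Rightarrow> ((nat + (nat \<times> nat) set), nat \<times> nat) graph \<Rightarrow>
    (nat + (nat \<times> nat) set \<Rightarrow> ngraph \<times> nat) \<Rightarrow> rat" where
  "graft_weight G H T = 1 / of_nat (card (Aut G)) * (\<Prod>v\<in>verts H. tree_weight (T v))"

text \<open>Regrouping by grafts produces black-white polynomials, so \<open>inverse t_var\<close>
  leaves no trace and the coefficient is a polynomial in \<open>t\<close>.\<close>

lemma X_series_nth:
  assumes G: "finite_graph G"
  shows "X_series G $ N = to_fract (\<Sum>n\<in>tuples_upto G (3 * N).
    \<Sum>T\<in>verts (subdivide G n) \<rightarrow>\<^sub>E small_trees N.
      if card (verts (graft (subdivide G n) T)) = N
      then smult (graft_weight G (subdivide G n) T) (bw_poly (graft (subdivide G n) T)) else 0)"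
proof -
  let ?tp = "tree_poly (\<lambda>\<tau>. const_ratfun (tree_weight \<tau>)) t_var (small_trees N)"
  let ?b = "fps_to_ratfun T_black" and ?e = "fps_to_ratfun T_white_even" and ?o = "fps_to_ratfun T_white_odd"
  let ?b' = "?tp (\<lambda>T r c. c r = 1)" and ?e' = "?tp (\<lambda>T r c. c r = 0 \<and> even (black_nbrs T c r))"
    and ?o' = "?tp (\<lambda>T r c. c r = 0 \<and> odd (black_nbrs T c r))"
  have z: "?b $ 0 = 0" "?e $ 0 = 0" "?o $ 0 = 0"
    by (simp_all add: fps_to_ratfun_def T_black_def T_white_even_def T_white_odd_def tree_series_nth_0)
  have ag: "agree_upto N ?b ?b'" "agree_upto N ?e ?e'" "agree_upto N ?o ?o'"
    unfolding T_black_def T_white_even_def T_white_odd_def by (rule tree_series_agree)+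
  have W: "full_W (subdivide G n) ?b (fps_const (inverse t_var) * ?e + fps_const t_var * ?o) (?e + ?o) $ N =
      (\<Sum>T\<in>verts (subdivide G n) \<rightarrow>\<^sub>E small_trees N. if card (verts (graft (subdivide G n) T)) = N
        then const_ratfun (\<Prod>v\<in>verts (subdivide G n). tree_weight (T v)) * to_fract (bw_poly (graft (subdivide G n) T)) else 0)" for n
  proof -
    let ?S = "subdivide G n"
    have "agree_upto N (full_W ?S ?b (fps_const (inverse t_var) * ?e + fps_const t_var * ?o) (?e + ?o))
        (full_W ?S ?b' (fps_const (inverse t_var) * ?e' + fps_const t_var * ?o') (?e' + ?o'))"
      using ag by (intro agree_upto_full_W agree_upto_add agree_upto_mult agree_upto_refl)
    then have "full_W ?S ?b (fps_const (inverse t_var) * ?e + fps_const t_var * ?o) (?e + ?o) $ N =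
        full_W ?S ?b' (fps_const (inverse t_var) * ?e' + fps_const t_var * ?o') (?e' + ?o') $ N"
      by (simp add: agree_upto_def)
    also have "\<dots> = (\<Sum>T\<in>verts ?S \<rightarrow>\<^sub>E small_trees N. if card (verts (graft ?S T)) = N
        then const_ratfun (\<Prod>v\<in>verts ?S. tree_weight (T v)) * to_fract (bw_poly (graft ?S T)) else 0)"
      unfolding full_W_tree_poly[OF finite_graph_subdivide[OF G] finite_imageI[OF finite_small_tree_classes]
          small_trees_subset t_var_nonzero] fps_sum_nth to_fract_bw_poly const_ratfun_prod
      by (intro sum.cong refl) (auto simp: fps_X_power_mult_right_nth simp del: graft_simps subdivide_simps)
    finally show ?thesis .
  qed
  have "X_series G $ N = const_ratfun (1 / of_nat (card (Aut G))) * (\<Sum>n\<in>tuples_upto G (3 * N).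
      full_W (subdivide G n) ?b (fps_const (inverse t_var) * ?e + fps_const t_var * ?o) (?e + ?o) $ N)"
    unfolding X_series_def using z by (intro fps3_subst_Z_series G) simp_all
  also have "\<dots> = to_fract (\<Sum>n\<in>tuples_upto G (3 * N).
    \<Sum>T\<in>verts (subdivide G n) \<rightarrow>\<^sub>E small_trees N.
      if card (verts (graft (subdivide G n) T)) = N
      then smult (graft_weight G (subdivide G n) T) (bw_poly (graft (subdivide G n) T)) else 0)"
  proof -
    have gw: "const_ratfun (graft_weight G H T) =
        const_ratfun (1 / of_nat (card (Aut G))) * const_ratfun (\<Prod>v\<in>verts H. tree_weight (T v))" for H T
      by (simp only: graft_weight_def const_ratfun_mult)
    show ?thesis
      unfolding W to_fract_sum sum_distrib_left
      by (intro sum.cong refl) (simp add: to_fract_smult gw mult.assoc del: graft_simps subdivide_simps)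
  qed
  finally show ?thesis .
qed

lemma iso_rel_iff:
  "(G, H) \<in> iso_rel \<longleftrightarrow> finite_graph G \<and> finite_graph H \<and> graph_isos G H \<noteq> {}"
  by (simp add: iso_rel_def)

lemma smult_sum_right: "smult a (sum f S) = (\<Sum>x\<in>S. smult a (f x))"
  by (induction S rule: infinite_finite_induct) (simp_all add: smult_add_right)

lemma iso_classes_rep:
  assumes "D \<in> iso_classes g"
  shows "finite_graph (rep D)" "connected_graph (rep D)" "betti (rep D) = int g"
proof -
  let ?B = "{G. finite_graph G \<and> connected_graph G \<and> betti G = int g}"
  have "?B \<subseteq> {G. finite_graph G}" by auto
  from quotient_rep(1)[OF iso_rel_equiv this assms[unfolded iso_classes_def]]
  obtain G where G: "finite_graph G" "connected_graph G" "betti G = int g" "(G, rep D) \<in> iso_rel" by auto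
  then show f: "finite_graph (rep D)" by (simp add: iso_rel_iff)
  have ne: "graph_isos G (rep D) \<noteq> {}" using G by (simp add: iso_rel_iff)
  show "connected_graph (rep D)" using graph_isos_connected[OF G(1) f G(2) ne] .
  show "betti (rep D) = int g" using graph_isos_betti[OF G(1) f ne] G(3) by simp
qed

lemma iso_classes_ge3_rep:
  assumes "C \<in> iso_classes_ge3 g"
  shows "finite_graph (rep C)" "connected_graph (rep C)" "betti (rep C) = int g" "min_degree 3 (rep C)"
proof -
  let ?B = "{G. finite_graph G \<and> connected_graph G \<and> betti G = int g \<and> (\<forall>v\<in>verts G. 3 \<le> vertex_degree G v)}"
  have "?B \<subseteq> {G. finite_graph G}" by auto
  from quotient_rep(1)[OF iso_rel_equiv this assms[unfolded iso_classes_ge3_def]]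
  obtain G where G: "finite_graph G" "connected_graph G" "betti G = int g" "(G, rep C) \<in> iso_rel"
    and d: "\<forall>v\<in>verts G. 3 \<le> vertex_degree G v" by auto
  then show f: "finite_graph (rep C)" by (simp add: iso_rel_iff)
  have ne: "graph_isos G (rep C) \<noteq> {}" using G by (simp add: iso_rel_iff)
  show "connected_graph (rep C)" using graph_isos_connected[OF G(1) f G(2) ne] .
  show "betti (rep C) = int g" using graph_isos_betti[OF G(1) f ne] G(3) by simp
  obtain \<sigma> \<pi> where i: "(\<sigma>, \<pi>) \<in> graph_isos G (rep C)" using ne by auto
  show "min_degree 3 (rep C)"
    unfolding min_degree_def
  proof
    fix w assume "w \<in> verts (rep C)"
    then obtain v where "v \<in> verts G" "w = \<sigma> v"
      using bij_betw_imp_surj_on[OF graph_isosD(1)[OF i]] by blast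
    then show "3 \<le> vertex_degree (rep C) w" using d graph_isos_degree[OF G(1) i] by simp
  qed
qed

lemma finite_iso_classes_ge3: "finite (iso_classes_ge3 g)"
proof (rule finite_subset)
  let ?B = "{G. finite_graph G \<and> connected_graph G \<and> betti G = int g \<and> (\<forall>v\<in>verts G. 3 \<le> vertex_degree G v)}"
  \<comment> \<open>With \<open>V\<close> vertices and \<open>D\<close> darts,
    \<open>3 * V \<le> D\<close> and \<open>D = 2 * V + 2 * g - 2\<close> give
    \<open>V \<le> 2 * g - 2\<close> and \<open>D \<le> 6 * g - 6\<close>; the bounds are rounded up
    to avoid subtraction.\<close>
  show "finite {C \<in> ?B // iso_rel. card (verts (rep C)) \<le> 2 * g \<and> card (darts (rep C)) \<le> 6 * g}"
    by (rule finite_iso_classes) auto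
  have "card (verts (rep C)) \<le> 2 * g \<and> card (darts (rep C)) \<le> 6 * g" if "C \<in> iso_classes_ge3 g" for C
  proof -
    note r = iso_classes_ge3_rep[OF that]
    have "3 * card (verts (rep C)) \<le> (\<Sum>v\<in>verts (rep C). vertex_degree (rep C) v)"
      using sum_bounded_below[of "verts (rep C)" 3 "vertex_degree (rep C)"] r(4)
      by (simp add: min_degree_def mult.commute)
    then have "3 * card (verts (rep C)) \<le> card (darts (rep C))"
      using sum_vertex_degree[OF r(1)] by simp
    then show ?thesis
      using betti_iff[OF r(1), of "int g"] r(3) by linarith
  qed
  then show "iso_classes_ge3 g \<subseteq> {C \<in> ?B // iso_rel. card (verts (rep C)) \<le> 2 * g \<and> card (darts (rep C)) \<le> 6 * g}"
    by (auto simp: iso_classes_ge3_def)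
qed

lemma finite_iso_classes_card: "finite {D \<in> iso_classes g. card (verts (rep D)) = N}"
proof (rule finite_subset)
  let ?B = "{G. finite_graph G \<and> connected_graph G \<and> betti G = int g}"
  show "finite {C \<in> ?B // iso_rel. card (verts (rep C)) \<le> N \<and> card (darts (rep C)) \<le> 2 * (N + g)}"
    by (rule finite_iso_classes) auto
  have "card (darts (rep D)) \<le> 2 * (card (verts (rep D)) + g)" if "D \<in> iso_classes g" for D
  proof -
    note r = iso_classes_rep[OF that]
    show ?thesis using iffD1[OF betti_iff[OF r(1)] r(3)] by presburger
  qed
  then show "{D \<in> iso_classes g. card (verts (rep D)) = N} \<subseteq>
      {C \<in> ?B // iso_rel. card (verts (rep C)) \<le> N \<and> card (darts (rep C)) \<le> 2 * (N + g)}"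
    by (auto simp: iso_classes_def)
qed

text \<open>The quotient of \<open>card (isos K (rep D))\<close> by
  \<open>card (Aut (rep D))\<close> is 1 for the class of \<open>K\<close> and 0 for all others.
  Spreading \<open>bw_poly K\<close> over all classes allows the sums over decompositions and over
  classes to be exchanged.\<close>

lemma bw_poly_class_sum:
  assumes K: "finite_graph K" "connected_graph K" "betti K = int g"
  shows "(if card (verts K) = N then bw_poly K else 0) =
    (\<Sum>D\<in>{D \<in> iso_classes g. card (verts (rep D)) = N}.
      smult (of_nat (card (isos K (rep D))) / of_nat (card (Aut (rep D)))) (bw_poly (rep D)))"
    (is "_ = (\<Sum>D\<in>?D. ?f D)")
proof -
  let ?B = "{G. finite_graph G \<and> connected_graph G \<and> betti G = int g}"
  have f: "?f D = (if graph_isos K (rep D) \<noteq> {} then bw_poly K else 0)" if D: "D \<in> iso_classes g" for D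
  proof (cases "graph_isos K (rep D) = {}")
    case True
    then show ?thesis using card_isos[OF K(1) iso_classes_rep(1)[OF D]] by simp
  next
    case False
    note r = iso_classes_rep(1)[OF D]
    have "card (isos K (rep D)) = card (Aut (rep D))"
      using card_isos[OF K(1) r] card_Aut_cong[OF K(1) r False] False by simp
    then show ?thesis
      using False card_Aut_pos[OF r] bw_poly_cong[OF K(1) r False] by simp
  qed
  show ?thesis
  proof (cases "card (verts K) = N")
    case True
    \<comment> \<open>The type of \<open>K\<close> is arbitrary, so its class is named through a
      copy on the natural numbers.\<close>
    obtain K' \<sigma> \<pi> where K': "K' \<in> std_graphs (card (verts K)) (card (darts K))" "finite_graph K'"
      "(\<sigma>, \<pi>) \<in> graph_isos K K'" by (rule std_graph_copy[OF K(1)])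
    have ne: "graph_isos K K' \<noteq> {}" using K'(3) by blast
    have "K' \<in> ?B"
      using K' graph_isos_connected[OF K(1) K'(2) K(2) ne] graph_isos_betti[OF K(1) K'(2) ne] K(3) by simp
    then have D: "iso_rel `` {K'} \<in> iso_classes g" (is "?C \<in> _")
      unfolding iso_classes_def by (rule quotientI)
    have "(rep ?C, K') \<in> iso_rel"
      using quotient_rep(2)[OF iso_rel_equiv _ D[unfolded iso_classes_def]]
        equiv_class_self[OF iso_rel_equiv, of K'] K'(2) by blast
    then have i: "graph_isos (rep ?C) K' \<noteq> {}" by (simp add: iso_rel_iff)
    then have ne': "graph_isos K (rep ?C) \<noteq> {}"
      using graph_isos_trans[OF ne] graph_isos_sym[OF iso_classes_rep(1)[OF D]] by blast
    have C: "?C \<in> ?D" using D graph_isos_cards(1)[OF ne'] True by simp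
    have only: "D = ?C" if "D \<in> ?D" "graph_isos K (rep D) \<noteq> {}" for D
    proof -
      have D': "D \<in> iso_classes g" using that(1) by simp
      have "graph_isos (rep D) (rep ?C) \<noteq> {}"
        using graph_isos_trans[OF graph_isos_sym[OF K(1) that(2)] ne'] .
      then have "(rep D, rep ?C) \<in> iso_rel"
        using iso_classes_rep(1)[OF D'] iso_classes_rep(1)[OF D] by (simp add: iso_rel_iff)
      then show "D = ?C"
        using quotient_rep_eqI[OF iso_rel_equiv _ D'[unfolded iso_classes_def] D[unfolded iso_classes_def]]
        by blast
    qed
    have "(\<Sum>D\<in>?D. ?f D) = (\<Sum>D\<in>?D. if D = ?C then bw_poly K else 0)"
    proof (rule sum.cong[OF refl])
      fix D assume D1: "D \<in> ?D"
      then have D2: "D \<in> iso_classes g" by simp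
      have "graph_isos K (rep D) \<noteq> {} \<longleftrightarrow> D = ?C" using only[OF D1] ne' by blast
      then show "?f D = (if D = ?C then bw_poly K else 0)" unfolding f[OF D2] by (simp only:)
    qed
    also have "\<dots> = bw_poly K"
      using C finite_iso_classes_card by simp
    finally show ?thesis using True by simp
  next
    case False
    have "?f D = 0" if "D \<in> ?D" for D
    proof -
      have "graph_isos K (rep D) = {}"
        using that False graph_isos_cards(1)[of K "rep D"] by auto
      then show ?thesis using f[of D] that by simp
    qed
    then have "(\<Sum>D\<in>?D. ?f D) = 0"
      by (intro sum.neutral ballI)
    then show ?thesis using False by simp
  qed
qed

text \<open>One decomposition of \<open>K\<close> is fixed as the target. Summing over
  \<open>T\<close> leaves the isomorphisms from \<open>subdivide G n\<close> to
  \<open>subdivide G0 n0\<close>, summing over \<open>n\<close> those from \<open>G\<close> to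
  \<open>G0\<close>, and division by \<open>card (Aut G)\<close> leaves 1 for the class of
  \<open>G0\<close> alone.\<close>

lemma graft_mass:
  fixes K :: ngraph
  assumes K: "finite_graph K" "connected_graph K" "betti K = int g" and N: "card (verts K) = N" and g: "2 \<le> g"
  shows "(\<Sum>C\<in>iso_classes_ge3 g. \<Sum>n\<in>tuples_upto (rep C) (3 * N).
    \<Sum>T\<in>verts (subdivide (rep C) n) \<rightarrow>\<^sub>E small_trees N.
      graft_weight (rep C) (subdivide (rep C) n) T * of_nat (card (isos (graft (subdivide (rep C) n) T) K))) = 1"
proof -
  obtain H :: ngraph and T' where H: "finite_graph H" "connected_graph H" "min_degree 2 H"
    and T': "\<And>v. v \<in> verts H \<Longrightarrow> T' v \<in> rooted_trees" and iK: "graph_isos (graft H T') K \<noteq> {}"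
    using exists_graft[OF K(1,2)] K(3) g by auto
  note t' = rooted_treesD[OF T']
  have fg: "finite_graph (graft H T')" using t' by (intro finite_graph_graft H(1))
  have bH: "betti H = int g"
    using betti_graft[OF H(1) T'] graph_isos_betti[OF fg K(1) iK] K(3) by simp
  then obtain G0 :: ngraph and n0 where G0: "finite_graph G0" "min_degree 3 G0"
    and i0: "graph_isos (subdivide G0 n0) H \<noteq> {}"
    using exists_subdivision[OF H] g by auto
  note f0 = finite_graph_subdivide[OF G0(1), of n0]
  have G0': "connected_graph G0" "betti G0 = int g"
    using graph_isos_connected[OF H(1) f0 H(2) graph_isos_sym[OF f0 i0]] connected_subdivide[OF G0(1)]
      graph_isos_betti[OF f0 H(1) i0] betti_subdivide[OF G0(1), of n0] bH by auto
  have sizes: "(\<Sum>v\<in>verts H. card (verts (fst (T' v)))) = N"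
    using graph_isos_cards(1)[OF iK] card_verts_graft[OF H(1) t'(1)] N by simp
  \<comment> \<open>The truncations lose nothing: the trees and the tuple of the fixed decomposition
    stay within the bounds.\<close>
  have small: "card (verts (fst (T' v))) \<le> N" if "v \<in> verts H" for v
    using member_le_sum[OF that, of "\<lambda>v. card (verts (fst (T' v)))"] sizes finite_graphD(1)[OF H(1)] by simp
  have "1 \<le> card (verts (fst (T' v)))" if "v \<in> verts H" for v
    using t'(3)[OF that] finite_graphD(1)[OF t'(1)[OF that]] by (simp add: Suc_le_eq card_gt_0_iff) blast
  then have "card (verts H) \<le> N"
    using sum_mono[of "verts H" "\<lambda>_. 1" "\<lambda>v. card (verts (fst (T' v)))"] sizes by simp
  then have n0: "(\<Sum>e\<in>edges G0. n0 e) \<le> 3 * N"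
    using graph_isos_cards(1)[OF i0] card_verts_subdivide[OF G0(1), of n0] by simp
  obtain \<alpha> \<beta> where iK': "(\<alpha>, \<beta>) \<in> graph_isos (graft H T') K" using iK by auto
  obtain \<alpha>0 \<beta>0 where i0': "(\<alpha>0, \<beta>0) \<in> graph_isos (subdivide G0 n0) H" using i0 by auto
  have inner: "(\<Sum>T\<in>verts (subdivide G n) \<rightarrow>\<^sub>E small_trees N.
      graft_weight G (subdivide G n) T * of_nat (card (isos (graft (subdivide G n) T) K))) =
      of_nat (card (isos (subdivide G n) (subdivide G0 n0))) / of_nat (card (Aut G))"
    if G: "finite_graph G" "min_degree 3 G" for G :: ngraph and n
  proof -
    let ?S = "subdivide G n"
    note fS = finite_graph_subdivide[OF G(1), of n]
    have "(\<Sum>T\<in>verts ?S \<rightarrow>\<^sub>E small_trees N. graft_weight G ?S T * of_nat (card (isos (graft ?S T) K))) =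
        (\<Sum>T\<in>verts ?S \<rightarrow>\<^sub>E small_trees N. of_nat (card (isos (graft ?S T) (graft H T'))) /
          (\<Prod>v\<in>verts ?S. of_nat (card (root_Aut (fst (T v)) (snd (T v)))))) / of_nat (card (Aut G))"
      unfolding sum_divide_distrib
    proof (rule sum.cong[OF refl])
      fix T assume T: "T \<in> verts ?S \<rightarrow>\<^sub>E small_trees N"
      have rt: "T v \<in> rooted_trees" if "v \<in> verts ?S" for v
        using PiE_mem[OF T that] small_trees_subset by blast
      have fT: "finite_graph (graft ?S T)"
        using rooted_treesD[OF rt] by (intro finite_graph_graft fS)
      have "card (isos (graft ?S T) (graft H T')) = card (isos (graft ?S T) K)"
        by (rule card_marked_isos_target[OF fT fg K(1) _ _ iK']) auto
      moreover have "(\<Prod>v\<in>verts ?S. tree_weight (T v)) =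
          1 / (\<Prod>v\<in>verts ?S. of_nat (card (root_Aut (fst (T v)) (snd (T v)))))"
        unfolding tree_weight_def by (simp only: prod_dividef prod.neutral_const)
      ultimately show "graft_weight G ?S T * of_nat (card (isos (graft ?S T) K)) =
          of_nat (card (isos (graft ?S T) (graft H T'))) /
          (\<Prod>v\<in>verts ?S. of_nat (card (root_Aut (fst (T v)) (snd (T v))))) / of_nat (card (Aut G))"
        by (simp add: graft_weight_def del: graft_simps subdivide_simps)
    qed
    also have "\<dots> = of_nat (card (isos ?S H)) / of_nat (card (Aut G))"
    proof -
      have "(\<Sum>T\<in>verts ?S \<rightarrow>\<^sub>E small_trees N. of_nat (card (isos (graft ?S T) (graft H T'))) /
          (\<Prod>v\<in>verts ?S. of_nat (card (root_Aut (fst (T v)) (snd (T v)))))) = (of_nat (card (isos ?S H)) :: rat)"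
        using fS H(1) min_degree_subdivide[OF G] H(3) T' finite_imageI[OF finite_small_tree_classes] small_trees_subset
        by (rule sum_card_isos_graft) (assumption | rule ex1_small_tree[OF T' small])+
      then show ?thesis by (rule arg_cong)
    qed
    also have "card (isos ?S H) = card (isos ?S (subdivide G0 n0))"
      by (rule card_marked_isos_target[OF fS f0 H(1) _ _ i0', symmetric]) auto
    finally show ?thesis .
  qed
  have outer: "(\<Sum>n\<in>tuples_upto G (3 * N). card (isos (subdivide G n) (subdivide G0 n0))) = card (isos G G0)"
    if G: "finite_graph G" "min_degree 3 G" for G :: ngraph
  proof (rule sum_card_isos_subdivide[OF G(1) G0(1) G(2) G0(2) finite_tuples_upto[OF G(1)]])
    show "tuples_upto G (3 * N) \<subseteq> edges G \<rightarrow>\<^sub>E UNIV" by (auto simp: tuples_upto_def)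
    fix \<theta> assume "\<theta> \<in> isos G G0"
    then have i: "(fst \<theta>, snd \<theta>) \<in> graph_isos G G0" by (cases \<theta>) (simp add: marked_isos_iff)
    \<comment> \<open>The pulled-back tuple has the same total as \<open>n0\<close>, because both
      the subdivisions and the cores have equally many vertices.\<close>
    let ?n = "\<lambda>e\<in>edges G. n0 (snd \<theta> ` e)"
    have "?n {h, opp G h} = n0 {snd \<theta> h, opp G0 (snd \<theta> h)}" if "h \<in> darts G" for h
      using that graph_isosD(4)[OF i that] by (auto simp: edges_def)
    from subdivide_graph_isos[where n = ?n and n' = n0, OF G(1) i this]
    have "card (verts (subdivide G ?n)) = card (verts (subdivide G0 n0))"
      by (intro graph_isos_cards(1)) blast
    moreover have "card (verts G) = card (verts G0)" using i by (intro graph_isos_cards(1)) blast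
    ultimately have "(\<Sum>e\<in>edges G. ?n e) = (\<Sum>e\<in>edges G0. n0 e)"
      using card_verts_subdivide[OF G(1), of ?n] card_verts_subdivide[OF G0(1), of n0] by simp
    then show "?n \<in> tuples_upto G (3 * N)" using n0 by (auto simp: tuples_upto_def)
  qed
  let ?B = "{G. finite_graph G \<and> connected_graph G \<and> betti G = int g \<and> (\<forall>v\<in>verts G. 3 \<le> vertex_degree G v)}"
  let ?C = "iso_rel `` {G0}"
  have C0: "?C \<in> iso_classes_ge3 g"
    unfolding iso_classes_ge3_def using G0 G0' by (intro quotientI) (simp add: min_degree_def)
  have r0: "(rep ?C, G0) \<in> iso_rel"
    using quotient_rep(2)[OF iso_rel_equiv _ C0[unfolded iso_classes_ge3_def]]
      equiv_class_self[OF iso_rel_equiv, of G0] G0(1) by blast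
  have only: "C = ?C" if "C \<in> iso_classes_ge3 g" "graph_isos (rep C) G0 \<noteq> {}" for C
  proof -
    have "(rep C, G0) \<in> iso_rel"
      using that(2) iso_classes_ge3_rep(1)[OF that(1)] G0(1) by (simp add: iso_rel_iff)
    then have "(rep C, rep ?C) \<in> iso_rel" using r0 iso_rel_equiv by (meson equivE symD transD)
    then show ?thesis
      using quotient_rep_eqI[OF iso_rel_equiv _ that(1)[unfolded iso_classes_ge3_def]
          C0[unfolded iso_classes_ge3_def]] by blast
  qed
  have "(\<Sum>C\<in>iso_classes_ge3 g. \<Sum>n\<in>tuples_upto (rep C) (3 * N).
      \<Sum>T\<in>verts (subdivide (rep C) n) \<rightarrow>\<^sub>E small_trees N.
        graft_weight (rep C) (subdivide (rep C) n) T * of_nat (card (isos (graft (subdivide (rep C) n) T) K))) =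
      (\<Sum>C\<in>iso_classes_ge3 g. if C = ?C then 1 else (0 :: rat))"
  proof (rule sum.cong[OF refl])
    fix C assume C: "C \<in> iso_classes_ge3 g"
    note r = iso_classes_ge3_rep[OF C]
    have "(\<Sum>n\<in>tuples_upto (rep C) (3 * N). \<Sum>T\<in>verts (subdivide (rep C) n) \<rightarrow>\<^sub>E small_trees N.
        graft_weight (rep C) (subdivide (rep C) n) T * of_nat (card (isos (graft (subdivide (rep C) n) T) K))) =
      of_nat (card (isos (rep C) G0)) / of_nat (card (Aut (rep C)))"
      unfolding inner[OF r(1,4)] outer[OF r(1,4), symmetric] by (simp add: sum_divide_distrib)
    also have "\<dots> = (if C = ?C then 1 else 0)"
    proof (cases "graph_isos (rep C) G0 = {}")
      case True
      then show ?thesis using r0 by (auto simp: card_isos[OF r(1) G0(1)] iso_rel_iff)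
    next
      case False
      then have "card (isos (rep C) G0) = card (Aut (rep C))"
        using card_isos[OF r(1) G0(1)] by simp
      then show ?thesis using only[OF C False] card_Aut_pos[OF r(1)] by simp
    qed
    finally show "(\<Sum>n\<in>tuples_upto (rep C) (3 * N). \<Sum>T\<in>verts (subdivide (rep C) n) \<rightarrow>\<^sub>E small_trees N.
        graft_weight (rep C) (subdivide (rep C) n) T * of_nat (card (isos (graft (subdivide (rep C) n) T) K))) =
      (if C = ?C then 1 else 0)" .
  qed
  also have "\<dots> = 1" using C0 finite_iso_classes_ge3 by simp
  finally show ?thesis .
qed

text \<open>The equation is stated after the embedding into rational functions, where the
  substitution takes place. The second conjunct says that each summand comes from a series over
  polynomials in \<open>t\<close>, and finiteness keeps the sum from being 0 by convention.\<close>

theorem theorem4p16: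
  fixes g :: nat
  assumes "g \<ge> 2"
  shows "finite (iso_classes_ge3 g) \<and>
    (\<forall>C\<in>iso_classes_ge3 g. X_series (rep C) \<in> range fps_to_ratfun) \<and>
    fps_to_ratfun (W_series g) = (\<Sum>C\<in>iso_classes_ge3 g. X_series (rep C))"
proof (intro conjI ballI)
  show "finite (iso_classes_ge3 g)" by (rule finite_iso_classes_ge3)
  \<comment> \<open>The polynomial whose image is the coefficient of \<open>X_series (rep C)\<close>
    at \<open>N\<close>; with it the remaining computation takes place over polynomials.\<close>
  define p where "p C N = (\<Sum>n\<in>tuples_upto (rep C) (3 * N).
    \<Sum>T\<in>verts (subdivide (rep C) n) \<rightarrow>\<^sub>E small_trees N.
      if card (verts (graft (subdivide (rep C) n) T)) = N
      then smult (graft_weight (rep C) (subdivide (rep C) n) T) (bw_poly (graft (subdivide (rep C) n) T)) else 0)"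
    for C N
  have X: "X_series (rep C) $ N = to_fract (p C N)" if "C \<in> iso_classes_ge3 g" for C N
    unfolding p_def by (rule X_series_nth[OF iso_classes_ge3_rep(1)[OF that]])
  show "X_series (rep C) \<in> range fps_to_ratfun" if "C \<in> iso_classes_ge3 g" for C
    by (rule range_eqI[where x = "Abs_fps (p C)"]) (simp add: fps_eq_iff fps_to_ratfun_def X[OF that])
  show "fps_to_ratfun (W_series g) = (\<Sum>C\<in>iso_classes_ge3 g. X_series (rep C))"
  proof (rule fps_ext)
    fix N
    let ?D = "{D \<in> iso_classes g. card (verts (rep D)) = N}"
    let ?w = "\<lambda>C n T. graft_weight (rep C) (subdivide (rep C) n) T"
    let ?c = "\<lambda>C n T D. of_nat (card (isos (graft (subdivide (rep C) n) T) (rep D))) :: rat"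
    let ?a = "\<lambda>D. of_nat (card (Aut (rep D))) :: rat"
    \<comment> \<open>The polynomial of every graft is spread over the classes with \<open>N\<close>
      vertices, so that the class can become the outer summation index.\<close>
    have p: "p C N = (\<Sum>D\<in>?D. \<Sum>n\<in>tuples_upto (rep C) (3 * N).
        \<Sum>T\<in>verts (subdivide (rep C) n) \<rightarrow>\<^sub>E small_trees N.
          smult (?w C n T * ?c C n T D / ?a D) (bw_poly (rep D)))"
      if C: "C \<in> iso_classes_ge3 g" for C
    proof -
      note r = iso_classes_ge3_rep[OF C]
      have "p C N = (\<Sum>n\<in>tuples_upto (rep C) (3 * N).
          \<Sum>T\<in>verts (subdivide (rep C) n) \<rightarrow>\<^sub>E small_trees N. \<Sum>D\<in>?D.
          smult (?w C n T * ?c C n T D / ?a D) (bw_poly (rep D)))"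
        unfolding p_def
      proof (intro sum.cong refl)
        fix n T assume T: "T \<in> verts (subdivide (rep C) n) \<rightarrow>\<^sub>E small_trees N"
        let ?S = "subdivide (rep C) n"
        note fS = finite_graph_subdivide[OF r(1), of n]
        have rt: "T v \<in> rooted_trees" if "v \<in> verts ?S" for v
          using PiE_mem[OF T that] small_trees_subset by blast
        have "finite_graph (graft ?S T)"
          using rooted_treesD[OF rt] by (intro finite_graph_graft fS)
        moreover have "connected_graph (graft ?S T)"
          using r(1,2) rt connected_subdivide by (intro connected_graph_graft fS) blast+
        moreover have "betti (graft ?S T) = int g"
          using betti_graft[OF fS rt] betti_subdivide[OF r(1), of n] r(3) by simp
        ultimately have "(if card (verts (graft ?S T)) = N then bw_poly (graft ?S T) else 0) =
            (\<Sum>D\<in>?D. smult (?c C n T D / ?a D) (bw_poly (rep D)))"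
          by (rule bw_poly_class_sum)
        then have "smult (?w C n T) (if card (verts (graft ?S T)) = N then bw_poly (graft ?S T) else 0) =
            (\<Sum>D\<in>?D. smult (?w C n T * ?c C n T D / ?a D) (bw_poly (rep D)))"
          by (simp only: smult_sum_right smult_smult times_divide_eq_right)
        then show "(if card (verts (graft ?S T)) = N then smult (?w C n T) (bw_poly (graft ?S T)) else 0) =
            (\<Sum>D\<in>?D. smult (?w C n T * ?c C n T D / ?a D) (bw_poly (rep D)))"
          by (simp only: if_distrib[of "smult _"] smult_0_right)
      qed
      also have "\<dots> = (\<Sum>n\<in>tuples_upto (rep C) (3 * N). \<Sum>D\<in>?D.
          \<Sum>T\<in>verts (subdivide (rep C) n) \<rightarrow>\<^sub>E small_trees N.
          smult (?w C n T * ?c C n T D / ?a D) (bw_poly (rep D)))"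
        by (intro sum.cong refl sum.swap)
      finally show ?thesis by (simp only: sum.swap[of _ ?D])
    qed
    have "(\<Sum>C\<in>iso_classes_ge3 g. p C N) = (\<Sum>C\<in>iso_classes_ge3 g. \<Sum>D\<in>?D.
        \<Sum>n\<in>tuples_upto (rep C) (3 * N). \<Sum>T\<in>verts (subdivide (rep C) n) \<rightarrow>\<^sub>E small_trees N.
          smult (?w C n T * ?c C n T D / ?a D) (bw_poly (rep D)))"
      by (intro sum.cong refl p)
    also have "\<dots> = (\<Sum>D\<in>?D. \<Sum>C\<in>iso_classes_ge3 g.
        \<Sum>n\<in>tuples_upto (rep C) (3 * N). \<Sum>T\<in>verts (subdivide (rep C) n) \<rightarrow>\<^sub>E small_trees N.
          smult (?w C n T * ?c C n T D / ?a D) (bw_poly (rep D)))"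
      by (rule sum.swap)
    \<comment> \<open>For each class \<open>D\<close> the inner weights add up to 1 by
      \<open>graft_mass\<close>, and only the factor from spreading over classes remains.\<close>
    also have "\<dots> = (\<Sum>D\<in>?D. smult (1 / ?a D) (bw_poly (rep D)))"
    proof (rule sum.cong[OF refl])
      fix D assume D: "D \<in> ?D"
      then have r: "finite_graph (rep D)" "connected_graph (rep D)" "betti (rep D) = int g"
        using iso_classes_rep by auto
      have N: "card (verts (rep D)) = N" using D by simp
      show "(\<Sum>C\<in>iso_classes_ge3 g. \<Sum>n\<in>tuples_upto (rep C) (3 * N).
          \<Sum>T\<in>verts (subdivide (rep C) n) \<rightarrow>\<^sub>E small_trees N.
          smult (?w C n T * ?c C n T D / ?a D) (bw_poly (rep D))) = smult (1 / ?a D) (bw_poly (rep D))"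
        unfolding smult_sum[symmetric] sum_divide_distrib[symmetric] graft_mass[OF r N assms] ..
    qed
    finally have "(\<Sum>D\<in>?D. smult (1 / ?a D) (bw_poly (rep D))) = (\<Sum>C\<in>iso_classes_ge3 g. p C N)" ..
    then show "fps_to_ratfun (W_series g) $ N = (\<Sum>C\<in>iso_classes_ge3 g. X_series (rep C)) $ N"
      by (simp add: fps_to_ratfun_def W_series_def fps_sum_nth X flip: to_fract_sum)
  qed
qed

end
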